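(* Let $D$ be a division ring with center $F$ and let $d$ be a positive integer. Assume that $N$ is a noncentral normal subgroup of $D^*$ (that is, $N\not\subseteq F$). If $N$ is algebraic of bounded degree $d$ over $F$, then $[D:F]\le d^2$.
   Context: $D^*$ denotes the multiplicative group of $D$, and $[D:F]$ the dimension of $D$ as a vector space over $F$. A subset $S\subseteq D$ is algebraic of bounded degree $d$ over $F$ if every $a\in S$ is algebraic over $F$ with $[F(a):F]\le d$. *)

theory Defs
  imports "HOL-Algebra.Algebra"
begin

locale skew_field = ring +
  assumes one_not_zero: "\<one> \<noteq> \<zero>"
    and skew_field_Units: "Units R = carrier R - {\<zero>}"

definition ring_center :: "('a, 'b) ring_scheme \<Rightarrow> 'a set"
  where "ring_center R = {z \<in> carrier R. \<forall>x \<in> carrier R. z \<otimes>\<^bsub>R\<^esub> x = x \<otimes>\<^bsub>R\<^esub> z}"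

(* K(a) is generate_field R (insert a K), the closure of K and a under the ring operations
   and inverses of nonzero elements.  It is a subfield when K is central
   (generate_field_center_subfield below), although R need not be commutative.
   Since dim is a definite description, it is always accompanied by finite_dimension. *)
definition (in ring) algebraic_of_bounded_degree :: "'a set \<Rightarrow> nat \<Rightarrow> 'a set \<Rightarrow> bool"
  where "algebraic_of_bounded_degree K d S \<longleftrightarrow>
    (\<forall>a \<in> S. (algebraic over K) a \<and>
      finite_dimension K (generate_field R (insert a K)) \<and>
      (dim over K) (generate_field R (insert a K)) \<le> d)"

lemma (in ring) mult_commute_closed:
  assumes "a \<in> carrier R" "b \<in> carrier R" "y \<in> carrier R"
    and "a \<otimes> y = y \<otimes> a" "b \<otimes> y = y \<otimes> b"
  shows "a \<otimes> b \<otimes> y = y \<otimes> (a \<otimes> b)"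
proof -
  have "a \<otimes> b \<otimes> y = a \<otimes> (b \<otimes> y)" using assms by (rule_tac m_assoc)
  also have "\<dots> = a \<otimes> (y \<otimes> b)" using assms by simp
  also have "\<dots> = a \<otimes> y \<otimes> b" using assms by (rule_tac m_assoc[symmetric])
  also have "\<dots> = y \<otimes> a \<otimes> b" using assms by simp
  also have "\<dots> = y \<otimes> (a \<otimes> b)" using assms by (rule_tac m_assoc)
  finally show ?thesis .
qed

lemma (in skew_field) inv_commute:
  assumes "x \<in> carrier R" "x \<noteq> \<zero>" "y \<in> carrier R" "x \<otimes> y = y \<otimes> x"
  shows "inv x \<otimes> y = y \<otimes> inv x"
proof -
  have u: "x \<in> Units R" using assms skew_field_Units by auto
  have i: "inv x \<in> carrier R" using u by simp
  have "inv x \<otimes> y = inv x \<otimes> (y \<otimes> x) \<otimes> inv x"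
    using u i assms by (simp add: m_assoc Units_r_inv)
  also have "\<dots> = inv x \<otimes> (x \<otimes> y) \<otimes> inv x" using assms by simp
  also have "\<dots> = y \<otimes> inv x"
    using u i assms(1,3) by (metis Units_l_inv l_one m_assoc m_closed)
  finally show ?thesis .
qed

lemma (in skew_field) subfieldI_skew:
  assumes "subring K R"
    and "\<And>x y. x \<in> K \<Longrightarrow> y \<in> K \<Longrightarrow> x \<otimes> y = y \<otimes> x"
    and "\<And>x. x \<in> K \<Longrightarrow> x \<noteq> \<zero> \<Longrightarrow> inv x \<in> K"
  shows "subfield K R"
proof -
  note sub = subringE[OF assms(1)]
  have U: "x \<in> Units R" if "x \<in> K" "x \<noteq> \<zero>" for x
    using that sub(1) skew_field_Units by auto
  show ?thesis
  proof (intro subfield.intro subdomain.intro subcring.intro subfield_axioms.intro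
      subdomain_axioms.intro subcring_axioms.intro assms(1) one_not_zero)
    show "h1 \<otimes> h2 = h2 \<otimes> h1" if "h1 \<in> K" "h2 \<in> K" for h1 h2
      using that assms(2) by blast
    show "h1 = \<zero> \<or> h2 = \<zero>" if "h1 \<in> K" "h2 \<in> K" "h1 \<otimes> h2 = \<zero>" for h1 h2
    proof (rule ccontr)
      assume "\<not> (h1 = \<zero> \<or> h2 = \<zero>)"
      then have "h1 \<otimes> h2 \<in> Units R" using U that(1,2) by blast
      then show False using that(3) skew_field_Units by simp
    qed
    show "Units (R\<lparr>carrier := K\<rparr>) = K - {\<zero>}"
    proof
      show "Units (R\<lparr>carrier := K\<rparr>) \<subseteq> K - {\<zero>}"
        using one_not_zero sub(1) unfolding Units_def by force
      show "K - {\<zero>} \<subseteq> Units (R\<lparr>carrier := K\<rparr>)"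
      proof
        fix x assume "x \<in> K - {\<zero>}"
        then show "x \<in> Units (R\<lparr>carrier := K\<rparr>)"
          using U[of x] assms(3)[of x] unfolding Units_def[of "R\<lparr>carrier := K\<rparr>"]
          by (auto intro!: bexI[of _ "inv x"])
      qed
    qed
  qed
qed

lemma (in skew_field) center_subfield: "subfield (ring_center R) R"
proof (rule subfieldI_skew)
  show "subring (ring_center R) R"
  proof (rule subringI)
    show "h1 \<otimes> h2 \<in> ring_center R" if "h1 \<in> ring_center R" "h2 \<in> ring_center R" for h1 h2
      using that mult_commute_closed[of h1 h2] unfolding ring_center_def by blast
  qed (auto simp: ring_center_def l_distr r_distr l_minus r_minus)
  show "inv x \<in> ring_center R" if "x \<in> ring_center R" "x \<noteq> \<zero>" for x
    using that inv_commute[of x] skew_field_Units by (auto simp: ring_center_def)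
  show "x \<otimes> y = y \<otimes> x" if "x \<in> ring_center R" "y \<in> ring_center R" for x y
    using that unfolding ring_center_def by blast
qed

lemma (in skew_field) generate_field_closed:
  assumes "H \<subseteq> carrier R" "h \<in> generate_field R H"
  shows "h \<in> carrier R"
  using assms(2)
proof (induction rule: generate_field.induct)
  case (m_inv h)
  then show ?case using skew_field_Units by auto
qed (use assms(1) in auto)

lemma (in skew_field) generate_field_commute:
  assumes "H \<subseteq> carrier R" "y \<in> carrier R" "\<And>h. h \<in> H \<Longrightarrow> h \<otimes> y = y \<otimes> h"
    and "x \<in> generate_field R H"
  shows "x \<otimes> y = y \<otimes> x"
  using assms(4)
proof (induction rule: generate_field.induct)
  case (m_inv h)
  then show ?case using inv_commute generate_field_closed[OF assms(1)] assms(2) by blast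
next
  case (eng_mult h1 h2)
  then show ?case
    using mult_commute_closed generate_field_closed[OF assms(1)] assms(2) by blast
next
  case (eng_add h1 h2)
  then show ?case
    using generate_field_closed[OF assms(1)] assms(2) by (simp add: l_distr r_distr)
next
  case (a_inv h)
  then show ?case
    using generate_field_closed[OF assms(1)] assms(2) by (simp add: l_minus r_minus)
qed (use assms(2,3) in auto)

lemma (in skew_field) generate_field_center_subfield:
  assumes a: "a \<in> carrier R"
  shows "subfield (generate_field R (insert a (ring_center R))) R"
proof -
  let ?H = "insert a (ring_center R)"
  have H: "?H \<subseteq> carrier R" using a by (auto simp: ring_center_def)
  have z: "z \<otimes> x = x \<otimes> z" if "z \<in> ring_center R" "x \<in> carrier R" for z x
    using that unfolding ring_center_def by blast
  have c1: "h \<otimes> k = k \<otimes> h" if "h \<in> ?H" "k \<in> ?H" for h k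
  proof (cases "h = a")
    case True
    then show ?thesis using that(2) z[of k a] a by (cases "k = a") simp_all
  next
    case False
    then show ?thesis using that z[of h k] H by blast
  qed
  have c2: "k \<otimes> x = x \<otimes> k" if "x \<in> generate_field R ?H" "k \<in> ?H" for x k
    using generate_field_commute[OF H subsetD[OF H that(2)] c1[OF _ that(2)] that(1)] by simp
  show ?thesis
  proof (rule subfieldI_skew)
    show "subring (generate_field R ?H) R"
      by (rule subringI)
        (auto intro: generate_field.intros generate_field_closed[OF H])
    show "x \<otimes> y = y \<otimes> x" if "x \<in> generate_field R ?H" "y \<in> generate_field R ?H" for x y
      using generate_field_commute[OF H generate_field_closed[OF H that(2)] _ that(1)]
        c2[OF that(2)] by blast
  qed (auto intro: generate_field.m_inv)
qed

end

(* Suppose first that the center F is infinite, and choose a in N whose powers 1, a, ..., a^(m-1)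
   are F-independent with m maximal, so that P(a) = 0 for a polynomial P of degree m over F. For b
   in N, the elements a_t = (1 + t x) b (1 + t x)^-1 b^-1 a of N deform a, and by maximality the
   powers 1, a_t, ..., a_t^m are dependent for all admissible t in F. Independence of rational
   functions of t at t = 0 spreads to almost all t, so the derivative of P at a in the direction
   [x, b] b^-1 a lies in F[a]. Hence the set of b for which the derivative Phi of P at a maps
   all [x, b] to the double centralizer of a is a division subring containing N; its conjugation
   invariant core is everything by the Cartan-Brauer-Hua theorem. As Phi maps D onto the
   centralizer C of a and is C-bilinear, commutators of C are central in C, which forces C to be
   commutative and then C = F(a). Artin's argument bounds the left dimension of D over C by m.

   If F is finite, every element of N has finite order, with boundedly many orders. A noncentral
   a in N is conjugate by some x to a different power of itself. If x has infinite order, a power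
   of x yields infinitely many points t centralizing a and x, and differentiating
   ((1 + t x) a (1 + t x)^-1 a^-1)^M = 1 at t = 0 shows that x and a commute. If x has finite
   order, a and x generate a finite division ring, and a Hilbert 90 count produces c with
   (c x)^r = 1, contradicting the independence of the powers of c x, as in Wedderburn's theorem. *)

theory Submission
  imports Defs
begin

context ring
begin

lemma finsum_lessThan_Suc:
  assumes "\<And>i. i \<le> n \<Longrightarrow> f i \<in> carrier R"
  shows "(\<Oplus>i\<in>{..<Suc n}. f i) = (\<Oplus>i\<in>{..<n}. f i) \<oplus> f n"
proof -
  have "(\<Oplus>i\<in>{..<Suc n}. f i) = f n \<oplus> (\<Oplus>i\<in>{..<n}. f i)"
    unfolding lessThan_Suc using assms by (intro finsum_insert) auto
  then show ?thesis using assms by (simp add: a_comm Pi_def)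
qed

lemma combine_map_upt:
  assumes "\<And>i. i < n \<Longrightarrow> g i \<in> carrier R" "\<And>i. i < n \<Longrightarrow> v i \<in> carrier R"
  shows "combine (map g [0..<n]) (map v [0..<n]) = (\<Oplus>i\<in>{..<n}. g i \<otimes> v i)"
  using assms
proof (induction n)
  case (Suc n)
  have "combine (map g [0..<n] @ [g n]) (map v [0..<n] @ [v n])
      = combine (map g [0..<n]) (map v [0..<n]) \<oplus> combine [g n] [v n]"
    using Suc.prems by (intro combine_append[symmetric]) auto
  with Suc show ?case by (simp add: finsum_lessThan_Suc)
qed simp

inductive_set mult_ops :: "('a \<Rightarrow> 'a) set" where
  mult_ops_id: "(\<lambda>y. y) \<in> mult_ops"
| mult_ops_add: "L \<in> mult_ops \<Longrightarrow> M \<in> mult_ops \<Longrightarrow> (\<lambda>y. L y \<oplus> M y) \<in> mult_ops"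
| mult_ops_left: "L \<in> mult_ops \<Longrightarrow> \<alpha> \<in> carrier R \<Longrightarrow> (\<lambda>y. \<alpha> \<otimes> L y) \<in> mult_ops"
| mult_ops_right: "L \<in> mult_ops \<Longrightarrow> \<alpha> \<in> carrier R \<Longrightarrow> (\<lambda>y. L y \<otimes> \<alpha>) \<in> mult_ops"

lemma mult_op_closed: "L \<in> mult_ops \<Longrightarrow> y \<in> carrier R \<Longrightarrow> L y \<in> carrier R"
  by (induction rule: mult_ops.induct) auto

lemma mult_op_add:
  "L \<in> mult_ops \<Longrightarrow> x \<in> carrier R \<Longrightarrow> y \<in> carrier R \<Longrightarrow> L (x \<oplus> y) = L x \<oplus> L y"
  by (induction rule: mult_ops.induct)
    (simp_all add: mult_op_closed l_distr r_distr a_ac)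

lemma ring_centerD:
  "z \<in> ring_center R \<Longrightarrow> z \<in> carrier R"
  "z \<in> ring_center R \<Longrightarrow> x \<in> carrier R \<Longrightarrow> z \<otimes> x = x \<otimes> z"
  unfolding ring_center_def by auto

lemma mult_op_smult:
  assumes "L \<in> mult_ops" "z \<in> ring_center R" "y \<in> carrier R"
  shows "L (z \<otimes> y) = z \<otimes> L y"
  using assms(1)
proof (induction rule: mult_ops.induct)
  case (mult_ops_left L \<alpha>)
  then show ?case
    using assms(3) ring_centerD(1)[OF assms(2)] ring_centerD(2)[OF assms(2) mult_ops_left(2)]
    by (simp add: mult_op_closed m_assoc[symmetric])
qed (use assms ring_centerD[OF assms(2)] in \<open>simp_all add: mult_op_closed r_distr m_assoc\<close>)

lemma mult_op_zero: "L \<in> mult_ops \<Longrightarrow> L \<zero> = \<zero>"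
  by (induction rule: mult_ops.induct) auto

end

context skew_field
begin

lemma Units_iff: "x \<in> Units R \<longleftrightarrow> x \<in> carrier R \<and> x \<noteq> \<zero>"
  using skew_field_Units by auto

lemma inv_nz [simp]:
  assumes "x \<in> carrier R" "x \<noteq> \<zero>"
  shows "inv x \<in> carrier R" "inv x \<otimes> x = \<one>" "x \<otimes> inv x = \<one>" "inv x \<noteq> \<zero>"
proof -
  have "x \<in> Units R" using assms by (simp add: Units_iff)
  then show "inv x \<in> carrier R" "inv x \<otimes> x = \<one>" "x \<otimes> inv x = \<one>" by auto
  then show "inv x \<noteq> \<zero>" using assms one_not_zero by auto
qed

lemma inv_cancel [simp]:
  assumes "x \<in> carrier R" "x \<noteq> \<zero>" "y \<in> carrier R"
  shows "inv x \<otimes> (x \<otimes> y) = y" "x \<otimes> (inv x \<otimes> y) = y"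
  using assms by (simp_all add: m_assoc[symmetric])

lemma mult_zero_iff [simp]:
  assumes "x \<in> carrier R" "y \<in> carrier R"
  shows "x \<otimes> y = \<zero> \<longleftrightarrow> x = \<zero> \<or> y = \<zero>"
  using assms by (metis inv_cancel(1) inv_nz(1) l_null r_null)

lemma mult_left_cancel:
  assumes "x \<in> carrier R" "x \<noteq> \<zero>" "y \<in> carrier R" "z \<in> carrier R" "x \<otimes> y = x \<otimes> z"
  shows "y = z"
  using assms by (metis inv_cancel(1))

lemma mult_right_cancel:
  assumes "x \<in> carrier R" "x \<noteq> \<zero>" "y \<in> carrier R" "z \<in> carrier R" "y \<otimes> x = z \<otimes> x"
  shows "y = z"
  using assms by (metis inv_nz(1,3) m_assoc r_one)

lemma minus_zero_iff:
  assumes "x \<in> carrier R" "y \<in> carrier R"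
  shows "x \<ominus> y = \<zero> \<longleftrightarrow> x = y"
  using assms by (simp add: r_right_minus_eq)

lemma mult_op_separates:
  assumes "set Us \<subseteq> carrier R" "v \<in> carrier R" "v \<notin> Span (ring_center R) Us"
  shows "\<exists>L \<in> mult_ops. L v = \<one> \<and> (\<forall>u \<in> set Us. L u = \<zero>)"
  using assms
proof (induction Us arbitrary: v)
  case Nil
  then show ?case
    by (intro bexI[of _ "\<lambda>y. inv v \<otimes> y"]) (auto intro: mult_ops.intros)
next
  case (Cons u Us)
  let ?F = "ring_center R"
  note F = center_subfield
  have u: "u \<in> carrier R" and Us: "set Us \<subseteq> carrier R" using Cons.prems by auto
  have "v \<notin> Span ?F Us" using mono_Span[OF F Us u] Cons.prems by blast
  from Cons.IH[OF Us Cons.prems(2) this] obtain L where L: "L \<in> mult_ops" "L v = \<one>"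
    "\<And>x. x \<in> set Us \<Longrightarrow> L x = \<zero>" by blast
  note [simp] = mult_op_closed[OF L(1)] u Cons.prems(2)
  have *: ?case if "M \<in> mult_ops" "M v = \<zero>" "M u = \<one>" "\<And>x. x \<in> set Us \<Longrightarrow> M x = \<zero>" for M
    using that L Us
    by (intro bexI[of _ "\<lambda>y. L y \<oplus> (\<ominus> L u) \<otimes> M y"])
      (auto intro!: mult_ops.intros simp: r_neg)
  show ?case
  proof (cases "L u \<in> ?F")
    case False
    then obtain y where y: "y \<in> carrier R" "L u \<otimes> y \<noteq> y \<otimes> L u"
      unfolding ring_center_def by auto
    define d where "d = y \<otimes> L u \<oplus> \<ominus> (L u \<otimes> y)"
    have d: "d \<in> carrier R" "d \<noteq> \<zero>"
      using y minus_zero_iff[of "y \<otimes> L u" "L u \<otimes> y"]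
      by (auto simp: d_def l_minus a_minus_def)
    define M where "M x = inv d \<otimes> (y \<otimes> L x \<oplus> (\<ominus> \<one>) \<otimes> (L x \<otimes> y))" for x
    have M: "M \<in> mult_ops"
      unfolding M_def using L(1) y(1) d by (intro mult_ops.intros) auto
    show ?thesis
    proof (rule *[OF M])
      show "M v = \<zero>" using L(2) y(1) d by (simp add: M_def l_minus r_neg)
      show "M u = \<one>" using y(1) d by (simp add: M_def l_minus d_def[symmetric])
      show "M x = \<zero>" if "x \<in> set Us" for x using L(3)[OF that] y(1) d by (simp add: M_def)
    qed
  next
    case True
    show ?thesis
    proof (cases "L u = \<zero>")
      case True
      then show ?thesis using L by auto
    next
      case nz: False
      define w where "w = u \<ominus> L u \<otimes> v"
      have w: "w \<in> carrier R" "u = w \<oplus> L u \<otimes> v"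
        by (simp_all add: w_def a_minus_def a_assoc l_neg)
      have "w \<notin> Span ?F Us"
      proof
        assume "w \<in> Span ?F Us"
        then have a: "\<ominus> w \<in> Span ?F Us" using Span_subgroup_props(4)[OF F Us] by blast
        have "L u \<otimes> v = \<one> \<otimes> u \<oplus> (\<ominus> w)" by (simp add: w_def a_minus_def minus_add r_neg2)
        then have "L u \<otimes> v \<in> line_extension ?F u (Span ?F Us)"
          unfolding line_extension_mem_iff
          using a subringE(3)[OF subfieldE(1)[OF F]] by blast
        then have "L u \<otimes> v \<in> Span ?F (u # Us)" by simp
        then show False
          using Span_m_inv_simprule[OF F, of "u # Us" "L u" v] Cons.prems True nz by auto
      qed
      from Cons.IH[OF Us w(1) this] obtain G where G: "G \<in> mult_ops" "G w = \<one>"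
        "\<And>x. x \<in> set Us \<Longrightarrow> G x = \<zero>" by blast
      note [simp] = mult_op_closed[OF G(1)] w(1)
      have "G u = G w \<oplus> L u \<otimes> G v"
        using mult_op_add[OF G(1), of w "L u \<otimes> v"] mult_op_smult[OF G(1) True, of v]
        by (simp add: w(2)[symmetric])
      then have "G u \<oplus> (\<ominus> G v) \<otimes> L u = \<one>"
        using G(2) ring_centerD(2)[OF True, of "G v"] by (simp add: l_minus a_assoc r_neg)
      then show ?thesis
        using G L Us
        by (intro *[of "\<lambda>x. G x \<oplus> (\<ominus> G v) \<otimes> L x"])
          (auto intro!: mult_ops.intros simp: r_neg)
    qed
  qed
qed

lemma exists_left_relation:
  assumes "finite I" "m < card I" "\<forall>i k. A i k \<in> carrier R"
  shows "\<exists>d. (\<forall>i. d i \<in> carrier R) \<and> (\<exists>i \<in> I. d i \<noteq> \<zero>) \<and>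
    (\<forall>k < m. (\<Oplus>i\<in>I. d i \<otimes> A i k) = \<zero>)"
  using assms
proof (induction m arbitrary: I A)
  case 0
  then have "I \<noteq> {}" by auto
  then show ?case using one_not_zero by (intro exI[of _ "\<lambda>_. \<one>"]) auto
next
  case (Suc m)
  show ?case
  proof (cases "\<forall>i \<in> I. A i m = \<zero>")
    case True
    obtain d where d: "\<And>i. d i \<in> carrier R" "\<exists>i \<in> I. d i \<noteq> \<zero>"
      "\<forall>k < m. (\<Oplus>i\<in>I. d i \<otimes> A i k) = \<zero>"
      using Suc.IH[of I A] Suc.prems by auto
    have "(\<Oplus>i\<in>I. d i \<otimes> A i m) = (\<Oplus>i\<in>I. \<zero>)"
      using True d(1) by (intro finsum_cong') auto
    then show ?thesis using d by (intro exI[of _ d]) (auto simp: less_Suc_eq)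
  next
    case False
    then obtain j where j: "j \<in> I" "A j m \<noteq> \<zero>" by auto
    define J where "J = I - {j}"
    have J: "finite J" "j \<notin> J" "I = insert j J" "m < card J"
      using Suc.prems(1,2) j(1) by (auto simp: J_def)
    note [simp] = Suc.prems(3)[rule_format]
    define c where "c = inv (A j m)"
    have c[simp]: "c \<in> carrier R" "c \<otimes> A j m = \<one>" using j by (auto simp: c_def)
    define B where "B i k = A i k \<ominus> A i m \<otimes> c \<otimes> A j k" for i k
    obtain d where d[simp]: "\<And>i. d i \<in> carrier R" and d2: "\<exists>i \<in> J. d i \<noteq> \<zero>"
      and d3: "\<And>k. k < m \<Longrightarrow> (\<Oplus>i\<in>J. d i \<otimes> B i k) = \<zero>"
      using Suc.IH[of J B] J by (auto simp: B_def)
    define s where "s k = (\<Oplus>i\<in>J. d i \<otimes> A i k)" for k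
    have s[simp]: "s k \<in> carrier R" for k by (simp add: s_def)
    have B: "(\<Oplus>i\<in>J. d i \<otimes> B i k) = s k \<ominus> s m \<otimes> c \<otimes> A j k" for k
    proof -
      have "(\<Oplus>i\<in>J. d i \<otimes> B i k)
          = (\<Oplus>i\<in>J. d i \<otimes> A i k \<oplus> (d i \<otimes> A i m) \<otimes> (\<ominus> (c \<otimes> A j k)))"
        by (intro finsum_cong')
          (auto simp: B_def a_minus_def r_distr r_minus m_assoc)
      also have "\<dots> = s k \<oplus> s m \<otimes> (\<ominus> (c \<otimes> A j k))"
        unfolding s_def using J(1) by (subst finsum_addf) (auto simp: finsum_ldistr)
      finally show ?thesis by (simp add: a_minus_def r_minus m_assoc)
    qed
    define e where "e = d(j := \<ominus> (s m \<otimes> c))"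
    have e: "e i \<in> carrier R" for i by (simp add: e_def)
    have sum: "(\<Oplus>i\<in>I. e i \<otimes> A i k) = \<ominus> (s m \<otimes> c) \<otimes> A j k \<oplus> s k" for k
    proof -
      have "(\<Oplus>i\<in>J. e i \<otimes> A i k) = s k"
        unfolding s_def using J(2) by (intro finsum_cong') (auto simp: e_def)
      then show ?thesis using J e by (simp add: e_def)
    qed
    have "(\<Oplus>i\<in>I. e i \<otimes> A i k) = \<zero>" if "k < Suc m" for k
    proof (cases "k = m")
      case True
      then show ?thesis by (simp add: sum l_minus m_assoc l_neg)
    next
      case False
      then have "s k \<ominus> s m \<otimes> c \<otimes> A j k = \<zero>" using B[of k] d3[of k] that by simp
      then show ?thesis by (simp add: sum l_minus a_minus_def a_comm)
    qed
    moreover have "\<exists>i \<in> I. e i \<noteq> \<zero>" using d2 J by (auto simp: e_def)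
    ultimately show ?thesis using e by blast
  qed
qed

lemma vandermonde_zero:
  fixes s z :: "nat \<Rightarrow> 'a"
  assumes "\<And>i. s i \<in> carrier R" "\<And>i. z i \<in> carrier R"
    and "\<And>i j. s i \<otimes> s j = s j \<otimes> s i" "inj_on s {..<n}"
    and "\<And>k::nat. (\<Oplus>i\<in>{..<n}. s i [^] k \<otimes> z i) = \<zero>" "i < n"
  shows "z i = \<zero>"
  using assms(2,4-)
proof (induction n arbitrary: z i)
  case (Suc n)
  note [simp] = assms(1) Suc.prems(1)
  define y where "y i = (s i \<ominus> s n) \<otimes> z i" for i
  have sn: "s i [^] k \<otimes> s n = s n \<otimes> s i [^] k" for i and k :: nat
    using assms(3) by (simp add: pow_mult_distrib nat_pow_comm group_commutes_pow)
  have y: "(\<Oplus>i\<in>{..<n}. s i [^] k \<otimes> y i) = \<zero>" for k :: nat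
  proof -
    have eq: "s i [^] k \<otimes> y i = s i [^] Suc k \<otimes> z i \<oplus> \<ominus> s n \<otimes> (s i [^] k \<otimes> z i)" for i and k :: nat
      using sn[of i k] unfolding y_def
      by (simp add: a_minus_def l_distr r_distr l_minus r_minus m_assoc[symmetric])
    have "(\<Oplus>i\<in>{..<n}. s i [^] k \<otimes> y i) = (\<Oplus>i\<in>{..<Suc n}. s i [^] k \<otimes> y i)"
      by (subst finsum_lessThan_Suc) (auto simp: y_def r_neg a_minus_def)
    also have "\<dots> = (\<Oplus>i\<in>{..<Suc n}. s i [^] Suc k \<otimes> z i)
        \<oplus> (\<Oplus>i\<in>{..<Suc n}. \<ominus> s n \<otimes> (s i [^] k \<otimes> z i))"
      unfolding eq by (intro finsum_addf) auto
    also have "(\<Oplus>i\<in>{..<Suc n}. \<ominus> s n \<otimes> (s i [^] k \<otimes> z i)) = \<zero>"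
      using Suc.prems(3)[of k] by (subst finsum_rdistr[symmetric]) auto
    finally show ?thesis using Suc.prems(3)[of "Suc k"] by simp
  qed
  have "z i = \<zero>" if "i < n" for i
  proof -
    have "y i = \<zero>"
      using Suc.IH[of y i] y that Suc.prems(2) by (auto simp: y_def inj_on_def)
    moreover have "s i \<ominus> s n \<noteq> \<zero>"
      using Suc.prems(2) that minus_zero_iff by (auto dest: inj_onD)
    ultimately show ?thesis by (simp add: y_def)
  qed
  moreover from this have "z n = \<zero>"
  proof -
    have "(\<Oplus>i\<in>{..<n}. z i) = (\<Oplus>i\<in>{..<n}. \<zero>)"
      using \<open>\<And>i. i < n \<Longrightarrow> z i = \<zero>\<close> by (intro finsum_cong') auto
    then show ?thesis using Suc.prems(3)[of 0] by (simp add: finsum_lessThan_Suc)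
  qed
  ultimately show ?case using Suc.prems(4) by (cases "i = n") auto
qed simp

lemma mult_op_combine:
  assumes "M \<in> mult_ops" "set Ks \<subseteq> ring_center R" "set Us \<subseteq> carrier R"
  shows "combine Ks (map M Us) = M (combine Ks Us)"
  using assms(2,3)
proof (induction Ks Us rule: combine.induct)
  case (1 k Ks u Us)
  then have "k \<in> carrier R" "combine Ks Us \<in> carrier R"
    using ring_centerD(1) by (auto intro!: combine_in_carrier)
  with 1 show ?case
    using mult_op_add[OF assms(1)] mult_op_smult[OF assms(1)] by simp
qed (simp_all add: mult_op_zero[OF assms(1)])

lemma independent_mult_op:
  assumes "M \<in> mult_ops" "set Us \<subseteq> carrier R" "independent (ring_center R) (map M Us)"
  shows "independent (ring_center R) Us"
    and "y \<in> Span (ring_center R) Us \<Longrightarrow> M y = \<zero> \<Longrightarrow> y = \<zero>"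
proof -
  note F = center_subfield
  have *: "set (take (length Us) Ks) \<subseteq> {\<zero>}"
    if "set Ks \<subseteq> ring_center R" "M (combine Ks Us) = \<zero>" for Ks
    using independent_imp_trivial_combine[OF F assms(3) that(1)]
      mult_op_combine[OF assms(1) that(1) assms(2)] that(2) by simp
  show "independent (ring_center R) Us"
    using * mult_op_zero[OF assms(1)] by (intro trivial_combine_imp_independent[OF F assms(2)]) auto
  assume "y \<in> Span (ring_center R) Us" "M y = \<zero>"
  then obtain Ks where Ks: "set Ks \<subseteq> ring_center R" "length Ks = length Us" "y = combine Ks Us"
    using Span_mem_iff_length_version[OF F assms(2)] by blast
  then have "set Ks \<subseteq> {\<zero>}" using *[of Ks] \<open>M y = \<zero>\<close> by simp
  then have "Ks = replicate (length Us) \<zero>"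
    using Ks(2) by (intro replicate_eqI) auto
  then show "y = \<zero>" using Ks(3) combine_replicate[OF assms(2)] by simp
qed

end

section \<open>Evaluation at infinitely many central points\<close>

locale central_evaluation = skew_field +
  fixes T :: "'a set"
  assumes T_center: "T \<subseteq> ring_center R" and T_infinite: "infinite T" and zero_T: "\<zero> \<in> T"
begin

lemma T_closed [simp]: "t \<in> T \<Longrightarrow> t \<in> carrier R"
  using T_center ring_centerD(1) by blast

lemma T_comm: "t \<in> T \<Longrightarrow> x \<in> carrier R \<Longrightarrow> x \<otimes> t = t \<otimes> x"
  using T_center ring_centerD(2)[of t x] by auto

lemma T_lcomm: "t \<in> T \<Longrightarrow> x \<in> carrier R \<Longrightarrow> y \<in> carrier R \<Longrightarrow> x \<otimes> (t \<otimes> y) = t \<otimes> (x \<otimes> y)"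
  using T_comm[of t x] by (simp add: m_assoc[symmetric])

text \<open>Polynomials and rational functions in a central variable are represented by their values on
  \<^term>\<open>T\<close>.  \<^term>\<open>pol n f\<close> is the Horner form of degree less than \<^term>\<open>n\<close>; the denominators of
  rational functions stand on the left and do not vanish at \<^term>\<open>\<zero>\<close>, but may vanish at other
  points of \<^term>\<open>T\<close>.\<close>

primrec pol :: "nat \<Rightarrow> ('a \<Rightarrow> 'a) \<Rightarrow> bool" where
  "pol 0 f \<longleftrightarrow> (\<forall>t \<in> T. f t = \<zero>)"
| "pol (Suc n) f \<longleftrightarrow> (\<exists>c \<in> carrier R. \<exists>g. pol n g \<and> (\<forall>t \<in> T. f t = c \<oplus> t \<otimes> g t))"

lemma pol_closed: "pol n f \<Longrightarrow> t \<in> T \<Longrightarrow> f t \<in> carrier R"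
  by (induction n arbitrary: f) auto

lemma pol_cong: "pol n f \<Longrightarrow> (\<And>t. t \<in> T \<Longrightarrow> g t = f t) \<Longrightarrow> pol n g"
  by (induction n arbitrary: f) auto

lemma pol_add: "pol n f \<Longrightarrow> pol n g \<Longrightarrow> pol n (\<lambda>t. f t \<oplus> g t)"
proof (induction n arbitrary: f g)
  case (Suc n)
  then obtain c f1 d g1 where *: "c \<in> carrier R" "pol n f1" "\<And>t. t \<in> T \<Longrightarrow> f t = c \<oplus> t \<otimes> f1 t"
    "d \<in> carrier R" "pol n g1" "\<And>t. t \<in> T \<Longrightarrow> g t = d \<oplus> t \<otimes> g1 t" by auto
  have "f t \<oplus> g t = (c \<oplus> d) \<oplus> t \<otimes> (f1 t \<oplus> g1 t)" if "t \<in> T" for t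
    using * that pol_closed[OF *(2) that] pol_closed[OF *(5) that] by (simp add: r_distr a_ac)
  then show ?case using Suc.IH[OF *(2,5)] *(1,4) by auto
qed auto

lemma pol_lmult: "pol n f \<Longrightarrow> c \<in> carrier R \<Longrightarrow> pol n (\<lambda>t. c \<otimes> f t)"
proof (induction n arbitrary: f)
  case (Suc n)
  then obtain d f1 where *: "d \<in> carrier R" "pol n f1" "\<And>t. t \<in> T \<Longrightarrow> f t = d \<oplus> t \<otimes> f1 t" by auto
  have "c \<otimes> f t = c \<otimes> d \<oplus> t \<otimes> (c \<otimes> f1 t)" if "t \<in> T" for t
    using * that pol_closed[OF *(2) that] Suc.prems(2) by (simp add: r_distr T_lcomm[OF that])
  then show ?case using Suc.IH[OF *(2)] *(1) Suc.prems(2) by auto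
qed auto

lemma pol_shift: "pol n f \<Longrightarrow> pol (Suc n) (\<lambda>t. t \<otimes> f t)"
  by (auto intro!: bexI[of _ \<zero>] exI[of _ f] simp: pol_closed)

lemma pol_Suc: "pol n f \<Longrightarrow> pol (Suc n) f"
proof (induction n arbitrary: f)
  case 0
  then show ?case by (auto intro!: bexI[of _ \<zero>] exI[of _ "\<lambda>_. \<zero>"])
next
  case (Suc n)
  then obtain c g where "c \<in> carrier R" "pol n g" "\<forall>t \<in> T. f t = c \<oplus> t \<otimes> g t" by auto
  with Suc.IH[of g] show ?case unfolding pol.simps(2)[of "Suc n"] by blast
qed

lemma pol_mono: "pol n f \<Longrightarrow> n \<le> m \<Longrightarrow> pol m f"
  by (induction m) (auto simp: le_Suc_eq simp del: pol.simps intro: pol_Suc)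

lemma pol_const: "c \<in> carrier R \<Longrightarrow> pol (Suc 0) (\<lambda>t. c)"
  by (auto intro!: bexI[of _ c] exI[of _ "\<lambda>_. \<zero>"])

lemma pol_mult: "pol n f \<Longrightarrow> pol m g \<Longrightarrow> pol (n + m) (\<lambda>t. f t \<otimes> g t)"
proof (induction n arbitrary: f)
  case 0
  then have "pol 0 (\<lambda>t. f t \<otimes> g t)" using pol_closed by auto
  then show ?case using pol_mono[of 0 _ m] by (simp del: pol.simps)
next
  case (Suc n)
  then obtain c f1 where *: "c \<in> carrier R" "pol n f1" "\<And>t. t \<in> T \<Longrightarrow> f t = c \<oplus> t \<otimes> f1 t" by auto
  have "pol (Suc n + m) (\<lambda>t. c \<otimes> g t)"
    by (rule pol_mono[OF pol_lmult[OF Suc.prems(2) *(1)]]) simp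
  moreover have "pol (Suc n + m) (\<lambda>t. t \<otimes> (f1 t \<otimes> g t))"
    using pol_shift[OF Suc.IH[OF *(2) Suc.prems(2)]] by (simp del: pol.simps)
  ultimately have "pol (Suc n + m) (\<lambda>t. c \<otimes> g t \<oplus> t \<otimes> (f1 t \<otimes> g t))" by (rule pol_add)
  then show ?case
    using * pol_closed[OF *(2)] pol_closed[OF Suc.prems(2)]
    by (elim pol_cong) (simp add: l_distr m_assoc)
qed

lemma pol_factor:
  assumes "pol (Suc n) f" "r \<in> T"
  shows "\<exists>g. pol n g \<and> (\<forall>t \<in> T. f t = f r \<oplus> (t \<ominus> r) \<otimes> g t)"
  using assms(1)
proof (induction n arbitrary: f)
  case 0
  then show ?case using assms(2) by (auto intro!: exI[of _ "\<lambda>_. \<zero>"])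
next
  case (Suc n)
  then obtain c f1 where f: "c \<in> carrier R" "pol (Suc n) f1" "\<And>t. t \<in> T \<Longrightarrow> f t = c \<oplus> t \<otimes> f1 t"
    by (auto simp del: pol.simps(2) simp: pol.simps(2)[of "Suc n"])
  from Suc.IH[OF f(2)] obtain g1
    where g1: "pol n g1" "\<And>t. t \<in> T \<Longrightarrow> f1 t = f1 r \<oplus> (t \<ominus> r) \<otimes> g1 t" by blast
  define g where "g t = f1 r \<oplus> t \<otimes> g1 t" for t
  have g: "pol (Suc n) g"
    using g1(1) pol_closed[OF f(2) assms(2)] by (auto simp: g_def)
  have "f t = f r \<oplus> (t \<ominus> r) \<otimes> g t" if t: "t \<in> T" for t
  proof -
    have [simp]: "f1 r \<in> carrier R" "g1 t \<in> carrier R" "t \<in> carrier R" "r \<in> carrier R"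
      using pol_closed f(2) g1(1) assms(2) t by (auto simp del: pol.simps)
    have c: "t \<otimes> ((t \<ominus> r) \<otimes> g1 t) = (t \<ominus> r) \<otimes> (t \<otimes> g1 t)"
      using t T_lcomm[OF t, of "t \<ominus> r"] by simp
    have "f t = c \<oplus> t \<otimes> (f1 r \<oplus> (t \<ominus> r) \<otimes> g1 t)" using f(3)[OF t] g1(2)[OF t] by simp
    also have "\<dots> = c \<oplus> (t \<otimes> f1 r \<oplus> (t \<ominus> r) \<otimes> (t \<otimes> g1 t))" using c f(1) by (simp add: r_distr)
    also have "\<dots> = (c \<oplus> r \<otimes> f1 r) \<oplus> (t \<ominus> r) \<otimes> g t"
    proof -
      have "(c \<oplus> r \<otimes> x) \<oplus> (t \<ominus> r) \<otimes> (x \<oplus> y) = c \<oplus> (t \<otimes> x \<oplus> (t \<ominus> r) \<otimes> y)"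
        if "x \<in> carrier R" "y \<in> carrier R" for x y
      proof -
        have "(t \<ominus> r) \<otimes> (x \<oplus> y) = t \<otimes> x \<oplus> (\<ominus> (r \<otimes> x) \<oplus> (t \<ominus> r) \<otimes> y)"
          using that by (simp add: r_distr l_distr a_minus_def l_minus a_assoc)
        then show ?thesis using that f(1) by (simp add: a_assoc a_lcomm[of "r \<otimes> x"] r_neg2)
      qed
      then show ?thesis unfolding g_def by simp
    qed
    finally show ?thesis using f(3)[OF assms(2)] by simp
  qed
  then show ?case using g by blast
qed

lemma pol_zeros:
  assumes "pol n f" "f \<zero> \<noteq> \<zero>"
  shows "finite {t \<in> T. f t = \<zero>}"
  using assms
proof (induction n arbitrary: f)
  case 0
  then show ?case using zero_T by simp
next
  case (Suc n)
  show ?case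
  proof (cases "\<exists>r \<in> T. f r = \<zero>")
    case True
    then obtain r where r: "r \<in> T" "f r = \<zero>" by blast
    from pol_factor[OF Suc.prems(1) r(1)] obtain g
      where g: "pol n g" "\<And>t. t \<in> T \<Longrightarrow> f t = f r \<oplus> (t \<ominus> r) \<otimes> g t" by blast
    have g': "f t = (t \<ominus> r) \<otimes> g t" if "t \<in> T" for t
      using g(2)[OF that] r pol_closed[OF g(1) that] that by simp
    have "g \<zero> \<noteq> \<zero>" using g'[OF zero_T] Suc.prems(2) zero_T r by auto
    then have "finite {t \<in> T. g t = \<zero>}" by (rule Suc.IH[OF g(1)])
    moreover have "{t \<in> T. f t = \<zero>} \<subseteq> insert r {t \<in> T. g t = \<zero>}"
      using g' pol_closed[OF g(1)] r(1) by (auto simp: minus_zero_iff)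
    ultimately show ?thesis by (meson finite.insertI finite_subset)
  next
    case False
    then have "{t \<in> T. f t = \<zero>} = {}" by blast
    then show ?thesis by (metis finite.emptyI)
  qed
qed

definition poly :: "('a \<Rightarrow> 'a) \<Rightarrow> bool" where
  "poly f \<longleftrightarrow> (\<exists>n. pol n f)"

lemma poly_closed: "poly f \<Longrightarrow> t \<in> T \<Longrightarrow> f t \<in> carrier R"
  unfolding poly_def using pol_closed by blast

lemma poly_add: "poly f \<Longrightarrow> poly g \<Longrightarrow> poly (\<lambda>t. f t \<oplus> g t)"
  unfolding poly_def by (metis pol_add pol_mono max.cobounded1 max.cobounded2)

lemma poly_mult: "poly f \<Longrightarrow> poly g \<Longrightarrow> poly (\<lambda>t. f t \<otimes> g t)"
  unfolding poly_def using pol_mult by blast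

lemma poly_const: "c \<in> carrier R \<Longrightarrow> poly (\<lambda>t. c)"
  unfolding poly_def using pol_const by blast

lemma poly_cong: "poly f \<Longrightarrow> (\<And>t. t \<in> T \<Longrightarrow> g t = f t) \<Longrightarrow> poly g"
  unfolding poly_def using pol_cong by blast

lemma poly_id: "poly (\<lambda>t. t)"
proof -
  have "pol (Suc (Suc 0)) (\<lambda>t. t \<otimes> \<one>)" by (intro pol_shift pol_const) simp
  then have "pol (Suc (Suc 0)) (\<lambda>t. t)" by (rule pol_cong) simp
  then show ?thesis unfolding poly_def by blast
qed

lemma poly_pow: "poly f \<Longrightarrow> poly (\<lambda>t. f t [^] (n::nat))"
  by (induction n) (auto intro: poly_const poly_mult)

lemma poly_finsum:
  assumes "finite I" "\<And>i. i \<in> I \<Longrightarrow> poly (f i)"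
  shows "poly (\<lambda>t. \<Oplus>i\<in>I. f i t)"
  using assms
proof (induction I)
  case empty
  then show ?case using poly_const[OF zero_closed] by simp
next
  case (insert x I)
  then have "poly (\<lambda>t. f x t \<oplus> (\<Oplus>i\<in>I. f i t))" by (intro poly_add) auto
  moreover have "(\<Oplus>i\<in>insert x I. f i t) = f x t \<oplus> (\<Oplus>i\<in>I. f i t)" if "t \<in> T" for t
    using insert that poly_closed by (intro finsum_insert) auto
  ultimately show ?case by (rule poly_cong)
qed

lemma pol_left_relation_coeffs:
  assumes "finite I" "\<forall>i \<in> I. pol n (f i)"
  shows "\<exists>A. (\<forall>i k. A i k \<in> carrier R) \<and> (\<forall>d. (\<forall>i. d i \<in> carrier R) \<longrightarrow>
    (\<forall>k < n. (\<Oplus>i\<in>I. d i \<otimes> A i k) = \<zero>) \<longrightarrow> (\<forall>t \<in> T. (\<Oplus>i\<in>I. d i \<otimes> f i t) = \<zero>))"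
  using assms(2)
proof (induction n arbitrary: f)
  case 0
  have "(\<Oplus>i\<in>I. d i \<otimes> f i t) = (\<Oplus>i\<in>I. \<zero>)" if "\<forall>i. d i \<in> carrier R" "t \<in> T" for d t
    using 0 that by (intro finsum_cong') auto
  then show ?case by (intro exI[of _ "\<lambda>_ _. \<zero>"]) auto
next
  case (Suc n)
  have "\<forall>i \<in> I. \<exists>p. fst p \<in> carrier R \<and> pol n (snd p) \<and>
      (\<forall>t \<in> T. f i t = fst p \<oplus> t \<otimes> snd p t)"
  proof
    fix i assume i: "i \<in> I"
    obtain c g where "c \<in> carrier R" "pol n g" "\<forall>t \<in> T. f i t = c \<oplus> t \<otimes> g t"
      using bspec[OF Suc.prems i] by auto
    then show "\<exists>p. fst p \<in> carrier R \<and> pol n (snd p) \<and> (\<forall>t \<in> T. f i t = fst p \<oplus> t \<otimes> snd p t)"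
      by (intro exI[of _ "(c, g)"]) simp
  qed
  then obtain p where "\<forall>i \<in> I. fst (p i) \<in> carrier R \<and> pol n (snd (p i)) \<and>
      (\<forall>t \<in> T. f i t = fst (p i) \<oplus> t \<otimes> snd (p i) t)"
    by (rule bchoice[THEN exE])
  then obtain c g where cg: "\<And>i. i \<in> I \<Longrightarrow> c i \<in> carrier R" "\<And>i. i \<in> I \<Longrightarrow> pol n (g i)"
    "\<And>i t. i \<in> I \<Longrightarrow> t \<in> T \<Longrightarrow> f i t = c i \<oplus> t \<otimes> g i t"
    using that[of "\<lambda>i. fst (p i)" "\<lambda>i. snd (p i)"] by simp
  have cg2: "\<forall>i \<in> I. pol n (g i)" using cg(2) by blast
  obtain A where A: "\<forall>i k. A i k \<in> carrier R" "\<forall>d. (\<forall>i. d i \<in> carrier R) \<longrightarrow>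
    (\<forall>k < n. (\<Oplus>i\<in>I. d i \<otimes> A i k) = \<zero>) \<longrightarrow> (\<forall>t \<in> T. (\<Oplus>i\<in>I. d i \<otimes> g i t) = \<zero>)"
    using Suc.IH[OF cg2] by (elim exE conjE)
  define B where "B i k = (if k = 0 then if i \<in> I then c i else \<zero> else A i (k - 1))" for i k
  have "(\<Oplus>i\<in>I. d i \<otimes> f i t) = \<zero>"
    if d: "\<forall>i. d i \<in> carrier R" "\<forall>k < Suc n. (\<Oplus>i\<in>I. d i \<otimes> B i k) = \<zero>" and t: "t \<in> T" for d t
  proof -
    have gt: "g i t \<in> carrier R" if "i \<in> I" for i using cg(2)[OF that] t pol_closed by blast
    have "(\<Oplus>i\<in>I. d i \<otimes> f i t) = (\<Oplus>i\<in>I. d i \<otimes> B i 0 \<oplus> t \<otimes> (d i \<otimes> g i t))"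
      using cg(1,3) gt d t by (intro finsum_cong') (auto simp: B_def r_distr T_lcomm[OF t])
    also have "\<dots> = (\<Oplus>i\<in>I. d i \<otimes> B i 0) \<oplus> (\<Oplus>i\<in>I. t \<otimes> (d i \<otimes> g i t))"
      using cg(1) gt d t by (intro finsum_addf) (auto simp: B_def)
    also have "(\<Oplus>i\<in>I. t \<otimes> (d i \<otimes> g i t)) = t \<otimes> (\<Oplus>i\<in>I. d i \<otimes> g i t)"
      using assms(1) gt d t by (intro finsum_rdistr[symmetric]) auto
    also have "(\<Oplus>i\<in>I. d i \<otimes> g i t) = \<zero>"
    proof (rule A(2)[rule_format, OF _ _ t])
      show "(\<Oplus>i\<in>I. d i \<otimes> A i k) = \<zero>" if "k < n" for k
        using d(2)[rule_format, of "Suc k"] that by (simp add: B_def)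
    qed (rule d(1)[rule_format])
    also have "(\<Oplus>i\<in>I. d i \<otimes> B i 0) = \<zero>" by (rule d(2)[rule_format]) simp
    finally show ?thesis using t by simp
  qed
  moreover have "\<forall>i k. B i k \<in> carrier R" using A(1) cg(1) by (simp add: B_def)
  ultimately show ?case by (intro exI[of _ B] conjI allI impI ballI) auto
qed

lemma pol_left_relation:
  assumes "finite I" "n < card I" "\<And>i. i \<in> I \<Longrightarrow> pol n (f i)"
  obtains d where "\<And>i. d i \<in> carrier R" "\<exists>i \<in> I. d i \<noteq> \<zero>"
    "\<And>t. t \<in> T \<Longrightarrow> (\<Oplus>i\<in>I. d i \<otimes> f i t) = \<zero>"
proof -
  have f: "\<forall>i \<in> I. pol n (f i)" using assms(3) by blast
  obtain A where A: "\<forall>i k. A i k \<in> carrier R" "\<forall>d. (\<forall>i. d i \<in> carrier R) \<longrightarrow>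
    (\<forall>k < n. (\<Oplus>i\<in>I. d i \<otimes> A i k) = \<zero>) \<longrightarrow> (\<forall>t \<in> T. (\<Oplus>i\<in>I. d i \<otimes> f i t) = \<zero>)"
    using pol_left_relation_coeffs[OF assms(1) f] by (elim exE conjE)
  from exists_left_relation[OF assms(1,2) A(1)]
  obtain d where d: "\<forall>i. d i \<in> carrier R" "\<exists>i \<in> I. d i \<noteq> \<zero>"
    "\<forall>k < n. (\<Oplus>i\<in>I. d i \<otimes> A i k) = \<zero>"
    by (elim exE conjE)
  show ?thesis
    using that[of d] d A(2)[rule_format, of d] by simp
qed

lemma pol_divide:
  assumes "pol (Suc n) P" "pol (Suc n) Q" "Q \<zero> \<noteq> \<zero>"
  shows "\<exists>c P1. c \<in> carrier R \<and> pol n P1 \<and> (\<forall>t \<in> T. P t = c \<otimes> Q t \<oplus> t \<otimes> P1 t)"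
proof -
  obtain p P1 where P: "p \<in> carrier R" "pol n P1" "\<And>t. t \<in> T \<Longrightarrow> P t = p \<oplus> t \<otimes> P1 t"
    using assms(1) by auto
  obtain q Q1 where Q: "q \<in> carrier R" "pol n Q1" "\<And>t. t \<in> T \<Longrightarrow> Q t = q \<oplus> t \<otimes> Q1 t"
    using assms(2) by auto
  have q: "q \<noteq> \<zero>" using Q(3)[OF zero_T] Q(1) pol_closed[OF Q(2) zero_T] assms(3) by auto
  define c where "c = p \<otimes> inv q"
  have c: "c \<in> carrier R" "c \<otimes> q = p" using P(1) Q(1) q by (simp_all add: c_def m_assoc)
  have "P t = c \<otimes> Q t \<oplus> t \<otimes> (P1 t \<oplus> (\<ominus> c) \<otimes> Q1 t)" if t: "t \<in> T" for t
  proof -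
    have [simp]: "P1 t \<in> carrier R" "Q1 t \<in> carrier R" using P(2) Q(2) t pol_closed by auto
    have "c \<otimes> Q t \<oplus> t \<otimes> (P1 t \<oplus> (\<ominus> c) \<otimes> Q1 t)
        = p \<oplus> (t \<otimes> (c \<otimes> Q1 t) \<oplus> (\<ominus> (t \<otimes> (c \<otimes> Q1 t)) \<oplus> t \<otimes> P1 t))"
      using Q(1) Q(3)[OF t] t c P(1)
      by (simp add: r_distr T_lcomm[OF t] l_minus r_minus a_ac)
    also have "\<dots> = P t" using P t c(1) by (simp add: r_neg2)
    finally show ?thesis by simp
  qed
  moreover have "pol n (\<lambda>t. P1 t \<oplus> (\<ominus> c) \<otimes> Q1 t)"
    using P(2) Q(2) c(1) by (intro pol_add pol_lmult) auto
  ultimately show ?thesis using c(1) by blast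
qed

text \<open>Ore condition: dividing \<^term>\<open>P\<close> repeatedly by \<^term>\<open>Q\<close> along increasing powers of the
  variable gives \<^term>\<open>P t = S j t \<otimes> Q t \<oplus> t [^] j \<otimes> W j t\<close> with \<^term>\<open>W j\<close> of bounded degree, and a left
  linear relation between the remainders \<^term>\<open>W j\<close> clears them.\<close>

lemma poly_ore:
  assumes "poly P" "poly Q" "Q \<zero> \<noteq> \<zero>"
  shows "\<exists>P' Q'. poly P' \<and> poly Q' \<and> Q' \<zero> \<noteq> \<zero> \<and> (\<forall>t \<in> T. Q' t \<otimes> P t = P' t \<otimes> Q t)"
proof -
  obtain n where n: "pol (Suc n) P" "pol (Suc n) Q"
    using assms(1,2) pol_mono unfolding poly_def
    by (metis le_SucI max.cobounded1 max.cobounded2)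
  define good where "good W Y c \<longleftrightarrow> c \<in> carrier R \<and> pol n Y \<and>
    (\<forall>t \<in> T. W t = c \<otimes> Q t \<oplus> t \<otimes> Y t)" for W Y c
  have "\<exists>W. \<forall>j. (pol (Suc n) (W j) \<and> (j = 0 \<longrightarrow> W j = P)) \<and> (\<exists>c. good (W j) (W (Suc j)) c)"
  proof (rule dependent_nat_choice)
    show "\<exists>W. pol (Suc n) W \<and> ((0::nat) = 0 \<longrightarrow> W = P)" using n by blast
    fix W and j :: nat assume "pol (Suc n) W \<and> (j = 0 \<longrightarrow> W = P)"
    then obtain c Y where "good W Y c"
      using pol_divide[OF _ n(2) assms(3), of W] unfolding good_def by blast
    then show "\<exists>Y. (pol (Suc n) Y \<and> (Suc j = 0 \<longrightarrow> Y = P)) \<and> (\<exists>c. good W Y c)"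
      using pol_Suc unfolding good_def by blast
  qed
  then obtain W where W: "W 0 = P" "\<And>j. \<exists>c. good (W j) (W (Suc j)) c" by metis
  have Xpol: "pol n (W (Suc j))" for j using W(2) unfolding good_def by blast
  have Xpoly: "poly (W j)" for j using W(1) Xpol assms(1) unfolding poly_def by (cases j) auto
  have "\<exists>S. poly S \<and> (\<forall>t \<in> T. P t = S t \<otimes> Q t \<oplus> t [^] j \<otimes> W j t)" for j :: nat
  proof (induction j)
    case 0
    have "P t = \<zero> \<otimes> Q t \<oplus> t [^] (0::nat) \<otimes> W 0 t" if "t \<in> T" for t
      using W(1) poly_closed assms(1,2) that by simp
    then show ?case using poly_const[OF zero_closed] by blast
  next
    case (Suc j)
    then obtain S where S: "poly S" "\<And>t. t \<in> T \<Longrightarrow> P t = S t \<otimes> Q t \<oplus> t [^] j \<otimes> W j t" by blast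
    obtain c where c: "good (W j) (W (Suc j)) c" using W(2) by blast
    have "P t = (S t \<oplus> t [^] j \<otimes> c) \<otimes> Q t \<oplus> t [^] Suc j \<otimes> W (Suc j) t" if t: "t \<in> T" for t
    proof -
      have [simp]: "S t \<in> carrier R" "Q t \<in> carrier R" "W (Suc j) t \<in> carrier R" "c \<in> carrier R"
        using S(1) assms(2) Xpoly t poly_closed c unfolding good_def by blast+
      have "W j t = c \<otimes> Q t \<oplus> t \<otimes> W (Suc j) t" using c t unfolding good_def by blast
      then show ?thesis using S(2)[OF t] t by (simp add: r_distr l_distr m_assoc a_assoc)
    qed
    moreover have "poly (\<lambda>t. S t \<oplus> t [^] j \<otimes> c)"
      using S(1) c unfolding good_def
      by (intro poly_add poly_mult poly_pow poly_id poly_const) auto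
    ultimately show ?case by blast
  qed
  then obtain S where S: "\<And>j. poly (S j)"
    "\<And>j t. t \<in> T \<Longrightarrow> P t = S j t \<otimes> Q t \<oplus> t [^] j \<otimes> W j t" by metis
  obtain d where d[simp]: "\<And>j. d j \<in> carrier R" and d0: "\<exists>j \<in> {..n}. d j \<noteq> \<zero>"
    and dX: "\<And>t. t \<in> T \<Longrightarrow> (\<Oplus>j\<in>{..n}. d j \<otimes> W (Suc j) t) = \<zero>"
    using pol_left_relation[of "{..n}" n "\<lambda>j. W (Suc j)"] Xpol by auto
  define J where "J = Max {j \<in> {..n}. d j \<noteq> \<zero>}"
  have "J \<in> {j \<in> {..n}. d j \<noteq> \<zero>}" using d0 unfolding J_def by (intro Max_in) auto
  then have J: "J \<le> n" "d J \<noteq> \<zero>" by auto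
  have dJ: "d j = \<zero>" if "j \<le> n" "J < j" for j
  proof (rule ccontr)
    assume "d j \<noteq> \<zero>"
    then have "j \<le> J" unfolding J_def using that(1) by (intro Max_ge) auto
    then show False using that by simp
  qed
  define Q' where "Q' t = (\<Oplus>j\<in>{..n}. d j \<otimes> t [^] (J - j))" for t
  define P' where "P' t = (\<Oplus>j\<in>{..n}. d j \<otimes> t [^] (J - j) \<otimes> S (Suc j) t)" for t
  have polys: "poly Q'" "poly P'"
    unfolding Q'_def P'_def
    by (intro poly_finsum poly_mult poly_pow poly_id poly_const S d finite_atMost)+
  have "Q' \<zero> = (\<Oplus>j\<in>{..n}. if J = j then d j else \<zero>)"
    unfolding Q'_def
  proof (intro finsum_cong')
    fix j assume "j \<in> {..n}"
    then show "d j \<otimes> \<zero> [^] (J - j) = (if J = j then d j else \<zero>)"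
      using dJ[of j] by (cases "J - j") auto
  qed auto
  also have "\<dots> = d J" using J(1) by (intro finsum_singleton) auto
  finally have Q'0: "Q' \<zero> \<noteq> \<zero>" using J(2) by simp
  have "Q' t \<otimes> P t = P' t \<otimes> Q t" if t: "t \<in> T" for t
  proof -
    have [simp]: "S j t \<in> carrier R" "Q t \<in> carrier R" "W j t \<in> carrier R" "P t \<in> carrier R" for j
      using S(1) assms(1,2) Xpoly t poly_closed by blast+
    note [simp] = T_closed[OF t]
    have tp: "x \<otimes> t [^] k = t [^] k \<otimes> x" if "x \<in> carrier R" for x and k :: nat
      using that T_comm[OF t that] group_commutes_pow[of t x k] by simp
    have eq: "d j \<otimes> t [^] (J - j) \<otimes> P t
        = d j \<otimes> t [^] (J - j) \<otimes> S (Suc j) t \<otimes> Q t \<oplus> t [^] Suc J \<otimes> (d j \<otimes> W (Suc j) t)"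
      if "j \<le> n" for j
    proof (cases "j \<le> J")
      case True
      have "d j \<otimes> t [^] (J - j) \<otimes> (t [^] Suc j \<otimes> W (Suc j) t)
          = d j \<otimes> t [^] Suc J \<otimes> W (Suc j) t"
        using True by (simp add: m_assoc[symmetric] nat_pow_mult del: nat_pow_Suc)
          (simp add: m_assoc nat_pow_mult del: nat_pow_Suc)
      also have "\<dots> = t [^] Suc J \<otimes> (d j \<otimes> W (Suc j) t)"
        using tp[of "d j" "Suc J"] by (simp add: m_assoc del: nat_pow_Suc)
      finally show ?thesis
        using S(2)[OF t, of "Suc j"] by (simp add: r_distr m_assoc del: nat_pow_Suc)
    next
      case False
      then show ?thesis using dJ[OF that] by simp
    qed
    have "Q' t \<otimes> P t = (\<Oplus>j\<in>{..n}. d j \<otimes> t [^] (J - j) \<otimes> P t)"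
      unfolding Q'_def by (intro finsum_ldistr) auto
    also have "\<dots> = (\<Oplus>j\<in>{..n}. d j \<otimes> t [^] (J - j) \<otimes> S (Suc j) t \<otimes> Q t
        \<oplus> t [^] Suc J \<otimes> (d j \<otimes> W (Suc j) t))"
      using eq by (intro finsum_cong') auto
    also have "\<dots> = (\<Oplus>j\<in>{..n}. d j \<otimes> t [^] (J - j) \<otimes> S (Suc j) t \<otimes> Q t)
        \<oplus> (\<Oplus>j\<in>{..n}. t [^] Suc J \<otimes> (d j \<otimes> W (Suc j) t))"
      by (intro finsum_addf) auto
    also have "(\<Oplus>j\<in>{..n}. d j \<otimes> t [^] (J - j) \<otimes> S (Suc j) t \<otimes> Q t) = P' t \<otimes> Q t"
      unfolding P'_def by (intro finsum_ldistr[symmetric]) auto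
    also have "(\<Oplus>j\<in>{..n}. t [^] Suc J \<otimes> (d j \<otimes> W (Suc j) t)) = t [^] Suc J \<otimes> \<zero>"
      using dX[OF t] by (subst finsum_rdistr[symmetric]) auto
    finally show ?thesis using polys t poly_closed by simp
  qed
  then show ?thesis using polys Q'0 by blast
qed

definition rat :: "('a \<Rightarrow> 'a) \<Rightarrow> bool" where
  "rat f \<longleftrightarrow> (\<forall>t \<in> T. f t \<in> carrier R) \<and>
    (\<exists>P Q. poly P \<and> poly Q \<and> Q \<zero> \<noteq> \<zero> \<and> (\<forall>t \<in> T. Q t \<otimes> f t = P t))"

lemma rat_closed: "rat f \<Longrightarrow> t \<in> T \<Longrightarrow> f t \<in> carrier R"
  unfolding rat_def by blast

lemma ratI:
  assumes "poly P" "poly Q" "Q \<zero> \<noteq> \<zero>" "\<And>t. t \<in> T \<Longrightarrow> f t \<in> carrier R"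
    "\<And>t. t \<in> T \<Longrightarrow> Q t \<otimes> f t = P t"
  shows "rat f"
  using assms unfolding rat_def by blast

lemma rat_poly: "poly f \<Longrightarrow> rat f"
  using one_not_zero by (intro ratI[of f "\<lambda>_. \<one>"]) (auto simp: poly_closed intro: poly_const)

lemma rat_const: "c \<in> carrier R \<Longrightarrow> rat (\<lambda>t. c)"
  by (intro rat_poly poly_const)

lemma rat_id: "rat (\<lambda>t. t)"
  by (intro rat_poly poly_id)

lemma rat_add:
  assumes "rat f" "rat g"
  shows "rat (\<lambda>t. f t \<oplus> g t)"
proof -
  obtain P1 Q1 where 1: "poly P1" "poly Q1" "Q1 \<zero> \<noteq> \<zero>" "\<And>t. t \<in> T \<Longrightarrow> Q1 t \<otimes> f t = P1 t"
    using assms(1) unfolding rat_def by blast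
  obtain P2 Q2 where 2: "poly P2" "poly Q2" "Q2 \<zero> \<noteq> \<zero>" "\<And>t. t \<in> T \<Longrightarrow> Q2 t \<otimes> g t = P2 t"
    using assms(2) unfolding rat_def by blast
  obtain A B where AB: "poly A" "poly B" "B \<zero> \<noteq> \<zero>" "\<And>t. t \<in> T \<Longrightarrow> B t \<otimes> Q1 t = A t \<otimes> Q2 t"
    using poly_ore[OF 1(2) 2(2,3)] by blast
  show ?thesis
  proof (rule ratI)
    show "poly (\<lambda>t. B t \<otimes> P1 t \<oplus> A t \<otimes> P2 t)" "poly (\<lambda>t. B t \<otimes> Q1 t)"
      by (intro poly_add poly_mult 1 2 AB)+
    show "B \<zero> \<otimes> Q1 \<zero> \<noteq> \<zero>" using 1(2,3) AB(2,3) poly_closed zero_T by simp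
    fix t assume t: "t \<in> T"
    have [simp]: "f t \<in> carrier R" "g t \<in> carrier R" "A t \<in> carrier R" "B t \<in> carrier R"
      "Q1 t \<in> carrier R" "Q2 t \<in> carrier R"
      using assms 1 2 AB t poly_closed rat_closed by blast+
    show "f t \<oplus> g t \<in> carrier R" by simp
    have "B t \<otimes> Q1 t \<otimes> (f t \<oplus> g t) = B t \<otimes> (Q1 t \<otimes> f t) \<oplus> (B t \<otimes> Q1 t) \<otimes> g t"
      by (simp add: r_distr m_assoc)
    also have "\<dots> = B t \<otimes> P1 t \<oplus> A t \<otimes> P2 t"
      unfolding AB(4)[OF t] using 1(4) 2(4) t by (simp add: m_assoc)
    finally show "B t \<otimes> Q1 t \<otimes> (f t \<oplus> g t) = B t \<otimes> P1 t \<oplus> A t \<otimes> P2 t" .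
  qed
qed

lemma rat_mult:
  assumes "rat f" "rat g"
  shows "rat (\<lambda>t. f t \<otimes> g t)"
proof -
  obtain P1 Q1 where 1: "poly P1" "poly Q1" "Q1 \<zero> \<noteq> \<zero>" "\<And>t. t \<in> T \<Longrightarrow> Q1 t \<otimes> f t = P1 t"
    using assms(1) unfolding rat_def by blast
  obtain P2 Q2 where 2: "poly P2" "poly Q2" "Q2 \<zero> \<noteq> \<zero>" "\<And>t. t \<in> T \<Longrightarrow> Q2 t \<otimes> g t = P2 t"
    using assms(2) unfolding rat_def by blast
  obtain A B where AB: "poly A" "poly B" "B \<zero> \<noteq> \<zero>" "\<And>t. t \<in> T \<Longrightarrow> B t \<otimes> P1 t = A t \<otimes> Q2 t"
    using poly_ore[OF 1(1) 2(2,3)] by blast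
  show ?thesis
  proof (rule ratI)
    show "poly (\<lambda>t. A t \<otimes> P2 t)" "poly (\<lambda>t. B t \<otimes> Q1 t)"
      by (intro poly_mult 1 2 AB)+
    show "B \<zero> \<otimes> Q1 \<zero> \<noteq> \<zero>" using 1(2,3) AB(2,3) poly_closed zero_T by simp
    fix t assume t: "t \<in> T"
    have [simp]: "f t \<in> carrier R" "g t \<in> carrier R" "A t \<in> carrier R" "B t \<in> carrier R"
      "Q1 t \<in> carrier R" "Q2 t \<in> carrier R" "P1 t \<in> carrier R"
      using assms 1 2 AB t poly_closed rat_closed by blast+
    show "f t \<otimes> g t \<in> carrier R" by simp
    have "B t \<otimes> Q1 t \<otimes> (f t \<otimes> g t) = B t \<otimes> (Q1 t \<otimes> f t) \<otimes> g t"
      by (simp add: m_assoc)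
    also have "\<dots> = A t \<otimes> P2 t"
      using 1(4)[OF t] 2(4)[OF t] AB(4)[OF t] by (simp add: m_assoc)
    finally show "B t \<otimes> Q1 t \<otimes> (f t \<otimes> g t) = A t \<otimes> P2 t" .
  qed
qed

lemma rat_pow: "rat f \<Longrightarrow> rat (\<lambda>t. f t [^] (n::nat))"
  by (induction n) (auto intro: rat_const rat_mult)

lemma rat_cong:
  assumes "rat f" "\<And>t. t \<in> T \<Longrightarrow> g t = f t"
  shows "rat g"
  using assms unfolding rat_def by simp

lemma rat_finsum:
  assumes "finite I" "\<And>i. i \<in> I \<Longrightarrow> rat (f i)"
  shows "rat (\<lambda>t. \<Oplus>i\<in>I. f i t)"
  using assms
proof (induction I)
  case empty
  then show ?case using rat_const[OF zero_closed] by simp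
next
  case (insert x I)
  then have "rat (\<lambda>t. f x t \<oplus> (\<Oplus>i\<in>I. f i t))" by (intro rat_add) auto
  moreover have "(\<Oplus>i\<in>insert x I. f i t) = f x t \<oplus> (\<Oplus>i\<in>I. f i t)" if "t \<in> T" for t
    using insert that rat_closed by (intro finsum_insert) auto
  ultimately show ?case by (rule rat_cong)
qed

lemma rat_mult_op: "L \<in> mult_ops \<Longrightarrow> rat f \<Longrightarrow> rat (\<lambda>t. L (f t))"
  by (induction rule: mult_ops.induct) (auto intro: rat_const rat_add rat_mult)

lemma rat_inv:
  assumes "poly f" "\<And>t. t \<in> T \<Longrightarrow> f t \<noteq> \<zero>"
  shows "rat (\<lambda>t. inv (f t))"
  using assms zero_T poly_closed[OF assms(1)]
  by (intro ratI[of "\<lambda>_. \<one>" f]) (auto intro: poly_const)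

lemma rat_zeros:
  assumes "rat f" "f \<zero> \<noteq> \<zero>"
  shows "finite {t \<in> T. f t = \<zero>}"
proof -
  obtain P Q where PQ: "poly P" "poly Q" "Q \<zero> \<noteq> \<zero>" "\<And>t. t \<in> T \<Longrightarrow> Q t \<otimes> f t = P t"
    using assms(1) unfolding rat_def by blast
  have "P \<zero> \<noteq> \<zero>"
    using PQ assms zero_T poly_closed[OF PQ(2)] rat_closed[OF assms(1)]
    by (simp add: PQ(4)[symmetric])
  then have "finite {t \<in> T. P t = \<zero>}" using PQ(1) pol_zeros unfolding poly_def by blast
  moreover have "{t \<in> T. f t = \<zero>} \<subseteq> {t \<in> T. P t = \<zero>}"
    using PQ(4) poly_closed[OF PQ(2)] by force
  ultimately show ?thesis by (rule finite_subset[rotated])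
qed

text \<open>Elimination without determinants: if \<^term>\<open>L\<close> sends \<^term>\<open>v \<zero>\<close> to \<^term>\<open>\<one>\<close> and the other
  \<^term>\<open>u \<zero>\<close> to \<^term>\<open>\<zero>\<close>, then \<^term>\<open>\<lambda>y. L (v t) \<otimes> y \<ominus> L y \<otimes> v t\<close> kills \<^term>\<open>v t\<close>, is linear over the
  center, and fixes the \<^term>\<open>u \<zero>\<close>.\<close>

lemma rat_independent:
  assumes "\<And>v. v \<in> set vs \<Longrightarrow> rat v" "independent (ring_center R) (map (\<lambda>v. v \<zero>) vs)"
  shows "finite {t \<in> T. \<not> independent (ring_center R) (map (\<lambda>v. v t) vs)}"
  using assms
proof (induction "length vs" arbitrary: vs)
  case (Suc n)
  let ?F = "ring_center R"
  obtain v us where vs: "vs = v # us" using Suc.hyps(2) by (cases vs) auto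
  have v: "rat v" and us: "\<And>u. u \<in> set us \<Longrightarrow> rat u" using Suc.prems(1) vs by auto
  have cl: "v t \<in> carrier R" "set (map (\<lambda>u. u t) us) \<subseteq> carrier R" if "t \<in> T" for t
    using v us that rat_closed by auto
  have ind: "v \<zero> \<notin> Span ?F (map (\<lambda>u. u \<zero>) us)" "independent ?F (map (\<lambda>u. u \<zero>) us)"
    using independent_backwards(1,2)[of ?F "v \<zero>" "map (\<lambda>u. u \<zero>) us"] Suc.prems(2)
    by (simp_all add: vs del: Span.simps)
  obtain L where L: "L \<in> mult_ops" "L (v \<zero>) = \<one>" "\<And>u. u \<in> set us \<Longrightarrow> L (u \<zero>) = \<zero>"
    using mult_op_separates[OF cl(2)[OF zero_T] cl(1)[OF zero_T] ind(1)] by fastforce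
  define M where "M t y = L (v t) \<otimes> y \<oplus> \<ominus> \<one> \<otimes> (L y \<otimes> v t)" for t y
  have M: "M t \<in> mult_ops" if "t \<in> T" for t
    unfolding M_def[abs_def]
    using L(1) cl(1)[OF that] by (intro mult_ops.intros) (auto intro: mult_op_closed)
  define ws where "ws = map (\<lambda>u t. M t (u t)) us"
  have ws0: "map (\<lambda>w. w \<zero>) ws = map (\<lambda>u. u \<zero>) us"
    using L(2,3) cl[OF zero_T] by (auto simp: ws_def M_def)
  have ws: "rat w" if "w \<in> set ws" for w
  proof -
    obtain u where u: "u \<in> set us" "w = (\<lambda>t. M t (u t))" using \<open>w \<in> set ws\<close> by (auto simp: ws_def)
    show ?thesis
      unfolding u(2) M_def
      by (rule rat_add[OF rat_mult[OF rat_mult_op[OF L(1) v] us[OF u(1)]]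
            rat_mult[OF rat_const rat_mult[OF rat_mult_op[OF L(1) us[OF u(1)]] v]]]) simp
  qed
  have "n = length ws" using Suc.hyps(2) vs by (simp add: ws_def)
  moreover have "independent ?F (map (\<lambda>w. w \<zero>) ws)" using ind(2) ws0 by simp
  ultimately have fin: "finite {t \<in> T. \<not> independent ?F (map (\<lambda>w. w t) ws)}"
    using Suc.hyps(1) ws by blast
  have "independent ?F (map (\<lambda>u. u t) vs)"
    if t: "t \<in> T" and i: "independent ?F (map (\<lambda>w. w t) ws)" and nz: "v t \<noteq> \<zero>" for t
  proof -
    have i': "independent ?F (map (M t) (map (\<lambda>u. u t) us))" using i by (simp add: ws_def comp_def)
    have "M t (v t) = \<zero>"
      using cl(1)[OF t] mult_op_closed[OF L(1) cl(1)[OF t]] by (simp add: M_def l_minus r_neg)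
    then have "v t \<notin> Span ?F (map (\<lambda>u. u t) us)"
      using independent_mult_op(2)[OF M[OF t] cl(2)[OF t] i'] nz by blast
    from li_Cons[OF cl(1)[OF t] this independent_mult_op(1)[OF M[OF t] cl(2)[OF t] i']]
    show ?thesis by (simp add: vs)
  qed
  then have "{t \<in> T. \<not> independent ?F (map (\<lambda>v. v t) vs)}
      \<subseteq> {t \<in> T. \<not> independent ?F (map (\<lambda>w. w t) ws)} \<union> {t \<in> T. v t = \<zero>}" by blast
  moreover have "v \<zero> \<noteq> \<zero>"
  proof
    assume "v \<zero> = \<zero>"
    then show False using L(2) mult_op_zero[OF L(1)] one_not_zero by simp
  qed
  ultimately show ?case using fin rat_zeros[OF v] by (auto intro: finite_subset)
qed auto

end

section \<open>Division subrings and elements algebraic over the center\<close>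

context skew_field
begin

definition cent :: "'a set \<Rightarrow> 'a set" where
  "cent A = {y \<in> carrier R. \<forall>x \<in> A. y \<otimes> x = x \<otimes> y}"

definition div_subring :: "'a set \<Rightarrow> bool" where
  "div_subring S \<longleftrightarrow> subring S R \<and> (\<forall>x \<in> S. x \<noteq> \<zero> \<longrightarrow> inv x \<in> S)"

lemma div_subringD:
  assumes "div_subring S"
  shows "S \<subseteq> carrier R" "\<zero> \<in> S" "\<one> \<in> S" "x \<in> S \<Longrightarrow> \<ominus> x \<in> S"
    "x \<in> S \<Longrightarrow> y \<in> S \<Longrightarrow> x \<otimes> y \<in> S" "x \<in> S \<Longrightarrow> y \<in> S \<Longrightarrow> x \<oplus> y \<in> S"
    "x \<in> S \<Longrightarrow> y \<in> S \<Longrightarrow> x \<ominus> y \<in> S" "x \<in> S \<Longrightarrow> x \<noteq> \<zero> \<Longrightarrow> inv x \<in> S"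
  using assms unfolding div_subring_def a_minus_def by (auto dest: subringE)

lemma div_subringI:
  assumes "S \<subseteq> carrier R" "\<one> \<in> S" "\<And>x. x \<in> S \<Longrightarrow> \<ominus> x \<in> S"
    "\<And>x y. x \<in> S \<Longrightarrow> y \<in> S \<Longrightarrow> x \<otimes> y \<in> S" "\<And>x y. x \<in> S \<Longrightarrow> y \<in> S \<Longrightarrow> x \<oplus> y \<in> S"
    "\<And>x. x \<in> S \<Longrightarrow> x \<noteq> \<zero> \<Longrightarrow> inv x \<in> S"
  shows "div_subring S"
  unfolding div_subring_def using assms by (auto intro: subringI)

lemma centD: "y \<in> cent A \<Longrightarrow> y \<in> carrier R" "y \<in> cent A \<Longrightarrow> x \<in> A \<Longrightarrow> y \<otimes> x = x \<otimes> y"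
  unfolding cent_def by auto

lemma cent_div_subring:
  assumes "A \<subseteq> carrier R"
  shows "div_subring (cent A)"
proof (rule div_subringI)
  fix x y assume x: "x \<in> cent A"
  have c: "x \<otimes> z = z \<otimes> x" "z \<in> carrier R" if "z \<in> A" for z
    using centD(2)[OF x that] assms that by auto
  note xc = centD(1)[OF x]
  show "\<ominus> x \<in> cent A" unfolding cent_def using xc c by (auto simp: l_minus r_minus)
  show "inv x \<in> cent A" if "x \<noteq> \<zero>"
    unfolding cent_def using that xc inv_commute[OF xc that] c by auto
  assume y: "y \<in> cent A"
  have d: "y \<otimes> z = z \<otimes> y" if "z \<in> A" for z using centD(2)[OF y that] .
  show "x \<otimes> y \<in> cent A"
    unfolding cent_def using xc centD(1)[OF y] c d mult_commute_closed[of x y] by auto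
  show "x \<oplus> y \<in> cent A"
    unfolding cent_def using xc centD(1)[OF y] c d by (auto simp: l_distr r_distr)
qed (use assms in \<open>auto simp: cent_def\<close>)

text \<open>For \<^term>\<open>r \<in> E\<close> and \<^term>\<open>d\<close> not commuting with \<^term>\<open>r\<close>, put \<^term>\<open>r1 = (\<one> \<oplus> d) \<otimes> r \<otimes> inv (\<one> \<oplus> d)\<close>
  and \<^term>\<open>r2 = d \<otimes> r \<otimes> inv d\<close>; then \<^term>\<open>r1 \<ominus> r = (r2 \<ominus> r1) \<otimes> d\<close> exhibits \<^term>\<open>d\<close> as a quotient in \<^term>\<open>E\<close>.\<close>

lemma cartan_brauer_hua:
  assumes E: "div_subring E" and conj: "\<And>g x. g \<in> carrier R \<Longrightarrow> g \<noteq> \<zero> \<Longrightarrow> x \<in> E \<Longrightarrow> g \<otimes> x \<otimes> inv g \<in> E"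
    and nc: "\<not> E \<subseteq> ring_center R"
  shows "E = carrier R"
proof
  show "E \<subseteq> carrier R" by (rule div_subringD(1)[OF E])
  have *: "d \<in> E" if d: "d \<in> carrier R" and r: "r \<in> E" and ncom: "d \<otimes> r \<noteq> r \<otimes> d" for d r
  proof -
    have rc: "r \<in> carrier R" using r div_subringD(1)[OF E] by blast
    have d0: "d \<noteq> \<zero>" using ncom rc by auto
    define g where "g = \<one> \<oplus> d"
    have g: "g \<in> carrier R" using d by (simp add: g_def)
    have gr: "g \<otimes> r = r \<oplus> d \<otimes> r" "r \<otimes> g = r \<oplus> r \<otimes> d"
      using d rc by (simp_all add: g_def l_distr r_distr)
    then have grn: "g \<otimes> r \<noteq> r \<otimes> g" using ncom d rc by simp
    then have g0: "g \<noteq> \<zero>" using rc by auto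
    define r1 where "r1 = g \<otimes> r \<otimes> inv g"
    define r2 where "r2 = d \<otimes> r \<otimes> inv d"
    have E12: "r1 \<in> E" "r2 \<in> E" using conj g g0 d d0 r by (auto simp: r1_def r2_def)
    then have c12: "r1 \<in> carrier R" "r2 \<in> carrier R" using div_subringD(1)[OF E] by auto
    have m: "r1 \<otimes> g = g \<otimes> r" "r2 \<otimes> d = d \<otimes> r"
      using g g0 d d0 rc by (simp_all add: r1_def r2_def m_assoc)
    have e1: "r1 \<oplus> r1 \<otimes> d = r \<oplus> r2 \<otimes> d" using m gr c12 d by (simp add: g_def r_distr)
    have "r1 \<ominus> r = r1 \<oplus> r1 \<otimes> d \<oplus> \<ominus> (r1 \<otimes> d) \<oplus> \<ominus> r"
      using c12 d rc by (simp add: a_minus_def a_assoc r_neg)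
    also have "\<dots> = (r2 \<ominus> r1) \<otimes> d"
      unfolding e1 using c12 d rc
      by (simp add: a_minus_def l_distr l_minus a_ac r_neg2 r_neg1)
    finally have e: "r1 \<ominus> r = (r2 \<ominus> r1) \<otimes> d" .
    have ne: "r2 \<ominus> r1 \<noteq> \<zero>"
    proof
      assume "r2 \<ominus> r1 = \<zero>"
      then have "r1 = r" using e d minus_zero_iff[OF c12(1) rc] by simp
      then show False using m(1) grn by simp
    qed
    have "d = inv (r2 \<ominus> r1) \<otimes> (r1 \<ominus> r)" using e ne c12 d by simp
    then show ?thesis using E12 r ne div_subringD[OF E] by (metis (no_types, lifting))
  qed
  obtain r y where r: "r \<in> E" and y: "y \<in> carrier R" "r \<otimes> y \<noteq> y \<otimes> r"
    using nc div_subringD(1)[OF E] unfolding ring_center_def by blast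
  have rc: "r \<in> carrier R" using r div_subringD(1)[OF E] by blast
  have yE: "y \<in> E" using *[OF y(1) r] y by metis
  show "carrier R \<subseteq> E"
  proof
    fix d assume d: "d \<in> carrier R"
    show "d \<in> E"
    proof (cases "d \<otimes> r = r \<otimes> d")
      case True
      have "(d \<oplus> y) \<otimes> r \<noteq> r \<otimes> (d \<oplus> y)"
        using True d y rc by (simp add: l_distr r_distr)
      then have "d \<oplus> y \<in> E" using *[of "d \<oplus> y", OF _ r] d y by simp
      then have "(d \<oplus> y) \<ominus> y \<in> E" using yE div_subringD(7)[OF E] by blast
      then show ?thesis using d y by (simp add: a_minus_def a_assoc r_neg)
    qed (use *[OF d r] in blast)
  qed
qed

definition pows :: "'a \<Rightarrow> nat \<Rightarrow> 'a list" where
  "pows x n = map (\<lambda>k. x [^] k) (rev [0..<n])"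

lemma pows_simps: "pows x 0 = []" "pows x (Suc n) = x [^] n # pows x n" "length (pows x n) = n"
  by (simp_all add: pows_def)

lemma set_pows: "set (pows x n) = (\<lambda>k. x [^] k) ` {..<n}"
  by (auto simp: pows_def)

lemma Span_pows_finsum:
  assumes "x \<in> carrier R" "y \<in> Span (ring_center R) (pows x n)"
  shows "\<exists>c. (\<forall>k. c k \<in> ring_center R) \<and> y = (\<Oplus>k\<in>{..<n}. c k \<otimes> x [^] k)"
  using assms(2)
proof (induction n arbitrary: y)
  case 0
  then show ?case
    using subringE(2)[OF subfieldE(1)[OF center_subfield]]
    by (auto simp: pows_simps intro!: exI[of _ "\<lambda>_. \<zero>"])
next
  case (Suc n)
  then obtain k v where k: "k \<in> ring_center R" "v \<in> Span (ring_center R) (pows x n)"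
    "y = k \<otimes> x [^] n \<oplus> v"
    by (auto simp: pows_simps line_extension_mem_iff)
  from Suc.IH[OF k(2)] obtain c where c: "\<forall>k. c k \<in> ring_center R"
    "v = (\<Oplus>k\<in>{..<n}. c k \<otimes> x [^] k)" by blast
  have cc: "c k \<in> carrier R" for k using c(1) ring_centerD(1) by blast
  have kc: "k \<in> carrier R" using k(1) ring_centerD(1) by blast
  have "(\<Oplus>j\<in>{..<Suc n}. (c(n := k)) j \<otimes> x [^] j)
      = (\<Oplus>j\<in>{..<n}. (c(n := k)) j \<otimes> x [^] j) \<oplus> k \<otimes> x [^] n"
    using cc kc assms(1) by (subst finsum_lessThan_Suc) auto
  also have "(\<Oplus>j\<in>{..<n}. (c(n := k)) j \<otimes> x [^] j) = v"
    unfolding c(2) using cc assms(1) by (intro finsum_cong') auto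
  finally have "y = (\<Oplus>j\<in>{..<Suc n}. (c(n := k)) j \<otimes> x [^] j)"
    using k(3) c(2) cc kc assms(1) by (simp add: a_comm)
  then show ?case using c(1) k(1) by (intro exI[of _ "c(n := k)"]) auto
qed

lemma finsum_mem_Span_pows:
  assumes "x \<in> carrier R" "\<And>k. c k \<in> ring_center R"
  shows "(\<Oplus>k\<in>{..<n}. c k \<otimes> x [^] k) \<in> Span (ring_center R) (pows x n)"
proof (induction n)
  case (Suc n)
  have cc: "c k \<in> carrier R" for k using assms(2) ring_centerD(1) by blast
  have s: "(\<Oplus>k\<in>{..<n}. c k \<otimes> x [^] k) \<in> carrier R" using cc assms(1) by simp
  have "(\<Oplus>k\<in>{..<Suc n}. c k \<otimes> x [^] k) = c n \<otimes> x [^] n \<oplus> (\<Oplus>k\<in>{..<n}. c k \<otimes> x [^] k)"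
    using cc assms(1) s by (subst finsum_lessThan_Suc) (auto simp: a_comm)
  then have "(\<Oplus>k\<in>{..<Suc n}. c k \<otimes> x [^] k)
      \<in> line_extension (ring_center R) (x [^] n) (Span (ring_center R) (pows x n))"
    unfolding line_extension_mem_iff using Suc.IH assms(2) by blast
  then show ?case by (simp add: pows_simps)
qed (simp add: pows_simps)

end

locale algebraic_element = skew_field +
  fixes a :: 'a and m :: nat and c :: "nat \<Rightarrow> 'a"
  assumes a_closed [simp]: "a \<in> carrier R"
    and c_center: "\<And>k. c k \<in> ring_center R"
    and a_pow: "a [^] m = (\<Oplus>k\<in>{..<m}. c k \<otimes> a [^] k)"
    and a_indep: "independent (ring_center R) (pows a m)"
begin

lemma c_closed [simp]: "c k \<in> carrier R"
  using c_center ring_centerD(1) by blast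

lemma m_pos: "m \<noteq> 0"
  using a_pow one_not_zero by (intro notI) simp

definition lin :: "(nat \<Rightarrow> 'a) \<Rightarrow> 'a" where
  "lin z = z m \<ominus> (\<Oplus>k\<in>{..<m}. c k \<otimes> z k)"

lemma lin_closed [simp]: "(\<And>k. z k \<in> carrier R) \<Longrightarrow> lin z \<in> carrier R"
  by (simp add: lin_def)

lemma lin_add:
  assumes "\<And>k. z k \<in> carrier R" "\<And>k. w k \<in> carrier R"
  shows "lin (\<lambda>k. z k \<oplus> w k) = lin z \<oplus> lin w"
proof -
  have "(\<Oplus>k\<in>{..<m}. c k \<otimes> (z k \<oplus> w k)) = (\<Oplus>k\<in>{..<m}. c k \<otimes> z k \<oplus> c k \<otimes> w k)"
    using assms by (simp add: r_distr)
  also have "\<dots> = (\<Oplus>k\<in>{..<m}. c k \<otimes> z k) \<oplus> (\<Oplus>k\<in>{..<m}. c k \<otimes> w k)"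
    using assms by (intro finsum_addf) auto
  finally show ?thesis using assms by (simp add: lin_def a_minus_def minus_add a_ac)
qed

lemma lin_lmult:
  assumes "\<And>k. z k \<in> carrier R" "y \<in> carrier R"
  shows "lin (\<lambda>k. y \<otimes> z k) = y \<otimes> lin z"
proof -
  have "c k \<otimes> (y \<otimes> z k) = y \<otimes> (c k \<otimes> z k)" for k
    using assms ring_centerD(2)[OF c_center assms(2), of k] by (simp add: m_assoc[symmetric])
  then have "(\<Oplus>k\<in>{..<m}. c k \<otimes> (y \<otimes> z k)) = (\<Oplus>k\<in>{..<m}. y \<otimes> (c k \<otimes> z k))" by simp
  also have "\<dots> = y \<otimes> (\<Oplus>k\<in>{..<m}. c k \<otimes> z k)"
    using assms by (intro finsum_rdistr[symmetric]) auto
  finally show ?thesis using assms by (simp add: lin_def a_minus_def r_distr r_minus)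
qed

lemma lin_rmult:
  assumes "\<And>k. z k \<in> carrier R" "y \<in> carrier R"
  shows "lin (\<lambda>k. z k \<otimes> y) = lin z \<otimes> y"
proof -
  have "(\<Oplus>k\<in>{..<m}. c k \<otimes> (z k \<otimes> y)) = (\<Oplus>k\<in>{..<m}. (c k \<otimes> z k) \<otimes> y)"
    using assms by (simp add: m_assoc)
  also have "\<dots> = (\<Oplus>k\<in>{..<m}. c k \<otimes> z k) \<otimes> y"
    using assms by (intro finsum_ldistr[symmetric]) auto
  finally show ?thesis using assms by (simp add: lin_def a_minus_def l_distr l_minus)
qed

lemma lin_pow: "lin (\<lambda>k. a [^] k) = \<zero>"
  unfolding lin_def using a_pow by (simp add: a_minus_def r_neg)

primrec diffq :: "'a \<Rightarrow> (nat \<Rightarrow> 'a) \<Rightarrow> nat \<Rightarrow> 'a" where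
  "diffq h \<beta> 0 = \<zero>"
| "diffq h \<beta> (Suc k) = a \<otimes> diffq h \<beta> k \<oplus> h \<otimes> \<beta> k"

text \<open>With \<^term>\<open>\<beta> = (\<lambda>k. a [^] k)\<close> this is the bilinear form of the difference quotient
  (P(X) - P(Y)) / (X - Y) of the relation P satisfied by \<^term>\<open>a\<close>, with \<^term>\<open>h\<close> placed between
  X and Y, i.e. the derivative of P at \<^term>\<open>a\<close> in direction \<^term>\<open>h\<close>.\<close>

definition phi :: "'a \<Rightarrow> (nat \<Rightarrow> 'a) \<Rightarrow> 'a" where
  "phi h \<beta> = lin (diffq h \<beta>)"

abbreviation (input) pw :: "nat \<Rightarrow> 'a" where "pw \<equiv> \<lambda>k. a [^] k"

context
  fixes \<beta> :: "nat \<Rightarrow> 'a"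
  assumes \<beta> [simp]: "\<And>k. \<beta> k \<in> carrier R"
begin

lemma diffq_closed [simp]: "h \<in> carrier R \<Longrightarrow> diffq h \<beta> k \<in> carrier R"
  by (induction k) auto

lemma phi_closed [simp]: "h \<in> carrier R \<Longrightarrow> phi h \<beta> \<in> carrier R"
  by (simp add: phi_def)

lemma phi_add:
  assumes [simp]: "h \<in> carrier R" "h' \<in> carrier R"
  shows "phi (h \<oplus> h') \<beta> = phi h \<beta> \<oplus> phi h' \<beta>"
proof -
  have "diffq (h \<oplus> h') \<beta> k = diffq h \<beta> k \<oplus> diffq h' \<beta> k" for k
    by (induction k) (simp_all add: r_distr l_distr a_ac)
  then have "diffq (h \<oplus> h') \<beta> = (\<lambda>k. diffq h \<beta> k \<oplus> diffq h' \<beta> k)" by blast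
  then show ?thesis by (simp add: phi_def lin_add)
qed

lemma phi_lmult:
  assumes "h \<in> carrier R" "y \<in> carrier R" "y \<otimes> a = a \<otimes> y"
  shows "phi (y \<otimes> h) \<beta> = y \<otimes> phi h \<beta>"
proof -
  have "diffq (y \<otimes> h) \<beta> k = y \<otimes> diffq h \<beta> k" for k
  proof (induction k)
    case (Suc k)
    have "a \<otimes> (y \<otimes> diffq h \<beta> k) = y \<otimes> (a \<otimes> diffq h \<beta> k)"
      using assms by (simp add: m_assoc[symmetric])
    then show ?case using Suc assms by (simp add: r_distr m_assoc)
  qed (use assms in simp)
  then have "diffq (y \<otimes> h) \<beta> = (\<lambda>k. y \<otimes> diffq h \<beta> k)" by blast
  then show ?thesis using assms by (simp add: phi_def lin_lmult)
qed

lemma phi_rmult: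
  assumes "h \<in> carrier R" "y \<in> carrier R"
  shows "phi h (\<lambda>k. \<beta> k \<otimes> y) = phi h \<beta> \<otimes> y"
proof -
  have "diffq h (\<lambda>k. \<beta> k \<otimes> y) k = diffq h \<beta> k \<otimes> y" for k
    using assms by (induction k) (simp_all add: l_distr m_assoc)
  then have "diffq h (\<lambda>k. \<beta> k \<otimes> y) = (\<lambda>k. diffq h \<beta> k \<otimes> y)" by blast
  then show ?thesis using assms by (simp add: phi_def lin_rmult)
qed

lemma phi_mult_shift:
  assumes "h \<in> carrier R" "y \<in> carrier R"
  shows "phi h (\<lambda>k. y \<otimes> \<beta> k) = phi (h \<otimes> y) \<beta>"
proof -
  have "diffq h (\<lambda>k. y \<otimes> \<beta> k) k = diffq (h \<otimes> y) \<beta> k" for k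
    using assms by (induction k) (simp_all add: m_assoc)
  then have "diffq h (\<lambda>k. y \<otimes> \<beta> k) = diffq (h \<otimes> y) \<beta>" by blast
  then show ?thesis by (simp add: phi_def)
qed

lemma phi_add_right:
  assumes "h \<in> carrier R" "\<And>k. \<gamma> k \<in> carrier R"
  shows "phi h (\<lambda>k. \<beta> k \<oplus> \<gamma> k) = phi h \<beta> \<oplus> phi h \<gamma>"
proof -
  have \<gamma>: "diffq h \<gamma> k \<in> carrier R" for k using assms by (induction k) auto
  have "diffq h (\<lambda>k. \<beta> k \<oplus> \<gamma> k) k = diffq h \<beta> k \<oplus> diffq h \<gamma> k" for k
    using assms \<gamma> by (induction k) (simp_all add: r_distr a_ac)
  then have "diffq h (\<lambda>k. \<beta> k \<oplus> \<gamma> k) = (\<lambda>k. diffq h \<beta> k \<oplus> diffq h \<gamma> k)" by blast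
  then show ?thesis using assms \<gamma> by (simp add: phi_def lin_add)
qed

lemma phi_zero:
  assumes "h \<in> carrier R" "\<And>k. k < m \<Longrightarrow> \<beta> k = \<zero>"
  shows "phi h \<beta> = \<zero>"
proof -
  have "diffq h \<beta> k = \<zero>" if "k \<le> m" for k
    using that assms by (induction k) auto
  moreover from this have "(\<Oplus>k\<in>{..<m}. c k \<otimes> diffq h \<beta> k) = (\<Oplus>k\<in>{..<m}. \<zero>)"
    by (intro finsum_cong') auto
  ultimately show ?thesis by (simp add: phi_def lin_def a_minus_def)
qed

lemma phi_unit:
  assumes "h \<in> carrier R" "\<And>k. Suc k < m \<Longrightarrow> \<beta> k = \<zero>" "\<beta> (m - 1) = \<one>"
  shows "phi h \<beta> = h"
proof -
  have z: "diffq h \<beta> k = \<zero>" if "k < m" for k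
    using that assms by (induction k) auto
  then have "(\<Oplus>k\<in>{..<m}. c k \<otimes> diffq h \<beta> k) = (\<Oplus>k\<in>{..<m}. \<zero>)"
    by (intro finsum_cong') auto
  moreover have "diffq h \<beta> m = h" using m_pos z[of "m - 1"] assms(1,3) by (cases m) auto
  ultimately show ?thesis using assms(1) by (simp add: phi_def lin_def a_minus_def)
qed

end

lemma phi_transfer:
  assumes "L \<in> mult_ops" "y \<in> carrier R" "\<And>k. \<beta> k \<in> carrier R" "\<And>k. \<gamma> k \<in> carrier R"
    and "\<And>h. h \<in> carrier R \<Longrightarrow> y \<otimes> phi h \<beta> = phi h \<gamma>" and "h \<in> carrier R"
  shows "y \<otimes> phi h (\<lambda>k. L (\<beta> k)) = phi h (\<lambda>k. L (\<gamma> k))"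
  using assms(1,6)
proof (induction arbitrary: h rule: mult_ops.induct)
  case mult_ops_id
  then show ?case using assms(5) by simp
next
  case (mult_ops_add L M)
  then show ?case
    using assms(2-4) by (simp add: phi_add_right mult_op_closed r_distr)
next
  case (mult_ops_left L \<alpha>)
  then show ?case
    using assms(2-4) by (simp add: phi_mult_shift mult_op_closed)
next
  case (mult_ops_right L \<alpha>)
  then show ?case
    using assms(2-4) by (simp add: phi_rmult mult_op_closed m_assoc[symmetric])
qed

lemma diffq_pow:
  assumes "h \<in> carrier R"
  shows "diffq h pw (Suc k) = diffq h pw k \<otimes> a \<oplus> a [^] k \<otimes> h"
proof (induction k)
  case 0
  then show ?case using assms by simp
next
  case (Suc k)
  have [simp]: "diffq h pw k \<in> carrier R" for k using assms by simp
  have aa: "a [^] k \<otimes> a = a \<otimes> a [^] k" using nat_pow_Suc2[OF a_closed, of k] by simp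
  have "diffq h pw (Suc (Suc k)) = a \<otimes> (diffq h pw k \<otimes> a \<oplus> a [^] k \<otimes> h) \<oplus> h \<otimes> (a [^] k \<otimes> a)"
    using Suc by simp
  also have "\<dots> = (a \<otimes> diffq h pw k \<oplus> h \<otimes> a [^] k) \<otimes> a \<oplus> a \<otimes> a [^] k \<otimes> h"
    using assms by (simp add: r_distr l_distr m_assoc a_ac)
  finally show ?case using aa by simp
qed

lemma phi_commute:
  assumes [simp]: "h \<in> carrier R"
  shows "phi h pw \<otimes> a = a \<otimes> phi h pw"
proof -
  have [simp]: "diffq h pw k \<in> carrier R" for k by simp
  have "a \<otimes> phi h pw = lin (\<lambda>k. a \<otimes> diffq h pw k) \<oplus> h \<otimes> lin pw"
    by (simp add: phi_def lin_lmult lin_pow)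
  also have "\<dots> = lin (\<lambda>k. a \<otimes> diffq h pw k \<oplus> h \<otimes> a [^] k)"
    by (simp add: lin_add lin_lmult)
  also have "\<dots> = lin (\<lambda>k. diffq h pw k \<otimes> a \<oplus> a [^] k \<otimes> h)"
    using diffq_pow[of h] by simp
  also have "\<dots> = lin (\<lambda>k. diffq h pw k \<otimes> a) \<oplus> lin pw \<otimes> h"
    by (simp add: lin_add lin_rmult)
  also have "\<dots> = phi h pw \<otimes> a" by (simp add: phi_def lin_rmult lin_pow)
  finally show ?thesis by simp
qed

lemma phi_rmult_commuting:
  assumes "h \<in> carrier R" "y \<in> carrier R" "y \<otimes> a = a \<otimes> y"
  shows "phi (h \<otimes> y) pw = phi h pw \<otimes> y"
proof -
  have "y \<otimes> a [^] k = a [^] k \<otimes> y" for k :: nat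
    using group_commutes_pow[of a y k] assms by simp
  then show ?thesis
    using assms phi_mult_shift[of pw h y] phi_rmult[of pw h y] by simp
qed

lemma phi_nonzero: "\<exists>h \<in> carrier R. phi h pw \<noteq> \<zero>"
proof (rule ccontr)
  assume "\<not> ?thesis"
  then have z: "\<zero> \<otimes> phi h pw = phi h pw" if "h \<in> carrier R" for h using that by auto
  obtain m' where m': "m = Suc m'" using m_pos by (cases m) auto
  have "independent (ring_center R) (a [^] m' # pows a m')"
    using a_indep by (simp add: m' pows_simps)
  then have "a [^] m' \<notin> Span (ring_center R) (pows a m')" by (rule independent_backwards(1))
  then obtain L where L: "L \<in> mult_ops" "L (a [^] m') = \<one>" "\<And>k. k < m' \<Longrightarrow> L (a [^] k) = \<zero>"
    using mult_op_separates[of "pows a m'" "a [^] m'"]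
    by (auto simp: set_pows image_subset_iff simp del: Span.simps)
  have "phi \<one> (\<lambda>k. L (a [^] k)) = \<one>"
    using L m' mult_op_closed[OF L(1)] by (intro phi_unit) auto
  moreover have "\<zero> \<otimes> phi \<one> (\<lambda>k. L (a [^] k)) = phi \<one> (\<lambda>k. L (a [^] k))"
    by (rule phi_transfer[OF L(1) _ _ _ z]) auto
  ultimately show False using one_not_zero by simp
qed

end

declare (in ring) Span.simps [simp del]

context skew_field
begin

lemma plus_plus_minus: "x \<in> carrier R \<Longrightarrow> y \<in> carrier R \<Longrightarrow> x \<oplus> (y \<oplus> \<ominus> x) = y"
  by (simp add: a_lcomm[of x] r_neg)

lemma inv_eqI:
  assumes "x \<in> carrier R" "y \<in> carrier R" "x \<otimes> y = \<one>"
  shows "inv x = y"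
proof -
  have "x \<noteq> \<zero>" using assms(2,3) one_not_zero by auto
  then show ?thesis using assms by (metis inv_cancel(1) inv_nz(1) r_one)
qed

lemma Span_Nil: "Span K [] = {\<zero>}"
  by (simp add: Span.simps)

lemma Span_Cons: "Span K (u # Us) = line_extension K u (Span K Us)"
  by (simp add: Span.simps)

lemma Span_subsetI:
  assumes "\<zero> \<in> E" "\<And>k u v. k \<in> K \<Longrightarrow> u \<in> set Us \<Longrightarrow> v \<in> E \<Longrightarrow> k \<otimes> u \<oplus> v \<in> E"
  shows "Span K Us \<subseteq> E"
  using assms(2)
proof (induction Us)
  case Nil
  then show ?case using assms(1) by (simp add: Span_Nil)
next
  case (Cons u Us)
  then show ?case by (force simp: Span_Cons line_extension_mem_iff)
qed

end

context algebraic_element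
begin

lemma phi_derivative:
  assumes "central_evaluation R T" "central_evaluation.rat R T s"
    and max: "\<And>t. t \<in> T \<Longrightarrow> t \<noteq> \<zero> \<Longrightarrow>
      \<not> independent (ring_center R) (pows (a \<oplus> t \<otimes> s t) (Suc m))"
  shows "phi (s \<zero>) pw \<in> Span (ring_center R) (pows a m)"
proof (rule ccontr)
  interpret T: central_evaluation R T by fact
  let ?F = "ring_center R"
  assume notin: "phi (s \<zero>) pw \<notin> Span ?F (pows a m)"
  have s: "s t \<in> carrier R" if "t \<in> T" for t using T.rat_closed[OF assms(2) that] .
  define x where "x t = a \<oplus> t \<otimes> s t" for t
  define E where "E t = rec_nat \<zero> (\<lambda>k e. e \<otimes> x t \<oplus> a [^] k \<otimes> s t)" for t
  have E0 [simp]: "E t 0 = \<zero>" and ES [simp]: "E t (Suc k) = E t k \<otimes> x t \<oplus> a [^] k \<otimes> s t" for t k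
    by (simp_all add: E_def)
  have x: "x t \<in> carrier R" if "t \<in> T" for t using s[OF that] that by (simp add: x_def)
  have E: "E t k \<in> carrier R" if "t \<in> T" for t k
    using s[OF that] x[OF that] by (induction k) auto
  have xpow: "x t [^] k = a [^] k \<oplus> t \<otimes> E t k" if t: "t \<in> T" for t and k :: nat
  proof (induction k)
    case (Suc k)
    note [simp] = s[OF t] x[OF t] E[OF t] T.T_closed[OF t]
    have "x t [^] Suc k = (a [^] k \<oplus> t \<otimes> E t k) \<otimes> x t" using Suc by simp
    also have "\<dots> = a [^] k \<otimes> x t \<oplus> t \<otimes> (E t k \<otimes> x t)" by (simp add: l_distr m_assoc)
    also have "a [^] k \<otimes> x t = a [^] Suc k \<oplus> t \<otimes> (a [^] k \<otimes> s t)"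
      using T.T_lcomm[OF t, of "a [^] k" "s t"] by (simp add: x_def r_distr)
    finally show ?case by (simp add: r_distr a_ac)
  qed (use E t in simp)
  have rx: "T.rat x"
    unfolding x_def by (intro T.rat_add T.rat_mult T.rat_const T.rat_id assms(2)) simp
  have rE: "T.rat (\<lambda>t. E t k)" for k
  proof (induction k)
    case (Suc k)
    then show ?case unfolding ES by (intro T.rat_add T.rat_mult rx assms(2) T.rat_const) auto
  qed (simp add: T.rat_const)
  have rlin: "T.rat (\<lambda>t. lin (E t))"
  proof (rule T.rat_cong)
    show "T.rat (\<lambda>t. E t m \<oplus> \<ominus> \<one> \<otimes> (\<Oplus>k\<in>{..<m}. c k \<otimes> E t k))"
      by (intro T.rat_add T.rat_mult T.rat_finsum rE T.rat_const) auto
    show "lin (E t) = E t m \<oplus> \<ominus> \<one> \<otimes> (\<Oplus>k\<in>{..<m}. c k \<otimes> E t k)" if "t \<in> T" for t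
      using E[OF that] by (simp add: lin_def a_minus_def l_minus)
  qed
  have s0: "s \<zero> \<in> carrier R" "x \<zero> = a" using s[OF T.zero_T] by (auto simp: x_def)
  have E_0: "E \<zero> k = diffq (s \<zero>) pw k" for k
  proof (induction k)
    case (Suc k)
    then show ?case using diffq_pow[OF s0(1), of k] s0(2) by simp
  qed simp
  then have "E \<zero> = diffq (s \<zero>) pw" by blast
  then have lin0: "lin (E \<zero>) = phi (s \<zero>) pw" by (simp add: phi_def)
  define vs where "vs = (\<lambda>t. lin (E t)) # map (\<lambda>k t. x t [^] k) (rev [0..<m])"
  have vs: "map (\<lambda>v. v t) vs = lin (E t) # pows (x t) m" for t
    by (simp add: vs_def pows_def)
  have "independent ?F (map (\<lambda>v. v \<zero>) vs)"
    unfolding vs lin0 s0(2) using notin s0(1) by (intro li_Cons a_indep) auto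
  moreover have "T.rat v" if "v \<in> set vs" for v
    using that rlin T.rat_pow[OF rx] by (auto simp: vs_def)
  ultimately have "finite {t \<in> T. \<not> independent ?F (map (\<lambda>v. v t) vs)}"
    by (rule T.rat_independent[rotated])
  then have fin: "finite ({t \<in> T. \<not> independent ?F (lin (E t) # pows (x t) m)} \<union> {\<zero>})"
    unfolding vs by simp
  have "infinite (T - ({t \<in> T. \<not> independent ?F (lin (E t) # pows (x t) m)} \<union> {\<zero>}))"
    by (rule Diff_infinite_finite[OF fin T.T_infinite])
  then obtain t where "t \<in> T - ({t \<in> T. \<not> independent ?F (lin (E t) # pows (x t) m)} \<union> {\<zero>})"
    by (metis (no_types, lifting) ex_in_conv finite.emptyI)
  then have t: "t \<in> T" "t \<noteq> \<zero>" "independent ?F (lin (E t) # pows (x t) m)" by auto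
  note F = center_subfield
  have cl: "set (pows (x t) m) \<subseteq> carrier R" using x[OF t(1)] by (auto simp: set_pows)
  have "x t [^] m \<in> Span ?F (pows (x t) m)"
  proof (rule ccontr)
    assume "\<not> ?thesis"
    then have "independent ?F (pows (x t) (Suc m))"
      using x[OF t(1)] independent_backwards(2)[OF t(3)] by (auto simp: pows_simps intro!: li_Cons)
    then show False using max[OF t(1,2)] by (simp add: x_def)
  qed
  moreover have "(\<Oplus>k\<in>{..<m}. c k \<otimes> x t [^] k) \<in> Span ?F (pows (x t) m)"
    by (rule finsum_mem_Span_pows[OF x[OF t(1)] c_center])
  ultimately have "lin (\<lambda>k. x t [^] k) \<in> Span ?F (pows (x t) m)"
    unfolding lin_def a_minus_def
    using Span_subgroup_props(3,4)[OF F cl] by blast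
  also have "lin (\<lambda>k. x t [^] k) = t \<otimes> lin (E t)"
    using E[OF t(1)] t(1) by (simp add: xpow lin_add lin_lmult lin_pow)
  finally have "lin (E t) \<in> Span ?F (pows (x t) m)"
    using Span_m_inv_simprule[OF F cl, of t "lin (E t)"] t(1,2) T.T_center E[OF t(1)] by auto
  then show False using independent_backwards(1)[OF t(3)] by blast
qed

text \<open>Artin's argument: a left relation of minimal support between the vectors of all
  \<^term>\<open>a [^] k \<otimes> v i\<close>, normalized to have a coefficient \<^term>\<open>\<one>\<close>, has coefficients commuting
  with \<^term>\<open>a\<close>.\<close>

lemma left_dimension_over_centralizer:
  assumes C: "subfield (cent {a}) R" and Vs: "independent (cent {a}) Vs"
  shows "length Vs \<le> m"
proof (rule ccontr)
  let ?F = "ring_center R"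
  let ?n = "length Vs"
  assume "\<not> ?n \<le> m"
  then have mn: "m < card {..<?n}" by simp
  have Vc: "set Vs \<subseteq> carrier R" by (rule independent_in_carrier[OF Vs])
  define v where "v i = (if i < ?n then Vs ! i else \<zero>)" for i
  have v [simp]: "v i \<in> carrier R" for i using Vc nth_mem by (fastforce simp: v_def)
  define rel where "rel e \<longleftrightarrow> (\<forall>i. e i \<in> carrier R) \<and> (\<exists>i \<in> {..<?n}. e i \<noteq> \<zero>) \<and>
    (\<forall>k < m. (\<Oplus>i\<in>{..<?n}. e i \<otimes> (a [^] k \<otimes> v i)) = \<zero>)" for e :: "nat \<Rightarrow> 'a"
  define supp where "supp e = {i \<in> {..<?n}. e i \<noteq> \<zero>}" for e :: "nat \<Rightarrow> 'a"
  have "\<exists>e. rel e"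
    unfolding rel_def by (rule exists_left_relation[OF _ mn]) auto
  then obtain e0 where "rel e0" by blast
  from ex_has_least_nat[of rel, OF this, of "\<lambda>e. card (supp e)"]
  obtain d where d: "rel d" "\<And>e. rel e \<Longrightarrow> card (supp d) \<le> card (supp e)" by metis
  then obtain j where j: "j < ?n" "d j \<noteq> \<zero>" unfolding rel_def by auto
  have dc [simp]: "d i \<in> carrier R" for i using d(1) unfolding rel_def by blast
  define e where "e i = inv (d j) \<otimes> d i" for i
  have e [simp]: "e i \<in> carrier R" "e j = \<one>" for i using j by (simp_all add: e_def)
  have supp_e: "supp e = supp d" using j by (simp add: supp_def e_def)
  define Y where "Y = {y \<in> carrier R. (\<Oplus>i\<in>{..<?n}. e i \<otimes> (y \<otimes> v i)) = \<zero>}"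
  have "a [^] k \<in> Y" if "k < m" for k
  proof -
    have "(\<Oplus>i\<in>{..<?n}. e i \<otimes> (a [^] k \<otimes> v i))
        = (\<Oplus>i\<in>{..<?n}. inv (d j) \<otimes> (d i \<otimes> (a [^] k \<otimes> v i)))"
      using j by (simp add: e_def m_assoc)
    also have "\<dots> = inv (d j) \<otimes> (\<Oplus>i\<in>{..<?n}. d i \<otimes> (a [^] k \<otimes> v i))"
      using j by (intro finsum_rdistr[symmetric]) auto
    finally show ?thesis using d(1) that j unfolding rel_def Y_def by simp
  qed
  note Ypow = this
  have YSpan: "Span ?F (pows a m) \<subseteq> Y"
  proof (rule Span_subsetI)
    show "\<zero> \<in> Y" by (simp add: Y_def)
    fix k u w assume k: "k \<in> ?F" and "u \<in> set (pows a m)" and w: "w \<in> Y"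
    then have u: "u \<in> Y" using Ypow by (auto simp: set_pows)
    have [simp]: "k \<in> carrier R" "u \<in> carrier R" "w \<in> carrier R"
      using ring_centerD(1)[OF k] u w by (auto simp: Y_def)
    have "e i \<otimes> ((k \<otimes> u \<oplus> w) \<otimes> v i) = k \<otimes> (e i \<otimes> (u \<otimes> v i)) \<oplus> e i \<otimes> (w \<otimes> v i)" for i
      using ring_centerD(2)[OF k, of "e i"] by (simp add: l_distr r_distr m_assoc[symmetric])
    then have "(\<Oplus>i\<in>{..<?n}. e i \<otimes> ((k \<otimes> u \<oplus> w) \<otimes> v i))
        = (\<Oplus>i\<in>{..<?n}. k \<otimes> (e i \<otimes> (u \<otimes> v i))) \<oplus> (\<Oplus>i\<in>{..<?n}. e i \<otimes> (w \<otimes> v i))"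
      by (simp add: finsum_addf)
    also have "(\<Oplus>i\<in>{..<?n}. k \<otimes> (e i \<otimes> (u \<otimes> v i))) = k \<otimes> (\<Oplus>i\<in>{..<?n}. e i \<otimes> (u \<otimes> v i))"
      by (intro finsum_rdistr[symmetric]) auto
    finally show "k \<otimes> u \<oplus> w \<in> Y" using u w by (simp add: Y_def)
  qed
  have "a [^] m \<in> Y"
    using YSpan finsum_mem_Span_pows[OF a_closed c_center] a_pow by auto
  then have Y: "a [^] k \<in> Y" if "k \<le> m" for k using Ypow[of k] that by (cases "k = m") auto
  define f where "f i = e i \<otimes> a \<oplus> \<ominus> a \<otimes> e i" for i
  have f: "f i \<in> carrier R" for i by (simp add: f_def)
  have frel: "(\<Oplus>i\<in>{..<?n}. f i \<otimes> (a [^] k \<otimes> v i)) = \<zero>" if "k < m" for k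
  proof -
    have "f i \<otimes> (a [^] k \<otimes> v i) = e i \<otimes> (a [^] Suc k \<otimes> v i) \<oplus> \<ominus> a \<otimes> (e i \<otimes> (a [^] k \<otimes> v i))" for i
      unfolding nat_pow_Suc2[OF a_closed] by (simp add: f_def l_distr m_assoc)
    then have "(\<Oplus>i\<in>{..<?n}. f i \<otimes> (a [^] k \<otimes> v i)) = (\<Oplus>i\<in>{..<?n}. e i \<otimes> (a [^] Suc k \<otimes> v i))
        \<oplus> (\<Oplus>i\<in>{..<?n}. \<ominus> a \<otimes> (e i \<otimes> (a [^] k \<otimes> v i)))"
      by (simp add: finsum_addf del: nat_pow_Suc)
    also have "(\<Oplus>i\<in>{..<?n}. \<ominus> a \<otimes> (e i \<otimes> (a [^] k \<otimes> v i)))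
        = \<ominus> a \<otimes> (\<Oplus>i\<in>{..<?n}. e i \<otimes> (a [^] k \<otimes> v i))"
      by (intro finsum_rdistr[symmetric]) auto
    finally show ?thesis using Y[of k] Y[of "Suc k"] that by (simp add: Y_def del: nat_pow_Suc)
  qed
  have "supp f \<subset> supp d"
  proof
    show "supp f \<subseteq> supp d" unfolding supp_e[symmetric] by (auto simp: supp_def f_def)
    have "f j = \<zero>" by (simp add: f_def l_minus r_neg)
    then have "j \<notin> supp f" by (simp add: supp_def)
    moreover have "j \<in> supp d" using j by (simp add: supp_def)
    ultimately show "supp f \<noteq> supp d" by blast
  qed
  then have "card (supp f) < card (supp d)" by (intro psubset_card_mono) (auto simp: supp_def)
  then have "\<not> rel f" using d(2)[of f] by linarith
  then have f0: "f i = \<zero>" if "i < ?n" for i using frel f that unfolding rel_def by blast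
  have eC: "e i \<in> cent {a}" if "i < ?n" for i
    using f0[OF that] minus_zero_iff[of "e i \<otimes> a" "a \<otimes> e i"]
    by (simp add: cent_def f_def l_minus a_minus_def)
  have "combine (map e [0..<?n]) (map v [0..<?n]) = (\<Oplus>i\<in>{..<?n}. e i \<otimes> v i)"
    by (rule combine_map_upt) auto
  also have "\<dots> = \<zero>" using Y[of 0] by (simp add: Y_def)
  also have "map v [0..<?n] = Vs" by (intro nth_equalityI) (auto simp: v_def)
  finally have "set (take ?n (map e [0..<?n])) \<subseteq> {\<zero>}"
    using eC by (intro independent_imp_trivial_combine[OF C Vs]) auto
  then have sub: "e ` {0..<?n} \<subseteq> {\<zero>}" by simp
  have "e j \<in> {\<zero>}" by (rule subsetD[OF sub imageI]) (use j in simp)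
  then show False using one_not_zero by simp
qed

end

locale maximal_element = algebraic_element +
  fixes N :: "'a set"
  assumes center_infinite: "infinite (ring_center R)"
    and N_closed: "N \<subseteq> carrier R - {\<zero>}"
    and N_mult: "\<And>x y. x \<in> N \<Longrightarrow> y \<in> N \<Longrightarrow> x \<otimes> y \<in> N"
    and N_inv: "\<And>x. x \<in> N \<Longrightarrow> inv x \<in> N"
    and N_conj: "\<And>g x. g \<in> carrier R \<Longrightarrow> g \<noteq> \<zero> \<Longrightarrow> x \<in> N \<Longrightarrow> g \<otimes> x \<otimes> inv g \<in> N"
    and N_noncentral: "\<not> N \<subseteq> ring_center R"
    and a_in_N: "a \<in> N"
    and maximal: "\<And>x. x \<in> N \<Longrightarrow> \<not> independent (ring_center R) (pows x (Suc m))"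
begin

abbreviation "C \<equiv> cent {a}"
abbreviation "CC \<equiv> cent C"

lemma C_div: "div_subring C" and CC_div: "div_subring CC"
  by (intro cent_div_subring; use centD(1) in auto)+

lemma a_nonzero: "a \<noteq> \<zero>"
  using a_in_N N_closed by auto

lemma a_in_CC: "a \<in> CC"
  by (auto simp: cent_def)

lemma C_iff: "y \<in> C \<longleftrightarrow> y \<in> carrier R \<and> y \<otimes> a = a \<otimes> y"
  by (auto simp: cent_def)

lemma Span_pows_CC: "Span (ring_center R) (pows a m) \<subseteq> CC"
proof (rule Span_subsetI)
  show "\<zero> \<in> CC" by (rule div_subringD(2)[OF CC_div])
  have p: "a [^] k \<in> CC" for k :: nat
    using div_subringD(3,5)[OF CC_div] a_in_CC by (induction k) auto
  have "k \<in> CC" if "k \<in> ring_center R" for k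
    unfolding cent_def[of C] using that ring_centerD centD(1)[of _ "{a}"] by blast
  then show "k \<otimes> u \<oplus> v \<in> CC" if "k \<in> ring_center R" "u \<in> set (pows a m)" "v \<in> CC" for k u v
    using that p div_subringD(5,6)[OF CC_div] by (auto simp: set_pows)
qed

lemma phi_commutator_N:
  assumes b: "b \<in> N" and x: "x \<in> carrier R"
  shows "phi (x \<otimes> b \<ominus> b \<otimes> x) pw \<in> CC"
proof -
  have bc [simp]: "b \<in> carrier R" and b0: "b \<noteq> \<zero>" using b N_closed by auto
  define y where "y = x \<otimes> b"
  have y [simp]: "y \<in> carrier R" using x by (simp add: y_def)
  define T where "T = {t \<in> ring_center R. \<one> \<oplus> t \<otimes> y \<noteq> \<zero>}"
  have Fc: "t \<in> carrier R" if "t \<in> ring_center R" for t using ring_centerD(1)[OF that] .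
  have "t = t'" if "t \<in> ring_center R - T" "t' \<in> ring_center R - T" for t t'
  proof -
    have t: "t \<in> carrier R" "t' \<in> carrier R" "\<one> \<oplus> t \<otimes> y = \<zero>" "\<one> \<oplus> t' \<otimes> y = \<zero>"
      using that Fc by (auto simp: T_def)
    then have "y \<noteq> \<zero>" using one_not_zero by auto
    moreover have "t \<otimes> y = t' \<otimes> y"
      using t add.l_cancel[of \<one> "t \<otimes> y" "t' \<otimes> y"] by simp
    ultimately show ?thesis using mult_right_cancel[of y t t'] t by simp
  qed
  then have "finite (ring_center R - T)"
    by (metis finite.simps insertCI is_singletonI' is_singleton_def)
  moreover have "T \<subseteq> ring_center R" by (auto simp: T_def)
  ultimately have Tinf: "infinite T" using center_infinite Diff_infinite_finite by fastforce
  have "central_evaluation R T"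
    using Tinf one_not_zero by unfold_locales (auto simp: T_def ring_center_def)
  then interpret T: central_evaluation R T .
  define g where "g t = \<one> \<oplus> t \<otimes> y" for t
  have g: "g t \<in> carrier R" "g t \<noteq> \<zero>" if "t \<in> T" for t using that Fc by (auto simp: g_def T_def)
  have gpoly: "T.poly g"
    unfolding g_def by (intro T.poly_add T.poly_mult T.poly_const T.poly_id) auto
  define q where "q = y \<otimes> b \<oplus> \<ominus> (b \<otimes> y)"
  have q [simp]: "q \<in> carrier R" by (simp add: q_def)
  define s where "s t = q \<otimes> inv (g t) \<otimes> inv b \<otimes> a" for t
  have rs: "T.rat s"
    unfolding s_def using b0 g
    by (intro T.rat_mult T.rat_const T.rat_inv gpoly) auto
  have eq: "a \<oplus> t \<otimes> s t = g t \<otimes> b \<otimes> inv (g t) \<otimes> inv b \<otimes> a" if t: "t \<in> T" for t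
  proof -
    note [simp] = g[OF t] T.T_closed[OF t]
    have ibc [simp]: "inv b \<in> carrier R" using b0 by simp
    have "b \<otimes> g t \<oplus> t \<otimes> q = g t \<otimes> b"
      using T.T_lcomm[OF t, of b y]
      by (simp add: g_def q_def l_distr r_distr r_minus m_assoc a_ac plus_plus_minus)
    then have "g t \<otimes> b \<otimes> inv (g t) = (b \<otimes> g t \<oplus> t \<otimes> q) \<otimes> inv (g t)" by simp
    also have "\<dots> = b \<oplus> t \<otimes> (q \<otimes> inv (g t))" by (simp add: l_distr m_assoc)
    finally have "g t \<otimes> b \<otimes> inv (g t) \<otimes> inv b \<otimes> a
        = b \<otimes> inv b \<otimes> a \<oplus> t \<otimes> (q \<otimes> inv (g t) \<otimes> inv b \<otimes> a)"
      by (simp add: l_distr m_assoc)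
    then show ?thesis using b0 by (simp add: s_def)
  qed
  have "phi (s \<zero>) pw \<in> Span (ring_center R) (pows a m)"
  proof (rule phi_derivative[OF T.central_evaluation_axioms rs])
    fix t assume t: "t \<in> T"
    have "a \<oplus> t \<otimes> s t \<in> N"
      unfolding eq[OF t] using g[OF t] b by (intro N_mult N_conj N_inv a_in_N) auto
    then show "\<not> independent (ring_center R) (pows (a \<oplus> t \<otimes> s t) (Suc m))" by (rule maximal)
  qed
  then have 1: "phi (s \<zero>) pw \<in> CC" using Span_pows_CC by blast
  have "g \<zero> = \<one>" by (simp add: g_def)
  then have "s \<zero> = (y \<otimes> b \<oplus> \<ominus> (b \<otimes> y)) \<otimes> inv b \<otimes> a" using b0 by (simp add: s_def q_def)
  also have "(y \<otimes> b \<oplus> \<ominus> (b \<otimes> y)) \<otimes> inv b = x \<otimes> b \<ominus> b \<otimes> x"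
    using b0 x by (simp add: y_def l_distr l_minus m_assoc a_minus_def)
  finally have "phi (s \<zero>) pw = phi (x \<otimes> b \<ominus> b \<otimes> x) pw \<otimes> a"
    using x by (simp add: phi_rmult_commuting)
  then have "phi (x \<otimes> b \<ominus> b \<otimes> x) pw = phi (s \<zero>) pw \<otimes> inv a"
    using x a_nonzero by (simp add: m_assoc)
  then show ?thesis
    using 1 a_in_CC a_nonzero div_subringD(5,8)[OF CC_div] by simp
qed

definition S :: "'a set" where
  "S = {b \<in> carrier R. \<forall>x \<in> carrier R. phi (x \<otimes> b \<ominus> b \<otimes> x) pw \<in> CC}"

lemma S_div: "div_subring S"
proof (rule div_subringI)
  have z: "phi \<zero> pw = \<zero>" using phi_lmult[of pw \<zero> \<zero>] by simp
  show "\<one> \<in> S"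
    using z div_subringD(2)[OF CC_div] by (simp add: S_def a_minus_def r_neg)
  fix b assume b: "b \<in> S"
  have bc [simp]: "b \<in> carrier R" using b by (simp add: S_def)
  have bS: "phi (x \<otimes> b \<ominus> b \<otimes> x) pw \<in> CC" if "x \<in> carrier R" for x
    using b that by (simp add: S_def)
  have neg: "phi (b \<otimes> x \<ominus> x \<otimes> b) pw \<in> CC" if x: "x \<in> carrier R" for x
  proof -
    have "b \<otimes> x \<ominus> x \<otimes> b = \<ominus> \<one> \<otimes> (x \<otimes> b \<ominus> b \<otimes> x)"
      using x by (simp add: a_minus_def l_minus minus_add a_comm)
    then have "phi (b \<otimes> x \<ominus> x \<otimes> b) pw = \<ominus> phi (x \<otimes> b \<ominus> b \<otimes> x) pw"
      using x phi_lmult[of pw "x \<otimes> b \<ominus> b \<otimes> x" "\<ominus> \<one>"] by (simp add: l_minus r_minus)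
    then show ?thesis using bS[OF x] div_subringD(4)[OF CC_div] by simp
  qed
  have "x \<otimes> \<ominus> b \<ominus> \<ominus> b \<otimes> x = b \<otimes> x \<ominus> x \<otimes> b" if "x \<in> carrier R" for x
    using that by (simp add: a_minus_def l_minus r_minus a_comm)
  then show "\<ominus> b \<in> S" using neg by (simp add: S_def)
  show "inv b \<in> S" if b0: "b \<noteq> \<zero>"
  proof -
    have "x \<otimes> inv b \<ominus> inv b \<otimes> x = b \<otimes> (inv b \<otimes> x \<otimes> inv b) \<ominus> (inv b \<otimes> x \<otimes> inv b) \<otimes> b"
      if "x \<in> carrier R" for x
      using that b0 by (simp add: m_assoc)
    then show ?thesis using neg b0 by (simp add: S_def)
  qed
  fix d assume d: "d \<in> S"
  have dc [simp]: "d \<in> carrier R" using d by (simp add: S_def)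
  have dS: "phi (x \<otimes> d \<ominus> d \<otimes> x) pw \<in> CC" if "x \<in> carrier R" for x
    using d that by (simp add: S_def)
  have "x \<otimes> (b \<oplus> d) \<ominus> (b \<oplus> d) \<otimes> x = (x \<otimes> b \<ominus> b \<otimes> x) \<oplus> (x \<otimes> d \<ominus> d \<otimes> x)"
    if "x \<in> carrier R" for x
    using that by (simp add: a_minus_def l_distr r_distr minus_add a_ac)
  then show "b \<oplus> d \<in> S"
    using bS dS div_subringD(6)[OF CC_div] by (simp add: S_def phi_add)
  have "x \<otimes> (b \<otimes> d) \<ominus> (b \<otimes> d) \<otimes> x
      = ((x \<otimes> b) \<otimes> d \<ominus> d \<otimes> (x \<otimes> b)) \<oplus> ((d \<otimes> x) \<otimes> b \<ominus> b \<otimes> (d \<otimes> x))"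
    if "x \<in> carrier R" for x
    using that by (simp add: a_minus_def m_assoc a_assoc r_neg1)
  then show "b \<otimes> d \<in> S"
    using bS dS div_subringD(6)[OF CC_div] by (simp add: S_def phi_add)
qed (auto simp: S_def)

lemma S_eq_carrier: "S = carrier R"
proof -
  define E where "E = {b \<in> carrier R. \<forall>g \<in> carrier R - {\<zero>}. g \<otimes> b \<otimes> inv g \<in> S}"
  have ES: "E \<subseteq> S"
  proof
    fix b assume "b \<in> E"
    then have b: "b \<in> carrier R" "\<forall>g \<in> carrier R - {\<zero>}. g \<otimes> b \<otimes> inv g \<in> S"
      unfolding E_def by auto
    have "\<one> \<otimes> b \<otimes> inv \<one> \<in> S" using one_not_zero by (intro b(2)[rule_format]) auto
    then show "b \<in> S" using b(1) by simp
  qed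
  have E: "div_subring E"
  proof (rule div_subringI)
    show "\<one> \<in> E" using div_subringD(3)[OF S_div] by (auto simp: E_def)
    fix b assume b: "b \<in> E"
    then have bc [simp]: "b \<in> carrier R" by (simp add: E_def)
    have bS: "g \<otimes> b \<otimes> inv g \<in> S" if "g \<in> carrier R" "g \<noteq> \<zero>" for g
      using b that by (simp add: E_def)
    show "\<ominus> b \<in> E"
      using bS div_subringD(4)[OF S_div] by (auto simp: E_def l_minus r_minus)
    show "inv b \<in> E" if b0: "b \<noteq> \<zero>"
    proof -
      have "g \<otimes> inv b \<otimes> inv g = inv (g \<otimes> b \<otimes> inv g)" if "g \<in> carrier R" "g \<noteq> \<zero>" for g
        using that b0 by (intro inv_eqI[symmetric]) (simp_all add: m_assoc)
      then show ?thesis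
        using bS b0 div_subringD(8)[OF S_div] by (auto simp: E_def)
    qed
    fix d assume d: "d \<in> E"
    then have dc [simp]: "d \<in> carrier R" by (simp add: E_def)
    have dS: "g \<otimes> d \<otimes> inv g \<in> S" if "g \<in> carrier R" "g \<noteq> \<zero>" for g
      using d that by (simp add: E_def)
    show "b \<oplus> d \<in> E"
      using bS dS div_subringD(6)[OF S_div] by (auto simp: E_def l_distr r_distr)
    have "g \<otimes> (b \<otimes> d) \<otimes> inv g = (g \<otimes> b \<otimes> inv g) \<otimes> (g \<otimes> d \<otimes> inv g)"
      if "g \<in> carrier R" "g \<noteq> \<zero>" for g
      using that by (simp add: m_assoc)
    then show "b \<otimes> d \<in> E"
      using bS dS div_subringD(5)[OF S_div] by (auto simp: E_def)
  qed (auto simp: E_def)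
  have NS: "N \<subseteq> S" using phi_commutator_N N_closed by (auto simp: S_def)
  have NE: "N \<subseteq> E" using NS N_conj N_closed by (auto simp: E_def)
  have "E = carrier R"
  proof (rule cartan_brauer_hua[OF E])
    fix g x assume g: "g \<in> carrier R" "g \<noteq> \<zero>" and x: "x \<in> E"
    have xc: "x \<in> carrier R" using x by (simp add: E_def)
    have "h \<otimes> (g \<otimes> x \<otimes> inv g) \<otimes> inv h \<in> S" if h: "h \<in> carrier R" "h \<noteq> \<zero>" for h
    proof -
      have "(h \<otimes> g) \<otimes> x \<otimes> inv (h \<otimes> g) \<in> S" using x g h by (simp add: E_def)
      moreover have "inv (h \<otimes> g) = inv g \<otimes> inv h"
        using g h by (intro inv_eqI) (simp_all add: m_assoc)
      ultimately show ?thesis using g h xc by (simp add: m_assoc)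
    qed
    then show "g \<otimes> x \<otimes> inv g \<in> E" using g xc by (auto simp: E_def)
  qed (use NE N_noncentral in blast)
  then show ?thesis using ES by (auto simp: S_def)
qed

lemma commutator_in_CC:
  assumes uv: "u \<in> C" "v \<in> C"
  shows "u \<otimes> v \<ominus> v \<otimes> u \<in> CC"
proof -
  have cc [simp]: "u \<in> carrier R" "v \<in> carrier R" and ca: "u \<otimes> a = a \<otimes> u" "v \<otimes> a = a \<otimes> v"
    using uv by (auto simp: C_iff)
  obtain h0 where h0: "h0 \<in> carrier R" "phi h0 pw \<noteq> \<zero>" using phi_nonzero by blast
  define z where "z = phi h0 pw"
  have z [simp]: "z \<in> carrier R" "z \<noteq> \<zero>" using h0 by (simp_all add: z_def)
  have "z \<in> C" using phi_commute[OF h0(1)] by (simp add: C_iff z_def h0(1))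
  then have iz: "v \<otimes> inv z \<in> C" using uv div_subringD(5,8)[OF C_div] by simp
  define h where "h = (v \<otimes> inv z) \<otimes> h0"
  have h [simp]: "h \<in> carrier R" using h0 by (simp add: h_def)
  have ph: "phi h pw = v"
    using iz h0 phi_lmult[of pw h0 "v \<otimes> inv z"] by (simp add: h_def C_iff z_def[symmetric] m_assoc)
  have "phi (u \<otimes> h \<ominus> h \<otimes> u) pw = phi (u \<otimes> h) pw \<oplus> phi (\<ominus> \<one> \<otimes> (h \<otimes> u)) pw"
    by (simp add: a_minus_def phi_add[symmetric] l_minus)
  also have "phi (\<ominus> \<one> \<otimes> (h \<otimes> u)) pw = \<ominus> \<one> \<otimes> phi (h \<otimes> u) pw"
    by (rule phi_lmult) (auto simp: l_minus r_minus)
  also have "phi (h \<otimes> u) pw = v \<otimes> u" using ca by (simp add: phi_rmult_commuting ph)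
  also have "phi (u \<otimes> h) pw = u \<otimes> v" using ca by (simp add: phi_lmult ph)
  finally have "phi (u \<otimes> h \<ominus> h \<otimes> u) pw = u \<otimes> v \<ominus> v \<otimes> u" by (simp add: a_minus_def l_minus)
  moreover have "phi (u \<otimes> h \<ominus> h \<otimes> u) pw \<in> CC"
    using S_eq_carrier cc(1) h unfolding S_def by blast
  ultimately show ?thesis by simp
qed

lemma C_commute:
  assumes uv: "u \<in> C" "v \<in> C"
  shows "u \<otimes> v = v \<otimes> u"
proof (rule ccontr)
  assume neq: "u \<otimes> v \<noteq> v \<otimes> u"
  have [simp]: "u \<in> carrier R" "v \<in> carrier R" using uv by (auto simp: C_iff)
  define \<delta> where "\<delta> = u \<otimes> v \<ominus> v \<otimes> u"
  have \<delta> [simp]: "\<delta> \<in> carrier R" "\<delta> \<noteq> \<zero>"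
    using neq by (simp_all add: \<delta>_def minus_zero_iff)
  have "\<delta> \<in> CC" unfolding \<delta>_def by (rule commutator_in_CC[OF uv])
  then have \<delta>u: "\<delta> \<otimes> v = v \<otimes> \<delta>" "\<delta> \<otimes> u = u \<otimes> \<delta>" using centD(2) uv by blast+
  have "u \<otimes> (u \<otimes> v) \<ominus> (u \<otimes> v) \<otimes> u = u \<otimes> \<delta>"
    by (simp add: \<delta>_def a_minus_def r_distr r_minus m_assoc)
  then have "u \<otimes> \<delta> \<in> CC"
    using commutator_in_CC[OF uv(1), of "u \<otimes> v"] uv div_subringD(5)[OF C_div] by simp
  then have "(u \<otimes> \<delta>) \<otimes> v = v \<otimes> (u \<otimes> \<delta>)" using centD(2) uv by blast
  then have "u \<otimes> v \<otimes> \<delta> = v \<otimes> u \<otimes> \<delta>" using \<delta>u by (simp add: m_assoc)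
  then show False using neq mult_right_cancel[of \<delta> "u \<otimes> v" "v \<otimes> u"] by simp
qed

lemma C_subfield: "subfield C R"
  using C_div C_commute div_subringD(8)[OF C_div]
  unfolding div_subring_def by (intro subfieldI_skew) auto

text \<open>A \<^term>\<open>z\<close> commuting with \<^term>\<open>a\<close> commutes with every value of \<^const>\<open>phi\<close>.  If \<^term>\<open>z\<close> were
  not in the field generated by \<^term>\<open>a\<close>, then the products of powers of \<^term>\<open>a\<close> with \<^term>\<open>z\<close>
  would be independent of the powers, and this identity could be separated.\<close>

lemma C_eq_generate_field: "C = generate_field R (insert a (ring_center R))"
proof
  let ?F = "ring_center R"
  let ?H = "insert a ?F"
  let ?G = "generate_field R ?H"
  have H: "?H \<subseteq> carrier R" using ring_centerD(1) by auto
  have Fc: "?F \<subseteq> carrier R" using ring_centerD(1) by blast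
  show "?G \<subseteq> C"
  proof
    fix x assume x: "x \<in> ?G"
    have "x \<otimes> a = a \<otimes> x"
      by (intro generate_field_commute[OF H a_closed _ x])
        (auto intro: ring_centerD(2)[OF _ a_closed])
    then show "x \<in> C" using generate_field_closed[OF H x] by (simp add: C_iff)
  qed
  have G: "?G \<subseteq> carrier R" using generate_field_closed[OF H] by blast
  note Gi = generate_field.intros
  have aG: "a [^] k \<in> ?G" for k :: nat
    by (induction k) (auto intro: Gi)
  have G0: "\<zero> \<in> ?G"
    using Gi(5)[OF Gi(1) Gi(3)[OF Gi(1)], of R ?H] by (simp add: r_neg)
  have SpanG: "Span ?F (pows a n) \<subseteq> ?G" for n
    using G0 aG by (intro Span_subsetI) (auto simp: set_pows intro!: Gi(5) Gi(6) intro: Gi(2))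
  show "C \<subseteq> ?G"
  proof (rule ccontr)
    assume "\<not> C \<subseteq> ?G"
    then obtain z where z: "z \<in> C" "z \<notin> ?G" by blast
    have zc [simp]: "z \<in> carrier R" using z by (simp add: C_iff)
    obtain m' where m': "m = Suc m'" using m_pos by (cases m) auto
    have pc: "set (pows a n) \<subseteq> carrier R" for n by (auto simp: set_pows)
    have pc': "set (map (\<lambda>u. u \<otimes> z) (pows a m')) \<subseteq> carrier R" by (auto simp: set_pows)
    note F = center_subfield
    have "independent ?F (a [^] m' # pows a m')"
      using a_indep by (simp add: m' pows_simps)
    then have nin: "a [^] m' \<notin> Span ?F (pows a m')" by (rule independent_backwards(1))
    define Us where "Us = map (\<lambda>u. u \<otimes> z) (pows a m') @ pows a m"
    have Us: "set Us \<subseteq> carrier R" using pc pc' by (auto simp: Us_def)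
    have "a [^] m' \<otimes> z \<notin> Span ?F Us"
    proof
      assume "a [^] m' \<otimes> z \<in> Span ?F Us"
      then have "a [^] m' \<otimes> z \<in> Span ?F (map (\<lambda>u. u \<otimes> z) (pows a m')) <+>\<^bsub>R\<^esub> Span ?F (pows a m)"
        unfolding Us_def Span_append_eq_set_add[OF F pc' pc] .
      then obtain u v where uv: "u \<in> Span ?F (map (\<lambda>u. u \<otimes> z) (pows a m'))" "v \<in> Span ?F (pows a m)"
        "a [^] m' \<otimes> z = u \<oplus> v"
        unfolding set_add_def' by blast
      obtain Ks where Ks: "set Ks \<subseteq> ?F" "u = combine Ks (map (\<lambda>u. u \<otimes> z) (pows a m'))"
        using uv(1) unfolding Span_eq_combine_set[OF F pc'] by blast
      define w where "w = combine Ks (pows a m')"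
      have w: "w \<in> Span ?F (pows a m')"
        unfolding Span_eq_combine_set[OF F pc] w_def using Ks(1) by blast
      then have wc [simp]: "w \<in> carrier R" using SpanG G by blast
      have vc [simp]: "v \<in> carrier R" using uv(2) SpanG G by blast
      have u: "u = w \<otimes> z"
        unfolding w_def Ks(2) by (rule combine_l_distr[symmetric, OF subset_trans[OF Ks(1) Fc] pc zc])
      define k where "k = a [^] m' \<oplus> \<ominus> w"
      have kc [simp]: "k \<in> carrier R" by (simp add: k_def)
      have k0: "k \<noteq> \<zero>"
        using nin w minus_zero_iff[of "a [^] m'" w] by (auto simp: k_def a_minus_def)
      have "w \<in> ?G" using w SpanG by blast
      then have kG: "k \<in> ?G" unfolding k_def using aG by (intro Gi(5) Gi(3))
      have "k \<otimes> z = v"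
        using uv(3) u by (simp add: k_def l_distr l_minus a_comm[of "w \<otimes> z"] a_assoc r_neg)
      then have eq: "inv k \<otimes> v = z" using inv_cancel(1)[OF kc k0 zc] by metis
      have "v \<in> ?G" using uv(2) SpanG by blast
      then have "z \<in> ?G" unfolding eq[symmetric] by (rule Gi(6)[OF Gi(4)[OF kG k0]])
      then show False using z(2) by blast
    qed
    then obtain L where L: "L \<in> mult_ops" "L (a [^] m' \<otimes> z) = \<one>" "\<And>u. u \<in> set Us \<Longrightarrow> L u = \<zero>"
      using mult_op_separates[OF Us, of "a [^] m' \<otimes> z"] by fastforce
    note Lc [simp] = mult_op_closed[OF L(1)]
    have "z \<otimes> phi h pw = phi h (\<lambda>k. a [^] k \<otimes> z)" if h: "h \<in> carrier R" for h
    proof -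
      have "phi h pw \<in> C" using h phi_commute[OF h] by (simp add: C_iff)
      then show ?thesis using C_commute[OF z(1)] phi_rmult[of pw h z] h by simp
    qed
    then have "z \<otimes> phi \<one> (\<lambda>k. L (a [^] k)) = phi \<one> (\<lambda>k. L (a [^] k \<otimes> z))"
      by (rule phi_transfer[OF L(1), rotated 3]) auto
    moreover have "phi \<one> (\<lambda>k. L (a [^] k)) = \<zero>"
      by (rule phi_zero) (auto intro!: L(3) simp: Us_def set_pows)
    moreover have "phi \<one> (\<lambda>k. L (a [^] k \<otimes> z)) = \<one>"
      using L(2) m' by (intro phi_unit) (auto intro!: L(3) simp: Us_def set_pows)
    ultimately show False using one_not_zero by simp
  qed
qed

lemma finite_dimension_carrier:
  assumes "dimension n (ring_center R) (generate_field R (insert a (ring_center R)))"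
  shows "\<exists>k \<le> m. dimension (n * k) (ring_center R) (carrier R)"
proof -
  note C = C_subfield
  define P where "P k \<longleftrightarrow> (\<exists>Vs. independent C Vs \<and> length Vs = k)" for k
  have "P 0" by (auto simp: P_def)
  moreover have bound: "k \<le> m" if "P k" for k
    using that left_dimension_over_centralizer[OF C] by (auto simp: P_def)
  ultimately obtain k where k: "P k" "\<And>j. P j \<Longrightarrow> j \<le> k"
    using GreatestI_nat[of P 0 m] Greatest_le_nat[of P _ m] by metis
  then obtain Vs where Vs: "independent C Vs" "length Vs = k" by (auto simp: P_def)
  have "v \<in> Span C Vs" if "v \<in> carrier R" for v
  proof (rule ccontr)
    assume "v \<notin> Span C Vs"
    then have "independent C (v # Vs)" using Vs that by (intro li_Cons)
    then have "P (Suc k)" using Vs(2) by (auto simp: P_def intro!: exI[of _ "v # Vs"])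
    then show False using k(2) by fastforce
  qed
  then have "Span C Vs = carrier R"
    using Span_subgroup_props(1)[OF C independent_in_carrier[OF Vs(1)]] by blast
  then have "dimension k C (carrier R)" using dimension_independent[OF Vs(1)] Vs(2) by simp
  then have "dimension (n * k) (ring_center R) (carrier R)"
    using telescopic_base[OF center_subfield C] assms C_eq_generate_field by simp
  then show ?thesis using bound[OF k(1)] by blast
qed

end

context skew_field
begin

lemma dimension_bound_infinite_center:
  assumes inf: "infinite (ring_center R)"
    and N: "N \<subseteq> carrier R - {\<zero>}" "\<And>x y. x \<in> N \<Longrightarrow> y \<in> N \<Longrightarrow> x \<otimes> y \<in> N"
      "\<And>x. x \<in> N \<Longrightarrow> inv x \<in> N"
      "\<And>g x. g \<in> carrier R \<Longrightarrow> g \<noteq> \<zero> \<Longrightarrow> x \<in> N \<Longrightarrow> g \<otimes> x \<otimes> inv g \<in> N"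
    and nc: "\<not> N \<subseteq> ring_center R"
    and alg: "algebraic_of_bounded_degree (ring_center R) d N"
  shows "finite_dimension (ring_center R) (carrier R) \<and> (dim over ring_center R) (carrier R) \<le> d\<^sup>2"
proof -
  let ?F = "ring_center R"
  note F = center_subfield
  define P where "P k \<longleftrightarrow> (\<exists>x \<in> N. independent ?F (pows x k))" for k
  define n where "n x = (dim over ?F) (generate_field R (insert x ?F))" for x
  have dimn: "dimension (n x) ?F (generate_field R (insert x ?F))" "n x \<le> d" if "x \<in> N" for x
    using alg that finite_dimensionE[OF F] unfolding algebraic_of_bounded_degree_def n_def by auto
  have le: "k \<le> n x" if x: "x \<in> N" and k: "independent ?F (pows x k)" for x k
  proof -
    have "x [^] j \<in> generate_field R (insert x ?F)" for j :: nat
      by (induction j) (auto intro: generate_field.intros)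
    then show ?thesis
      using independent_length_le_dimension[OF F dimn(1)[OF x] k] by (auto simp: pows_simps set_pows)
  qed
  have "P 0" using nc by (auto simp: P_def pows_simps)
  moreover have "k \<le> d" if "P k" for k using that le dimn(2) le_trans unfolding P_def by blast
  ultimately obtain m where m: "P m" "\<And>j. P j \<Longrightarrow> j \<le> m"
    using GreatestI_nat[of P 0 d] Greatest_le_nat[of P _ d] by metis
  then obtain a where a: "a \<in> N" "independent ?F (pows a m)" by (auto simp: P_def)
  have max: "\<not> independent ?F (pows x (Suc m))" if "x \<in> N" for x
    using m(2)[of "Suc m"] that by (auto simp: P_def)
  have ac: "a \<in> carrier R" using a N by blast
  have "a [^] m \<in> Span ?F (pows a m)"
  proof (rule ccontr)
    assume "\<not> ?thesis"
    then have "independent ?F (pows a (Suc m))"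
      using ac a(2) by (auto simp: pows_simps intro!: li_Cons)
    then show False using max[OF a(1)] by blast
  qed
  then obtain c where c: "\<forall>k. c k \<in> ?F" "a [^] m = (\<Oplus>k\<in>{..<m}. c k \<otimes> a [^] k)"
    using Span_pows_finsum[OF ac] by blast
  interpret maximal_element R a m c N
    using ac c a inf N nc max by unfold_locales auto
  obtain k where k: "k \<le> m" "dimension (n a * k) ?F (carrier R)"
    using finite_dimension_carrier[OF dimn(1)[OF a(1)]] by blast
  have "m \<le> n a" by (rule le[OF a])
  then have "n a * k \<le> d\<^sup>2"
    unfolding power2_eq_square using k(1) dimn(2)[OF a(1)] by (intro mult_le_mono) auto
  then show ?thesis using finite_dimensionI[OF k(2)] dimI[OF F k(2)] by simp
qed

end

section \<open>Finite center\<close>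

context ring
begin

lemma finsum_shift:
  assumes "\<And>i. f i \<in> carrier R"
  shows "(\<Oplus>i\<in>{..<n}. f (Suc i)) \<oplus> f 0 = (\<Oplus>i\<in>{..<n}. f i) \<oplus> f n"
proof (induction n)
  case (Suc n)
  have [simp]: "(\<Oplus>i\<in>{..<n}. f i) \<in> carrier R" "(\<Oplus>i\<in>{..<n}. f (Suc i)) \<in> carrier R"
    using assms by auto
  have "(\<Oplus>i\<in>{..<Suc n}. f (Suc i)) \<oplus> f 0 = (\<Oplus>i\<in>{..<n}. f (Suc i)) \<oplus> f 0 \<oplus> f (Suc n)"
    using assms by (simp add: finsum_lessThan_Suc a_ac)
  then show ?case using Suc assms by (simp add: finsum_lessThan_Suc)
qed (use assms in simp)

end

context skew_field
begin

lemma geometric_sum_zero: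
  assumes u: "u \<in> carrier R" "u \<noteq> \<one>" "u [^] (n::nat) = \<one>"
  shows "(\<Oplus>i\<in>{..<n}. u [^] i) = \<zero>"
proof -
  define s where "s = (\<Oplus>i\<in>{..<n}. u [^] i)"
  have s [simp]: "s \<in> carrier R" using u(1) by (simp add: s_def)
  have "u \<otimes> s = (\<Oplus>i\<in>{..<n}. u \<otimes> u [^] i)"
    unfolding s_def using u(1) by (intro finsum_rdistr) auto
  also have "\<dots> = (\<Oplus>i\<in>{..<n}. u [^] Suc i)"
    using nat_pow_Suc2[OF u(1)] by simp
  finally have "u \<otimes> s \<oplus> \<one> = s \<oplus> \<one>"
    using finsum_shift[of "\<lambda>i. u [^] i" n] u by (simp add: s_def)
  then have "u \<otimes> s = \<one> \<otimes> s" using u(1) by simp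
  then show ?thesis using mult_right_cancel[of s u \<one>] u s_def s by auto
qed

lemma finite_subfield_order:
  assumes K: "subfield K R" "finite K"
  shows "add_pow R (card K) \<one> = \<zero>" "y \<in> K \<Longrightarrow> y \<noteq> \<zero> \<Longrightarrow> y [^] (card K - 1) = \<one>"
proof -
  let ?K = "R\<lparr>carrier := K\<rparr>"
  interpret K: field ?K by (rule subfield_iff(2)[OF K(1)])
  have one: "\<one> \<in> K" using K.one_closed by simp
  show "add_pow R (card K) \<one> = \<zero>"
    using K.add.pow_order_eq_1[of \<one>] one by (simp add: order_def add_pow_def nat_pow_def)
  assume y: "y \<in> K" "y \<noteq> \<zero>"
  interpret M: group "Multiplicative_Group.mult_of ?K" by (rule K.field_mult_group)
  have "y [^]\<^bsub>Multiplicative_Group.mult_of ?K\<^esub> order (Multiplicative_Group.mult_of ?K) = \<one>\<^bsub>Multiplicative_Group.mult_of ?K\<^esub>"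
    by (rule M.pow_order_eq_1) (use K(2) y in auto)
  moreover have "order (Multiplicative_Group.mult_of ?K) = card K - 1"
    using K.zero_closed by (simp add: order_def)
  ultimately show "y [^] (card K - 1) = \<one>" by (simp add: nat_pow_def Multiplicative_Group.mult_of_def)
qed

text \<open>The operator \<^term>\<open>\<lambda>y. a \<otimes> y \<otimes> inv a\<close> has an eigenvector whose eigenvalue is a nontrivial
  power of \<^term>\<open>a\<close>, found by a discrete Fourier transform; characteristic plays no role.\<close>

lemma conjugate_to_other_power:
  assumes a: "a \<in> carrier R" "a \<noteq> \<zero>" "a [^] (M::nat) = \<one>" "M \<noteq> 0"
    and y: "y \<in> carrier R" "a \<otimes> y \<noteq> y \<otimes> a"
  obtains x and k :: nat where "x \<in> carrier R" "x \<noteq> \<zero>" "x \<otimes> a = a [^] k \<otimes> x" "a [^] k \<noteq> a"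
proof -
  define n where "n = (LEAST n::nat. n \<noteq> 0 \<and> a [^] n = \<one>)"
  have "n \<noteq> 0 \<and> a [^] n = \<one>"
    unfolding n_def by (rule LeastI[of "\<lambda>n::nat. n \<noteq> 0 \<and> a [^] n = \<one>" M]) (use a(3,4) in blast)
  then have n: "n \<noteq> 0" "a [^] n = \<one>" by auto
  have least: "n \<le> j" if "j \<noteq> 0" "a [^] j = \<one>" for j :: nat
    unfolding n_def using that by (intro Least_le) auto
  note [simp] = a(1) y(1)
  have pow0: "a [^] i \<noteq> \<zero>" for i :: nat
    using a(1,2) by (induction i) (auto simp: one_not_zero)
  have inj: "inj_on (\<lambda>i. a [^] i) {..<n}"
  proof (rule linorder_inj_onI)
    fix i j assume ij: "i < j" "i \<in> {..<n}" "j \<in> {..<n}"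
    show "a [^] i \<noteq> a [^] j"
    proof
      assume eq: "a [^] i = a [^] j"
      have "a [^] i \<otimes> a [^] (j - i) = a [^] j"
        using nat_pow_mult[OF a(1), of i "j - i"] ij by simp
      then have "a [^] i \<otimes> a [^] (j - i) = a [^] i \<otimes> \<one>" using eq by simp
      then have "a [^] (j - i) = \<one>"
        using mult_left_cancel[of "a [^] i" "a [^] (j - i)" \<one>] pow0 by simp
      then show False using least[of "j - i"] ij by auto
    qed
  qed auto
  define \<tau> where "\<tau> z = a \<otimes> z \<otimes> inv a" for z
  define w where "w i = (\<tau> ^^ i) y" for i
  have wc [simp]: "w i \<in> carrier R" and ww: "w i \<otimes> a [^] i = a [^] i \<otimes> y" for i
  proof (induction i)
    case (Suc i)
    case 1
    show ?case using Suc a(2) by (simp add: w_def \<tau>_def)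
    case 2
    have "w (Suc i) \<otimes> a [^] Suc i = a \<otimes> w i \<otimes> inv a \<otimes> (a \<otimes> a [^] i)"
      using nat_pow_Suc2[OF a(1), of i] by (simp add: w_def \<tau>_def)
    also have "\<dots> = a \<otimes> (w i \<otimes> a [^] i)" using Suc a(2) by (simp add: m_assoc)
    also have "\<dots> = a [^] Suc i \<otimes> y"
      using Suc nat_pow_Suc2[OF a(1), of i] by (simp add: m_assoc)
    finally show ?case .
  qed (simp_all add: w_def)
  have wS: "w (Suc i) = a \<otimes> w i \<otimes> inv a" for i by (simp add: w_def \<tau>_def)
  have wn: "w n = w 0" using ww[of n] wc[of n] n by (simp add: w_def)
  define z where "z i = w (Suc i) \<ominus> w i" for i
  have zc [simp]: "z i \<in> carrier R" for i by (simp add: z_def)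
  have zS: "z (Suc i) = a \<otimes> z i \<otimes> inv a" for i
    unfolding z_def wS[of "Suc i"] using a(2) wS[of i]
    by (simp add: a_minus_def r_distr l_distr r_minus l_minus)
  have zn: "z n = z 0" unfolding z_def using wS[of n] wS[of 0] wn by simp
  have z0: "z 0 \<noteq> \<zero>"
  proof
    assume "z 0 = \<zero>"
    then have "a \<otimes> y \<otimes> inv a = y"
      using minus_zero_iff[of "w (Suc 0)" "w 0"] a(2) by (simp add: z_def w_def \<tau>_def)
    then have "a \<otimes> y \<otimes> inv a \<otimes> a = y \<otimes> a" by simp
    then show False using y a(2) by (simp add: m_assoc)
  qed
  define u where "u j = (\<Oplus>i\<in>{..<n}. (a [^] i) [^] j \<otimes> z i)" for j :: nat
  have "\<exists>j. u j \<noteq> \<zero>"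
  proof (rule ccontr)
    assume "\<not> ?thesis"
    then have "z 0 = \<zero>"
      using inj n(1) unfolding u_def
      by (intro vandermonde_zero[of "\<lambda>i. a [^] i" z n 0]) (auto simp: nat_pow_mult add.commute)
    then show False using z0 by simp
  qed
  then obtain j where j: "u j \<noteq> \<zero>" by blast
  have uc [simp]: "u j \<in> carrier R" by (simp add: u_def)
  have pc: "(a [^] i) [^] j = a [^] (i * j)" for i by (simp add: nat_pow_pow)
  define g where "g i = a [^] (i * j) \<otimes> z i" for i
  have gc [simp]: "g i \<in> carrier R" for i by (simp add: g_def)
  have gS: "g (Suc i) = a [^] Suc j \<otimes> g i \<otimes> inv a" for i
  proof -
    have "a [^] Suc j \<otimes> a [^] (i * j) = a [^] (Suc i * j) \<otimes> a"
      using nat_pow_mult[OF a(1), of "Suc j" "i * j"] nat_pow_mult[OF a(1), of "Suc i * j" "Suc 0"]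
      by (simp add: add.commute add.left_commute del: nat_pow_Suc)
    then show ?thesis
      unfolding g_def zS using a(2) by (simp add: m_assoc[symmetric] del: nat_pow_Suc)
  qed
  have "g n = g 0" using n zn by (simp add: g_def nat_pow_pow[symmetric])
  then have "(\<Oplus>i\<in>{..<n}. g (Suc i)) = (\<Oplus>i\<in>{..<n}. g i)"
    using finsum_shift[of g n] by simp
  moreover have "(\<Oplus>i\<in>{..<n}. g (Suc i)) = a [^] Suc j \<otimes> (\<Oplus>i\<in>{..<n}. g i) \<otimes> inv a"
  proof -
    have "(\<Oplus>i\<in>{..<n}. g (Suc i)) = (\<Oplus>i\<in>{..<n}. a [^] Suc j \<otimes> g i \<otimes> inv a)"
      by (simp add: gS del: nat_pow_Suc)
    also have "\<dots> = (\<Oplus>i\<in>{..<n}. a [^] Suc j \<otimes> g i) \<otimes> inv a"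
      using a(2) by (intro finsum_ldistr[symmetric]) (auto simp del: nat_pow_Suc)
    also have "(\<Oplus>i\<in>{..<n}. a [^] Suc j \<otimes> g i) = a [^] Suc j \<otimes> (\<Oplus>i\<in>{..<n}. g i)"
      by (intro finsum_rdistr[symmetric]) (auto simp del: nat_pow_Suc)
    finally show ?thesis .
  qed
  moreover have "(\<Oplus>i\<in>{..<n}. g i) = u j" by (simp add: u_def g_def pc)
  ultimately have "u j = a [^] Suc j \<otimes> u j \<otimes> inv a" by simp
  then have "u j \<otimes> a = a [^] Suc j \<otimes> u j \<otimes> inv a \<otimes> a" by simp
  then have eig: "u j \<otimes> a = a [^] Suc j \<otimes> u j" using a(2) by (simp add: m_assoc del: nat_pow_Suc)
  have neq: "a [^] Suc j \<noteq> a"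
  proof
    assume "a [^] Suc j = a"
    then have "a [^] j \<otimes> a = \<one> \<otimes> a" by simp
    then have aj: "a [^] j = \<one>" using mult_right_cancel[of a "a [^] j" \<one>] a(2) by simp
    have "(a [^] i) [^] j = (a [^] j) [^] i" for i :: nat
      using nat_pow_pow[OF a(1), of i j] nat_pow_pow[OF a(1), of j i] by (simp add: mult.commute)
    then have "(a [^] i) [^] j = \<one>" for i :: nat using aj by simp
    then have "u j = (\<Oplus>i\<in>{..<n}. z i)" by (simp add: u_def)
    also have "\<dots> = (\<Oplus>i\<in>{..<n}. w (Suc i) \<oplus> \<ominus> \<one> \<otimes> w i)"
      by (simp add: z_def a_minus_def l_minus)
    also have "\<dots> = (\<Oplus>i\<in>{..<n}. w (Suc i)) \<oplus> (\<Oplus>i\<in>{..<n}. \<ominus> \<one> \<otimes> w i)"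
      by (intro finsum_addf) auto
    also have "(\<Oplus>i\<in>{..<n}. \<ominus> \<one> \<otimes> w i) = \<ominus> \<one> \<otimes> (\<Oplus>i\<in>{..<n}. w i)"
      by (intro finsum_rdistr[symmetric]) auto
    also have "(\<Oplus>i\<in>{..<n}. w (Suc i)) = (\<Oplus>i\<in>{..<n}. w i)"
      using finsum_shift[of w n] wn by simp
    finally have "u j = \<zero>" by (simp add: l_minus r_neg)
    then show False using j by simp
  qed
  show ?thesis by (rule that[OF uc j eig neq])
qed

end

context central_evaluation
begin

lemma periodic_commutators_absurd:
  assumes a: "a \<in> carrier R" "a \<noteq> \<zero>" and x: "x \<in> carrier R" "a \<otimes> x \<noteq> x \<otimes> a"
    and nz: "\<And>t. t \<in> T \<Longrightarrow> \<one> \<oplus> t \<otimes> x \<noteq> \<zero>"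
    and Ms: "finite Ms" "\<And>M. M \<in> Ms \<Longrightarrow> add_pow R (M::nat) \<one> \<noteq> \<zero>"
    and per: "\<And>t. t \<in> T \<Longrightarrow> t \<noteq> \<zero> \<Longrightarrow>
      \<exists>M \<in> Ms. ((\<one> \<oplus> t \<otimes> x) \<otimes> a \<otimes> inv (\<one> \<oplus> t \<otimes> x) \<otimes> inv a) [^] M = \<one>"
  shows False
proof -
  define g where "g t = \<one> \<oplus> t \<otimes> x" for t
  have g [simp]: "g t \<in> carrier R" "g t \<noteq> \<zero>" if "t \<in> T" for t
    using nz that x by (auto simp: g_def)
  define v where "v t = g t \<otimes> a \<otimes> inv (g t) \<otimes> inv a" for t
  have gpoly: "poly g"
    unfolding g_def by (intro poly_add poly_mult poly_const poly_id) (use x in auto)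
  have v: "rat v"
    unfolding v_def using a by (intro rat_mult rat_const rat_inv rat_poly gpoly) auto
  note vc = rat_closed[OF v]
  define S where "S M t = (\<Oplus>i\<in>{..<M}. v t [^] i)" for M :: nat and t
  have "v \<zero> = \<one>" using a x(1) one_not_zero by (simp add: v_def g_def m_assoc)
  then have S0: "S M \<zero> = add_pow R M \<one>" for M
    by (simp add: S_def add.finprod_const)
  have "finite {t \<in> T. S M t = \<zero>}" if "M \<in> Ms" for M
  proof (rule rat_zeros)
    show "rat (S M)" unfolding S_def by (intro rat_finsum rat_pow v) auto
    show "S M \<zero> \<noteq> \<zero>" using Ms(2)[OF that] S0 by simp
  qed
  then have "finite (\<Union>M \<in> Ms. {t \<in> T. S M t = \<zero>})" using Ms(1) by blast
  moreover have "T - {\<zero>} \<subseteq> (\<Union>M \<in> Ms. {t \<in> T. S M t = \<zero>})"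
  proof
    fix t assume "t \<in> T - {\<zero>}"
    then have t: "t \<in> T" "t \<noteq> \<zero>" by auto
    then obtain M where M: "M \<in> Ms" "v t [^] M = \<one>" using per by (auto simp: v_def g_def)
    have "v t \<noteq> \<one>"
    proof
      assume "v t = \<one>"
      then have "v t \<otimes> (a \<otimes> g t) = a \<otimes> g t" using a g[OF t(1)] by simp
      moreover have "v t \<otimes> (a \<otimes> g t) = g t \<otimes> a"
        using a g[OF t(1)] by (simp add: v_def m_assoc)
      ultimately have "a \<oplus> t \<otimes> (x \<otimes> a) = a \<oplus> t \<otimes> (a \<otimes> x)"
        using a x t T_lcomm[OF t(1), of a x] by (simp add: g_def r_distr l_distr m_assoc)
      then have "t \<otimes> (x \<otimes> a) = t \<otimes> (a \<otimes> x)" using a x t by simp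
      then show False using mult_left_cancel[of t "x \<otimes> a" "a \<otimes> x"] a x t by simp
    qed
    then have "S M t = \<zero>" unfolding S_def using vc[OF t(1)] M(2) by (intro geometric_sum_zero)
    then show "t \<in> (\<Union>M \<in> Ms. {t \<in> T. S M t = \<zero>})" using M t by blast
  qed
  ultimately have "finite (T - {\<zero>})" by (rule finite_subset[rotated])
  then show False using T_infinite by simp
qed

end

context ring
begin

inductive_set add_span :: "'a set \<Rightarrow> 'a set" for H where
  add_span_zero: "\<zero> \<in> add_span H"
| add_span_add: "h \<in> H \<Longrightarrow> s \<in> add_span H \<Longrightarrow> h \<oplus> s \<in> add_span H"

context
  fixes H assumes H: "H \<subseteq> carrier R"
begin

lemma add_span_closed: "s \<in> add_span H \<Longrightarrow> s \<in> carrier R"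
  by (induction rule: add_span.induct) (use H in auto)

lemma add_span_incl: "h \<in> H \<Longrightarrow> h \<in> add_span H"
  using add_span_add[OF _ add_span_zero, of h H] H by auto

lemma add_span_plus: "s \<in> add_span H \<Longrightarrow> s' \<in> add_span H \<Longrightarrow> s \<oplus> s' \<in> add_span H"
proof (induction rule: add_span.induct)
  case (add_span_add h s)
  have "h \<oplus> (s \<oplus> s') \<in> add_span H"
    by (rule add_span.add_span_add[OF add_span_add(1) add_span_add(3)[OF add_span_add(4)]])
  moreover have "h \<oplus> (s \<oplus> s') = h \<oplus> s \<oplus> s'"
    using add_span_add H add_span_closed by (intro a_assoc[symmetric]) auto
  ultimately show ?case by simp
qed (simp add: add_span_closed)

lemma add_span_finsum:
  assumes "finite I" "\<And>i. i \<in> I \<Longrightarrow> f i \<in> add_span H"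
  shows "(\<Oplus>i\<in>I. f i) \<in> add_span H"
  using assms
proof (induction I)
  case (insert i I)
  then show ?case using add_span_closed by (subst finsum_insert) (auto intro!: add_span_plus)
qed (simp add: add_span_zero)

lemma add_span_map:
  assumes "\<And>h. h \<in> H \<Longrightarrow> f h \<in> add_span H" "f \<zero> = \<zero>"
    "\<And>x y. x \<in> carrier R \<Longrightarrow> y \<in> carrier R \<Longrightarrow> f (x \<oplus> y) = f x \<oplus> f y"
    and "s \<in> add_span H"
  shows "f s \<in> add_span H"
  using assms(4)
proof (induction rule: add_span.induct)
  case (add_span_add h s)
  have "f (h \<oplus> s) = f h \<oplus> f s"
    using add_span_add H add_span_closed by (intro assms(3)) auto
  then show ?case using add_span_plus[OF assms(1)] add_span_add by simp
qed (simp add: assms(2) add_span_zero)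

end

lemma finite_add_span:
  assumes "finite H" "H \<subseteq> carrier R" "p \<noteq> 0" "add_pow R (p::nat) \<one> = \<zero>"
  shows "finite (add_span H)"
  using assms(1,2)
proof (induction H)
  case empty
  have "s \<in> {\<zero>}" if "s \<in> add_span {}" for s
    using that by (induction rule: add_span.induct) auto
  then have "add_span {} \<subseteq> {\<zero>}" by blast
  then show ?case by (rule finite_subset) simp
next
  case (insert h H)
  have h: "h \<in> carrier R" and H: "H \<subseteq> carrier R" using insert.prems by auto
  have p: "add_pow R p h = \<zero>"
    using add_pow_ldistr[of \<one> h p] h assms(4) by simp
  let ?B = "(\<lambda>(n, s). add_pow R (n::nat) h \<oplus> s) ` ({..<p} \<times> add_span H)"
  have "s \<in> ?B" if "s \<in> add_span (insert h H)" for s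
    using that
  proof (induction rule: add_span.induct)
    case add_span_zero
    then show ?case
      using assms(3) add_span.add_span_zero[of H] by (intro image_eqI[of _ _ "(0, \<zero>)"]) auto
  next
    case (add_span_add g s)
    then obtain n s' where s: "n < p" "s' \<in> add_span H" "s = add_pow R n h \<oplus> s'" by auto
    have s'c: "s' \<in> carrier R" using add_span_closed[OF H s(2)] .
    show ?case
    proof (cases "g = h")
      case True
      have eq: "g \<oplus> s = add_pow R (Suc n) h \<oplus> s'"
        using h s s'c True by (simp add: a_ac)
      show ?thesis
      proof (cases "Suc n = p")
        case True
        then have "g \<oplus> s = add_pow R (0::nat) h \<oplus> s'" using eq p by simp
        then show ?thesis using assms(3) s(2) by (intro image_eqI[of _ _ "(0, s')"]) auto
      next
        case False
        then show ?thesis using eq s by (intro image_eqI[of _ _ "(Suc n, s')"]) auto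
      qed
    next
      case False
      then have g: "g \<in> H" using add_span_add by auto
      then have "g \<oplus> s = add_pow R n h \<oplus> (g \<oplus> s')"
        using h s s'c H by (auto simp: a_ac)
      then show ?thesis
        using s(1) add_span.add_span_add[OF g s(2)] by (intro image_eqI[of _ _ "(n, g \<oplus> s')"]) auto
    qed
  qed
  then have "add_span (insert h H) \<subseteq> ?B" by blast
  moreover have "finite ?B" using insert by simp
  ultimately show ?case by (rule finite_subset)
qed

lemma conj_pow:
  assumes "y \<in> carrier R" "a \<in> carrier R" "b \<in> carrier R" "y \<otimes> a = b \<otimes> y"
  shows "y \<otimes> a [^] (n::nat) = b [^] n \<otimes> y"
proof (induction n)
  case (Suc n)
  have "y \<otimes> a [^] Suc n = y \<otimes> a [^] n \<otimes> a" using assms by (simp add: m_assoc)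
  also have "\<dots> = b [^] n \<otimes> (y \<otimes> a)" unfolding Suc using assms(1-3) by (simp add: m_assoc)
  also have "\<dots> = b [^] Suc n \<otimes> y" unfolding assms(4) using assms(1-3) by (simp add: m_assoc)
  finally show ?case .
qed (use assms in simp)

lemma pow_conj_pow:
  fixes k i :: nat
  assumes "x \<in> carrier R" "a \<in> carrier R" "x \<otimes> a = a [^] k \<otimes> x"
  shows "x [^] i \<otimes> a = a [^] (k ^ i) \<otimes> x [^] (i::nat)"
proof (induction i)
  case (Suc i)
  have "x [^] Suc i \<otimes> a = x [^] i \<otimes> (x \<otimes> a)" using assms(1,2) by (simp add: m_assoc)
  also have "\<dots> = x [^] i \<otimes> a [^] k \<otimes> x"
    unfolding assms(3) using assms(1,2) by (simp add: m_assoc)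
  also have "x [^] i \<otimes> a [^] k = (a [^] (k ^ i)) [^] k \<otimes> x [^] i"
    by (rule conj_pow) (use assms Suc in auto)
  finally show ?case using assms(1,2) by (simp add: nat_pow_pow m_assoc mult.commute)
qed (use assms in simp)

end

context skew_field
begin

lemma pow_nonzero: "x \<in> carrier R \<Longrightarrow> x \<noteq> \<zero> \<Longrightarrow> x [^] (n::nat) \<noteq> \<zero>"
  using one_not_zero by (induction n) auto

lemma finite_powers:
  assumes "a \<in> carrier R" "a [^] (n::nat) = \<one>" "n \<noteq> 0"
  shows "a [^] (i::nat) \<in> (\<lambda>j. a [^] j) ` {..<n}"
proof -
  have "a [^] i = (a [^] n) [^] (i div n) \<otimes> a [^] (i mod n)"
    using assms(1) by (simp add: nat_pow_pow nat_pow_mult)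
  then have "a [^] i = a [^] (i mod n)" using assms by simp
  then show ?thesis using assms(3) by (intro image_eqI[of _ _ "i mod n"]) auto
qed

lemma commuting_power:
  assumes a: "a \<in> carrier R" "a [^] (n::nat) = \<one>" "n \<noteq> 0"
    and x: "x \<in> carrier R" "x \<noteq> \<zero>" "x \<otimes> a = a [^] (k::nat) \<otimes> x"
  obtains r :: nat where "r \<noteq> 0" "x [^] r \<otimes> a = a \<otimes> x [^] r" "inj_on (\<lambda>i. a [^] (k ^ i)) {..<r}"
proof -
  note px = pow_conj_pow[OF x(1) a(1) x(3)]
  have step: "x [^] (j - i) \<otimes> a = a \<otimes> x [^] (j - i)"
    if ij: "i < j" and eq: "a [^] (k ^ i) = a [^] (k ^ j)" for i j
  proof -
    have xj: "x [^] j = x [^] i \<otimes> x [^] (j - i)" using nat_pow_mult[OF x(1), of i "j - i"] ij by simp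
    note [simp] = x(1) a(1)
    have "x [^] i \<otimes> (x [^] (j - i) \<otimes> a) = x [^] j \<otimes> a" unfolding xj by (simp add: m_assoc)
    also have "\<dots> = a [^] (k ^ i) \<otimes> x [^] i \<otimes> x [^] (j - i)"
      unfolding px[of j] eq[symmetric] unfolding xj by (simp add: m_assoc)
    also have "\<dots> = x [^] i \<otimes> (a \<otimes> x [^] (j - i))"
      unfolding px[of i, symmetric] by (simp add: m_assoc)
    finally have e: "x [^] i \<otimes> (x [^] (j - i) \<otimes> a) = x [^] i \<otimes> (a \<otimes> x [^] (j - i))" .
    show ?thesis by (rule mult_left_cancel[OF _ pow_nonzero[OF x(1,2)] _ _ e]) simp_all
  qed
  define P where "P r \<longleftrightarrow> r \<noteq> 0 \<and> x [^] r \<otimes> a = a \<otimes> x [^] r" for r :: nat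
  have "finite (range (\<lambda>i. a [^] (k ^ i)))"
    by (rule finite_subset[of _ "(\<lambda>j. a [^] j) ` {..<n}"])
      (intro image_subsetI finite_powers[OF a], simp)
  then have "\<not> inj (\<lambda>i. a [^] (k ^ i))" using finite_imageD[of _ "UNIV :: nat set"] by auto
  then have "\<exists>i j. i < j \<and> a [^] (k ^ i) = a [^] (k ^ j)"
    by (rule contrapos_np) (rule linorder_injI, blast)
  then obtain i j where "i < j" "a [^] (k ^ i) = a [^] (k ^ j)" by blast
  then have "P (j - i)" unfolding P_def using step by simp
  then have ex: "\<exists>r. P r" by blast
  define r where "r = (LEAST r. P r)"
  have r: "P r" "\<And>s. P s \<Longrightarrow> r \<le> s"
    unfolding r_def by (rule LeastI_ex[OF ex], rule Least_le)
  have "inj_on (\<lambda>i. a [^] (k ^ i)) {..<r}"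
  proof (rule linorder_inj_onI)
    fix i j assume ij: "i < j" "i \<in> {..<r}" "j \<in> {..<r}"
    show "a [^] (k ^ i) \<noteq> a [^] (k ^ j)"
    proof
      assume "a [^] (k ^ i) = a [^] (k ^ j)"
      then have "r \<le> j - i" using step[OF ij(1)] ij(1) by (intro r(2)) (simp add: P_def)
      then show False using ij r(1) by (auto simp: P_def)
    qed
  qed auto
  then show ?thesis using that[of r] r(1) unfolding P_def by blast
qed

end

text \<open>The situation of a finite cyclic algebra: U together with zero is a finite field on which
  conjugation by x acts nontrivially with order r, as witnessed by the distinct conjugates
  s i of a.\<close>

locale finite_cyclic_pair = skew_field +
  fixes U :: "'a set" and x a :: 'a and r :: nat and s :: "nat \<Rightarrow> 'a"
  assumes U_finite: "finite U" and U_closed: "U \<subseteq> carrier R - {\<zero>}"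
    and U_one: "\<one> \<in> U" and U_mult: "\<And>u v. u \<in> U \<Longrightarrow> v \<in> U \<Longrightarrow> u \<otimes> v \<in> U"
    and U_comm: "\<And>u v. u \<in> U \<Longrightarrow> v \<in> U \<Longrightarrow> u \<otimes> v = v \<otimes> u"
    and U_sum: "\<And>f n. (\<And>i. f i \<in> U) \<Longrightarrow> (\<Oplus>i\<in>{..<n::nat}. f i) \<in> insert \<zero> U"
    and x: "x \<in> carrier R" "x \<noteq> \<zero>" and U_conj: "\<And>u. u \<in> U \<Longrightarrow> x \<otimes> u \<otimes> inv x \<in> U"
    and x_pow: "x [^] r \<in> U" and r: "r \<noteq> 0"
    and a: "a \<in> U" and s: "\<And>i. s i \<in> U" "\<And>i. x [^] i \<otimes> a = s i \<otimes> x [^] i"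
    and s_inj: "inj_on s {..<r}" and s1: "s 1 \<noteq> a"
begin

lemma U_carrier [simp]: "u \<in> U \<Longrightarrow> u \<in> carrier R" and U_nonzero: "u \<in> U \<Longrightarrow> u \<noteq> \<zero>"
  using U_closed by auto

lemma U_pow: "u \<in> U \<Longrightarrow> u [^] (i::nat) \<in> U"
  by (induction i) (auto intro: U_one U_mult)

lemma U_inv:
  assumes u: "u \<in> U"
  shows "inv u \<in> U"
proof -
  have "inj_on (\<lambda>v. u \<otimes> v) U"
    by (rule inj_onI) (rule mult_left_cancel[OF U_carrier[OF u] U_nonzero[OF u]], auto)
  then have "(\<lambda>v. u \<otimes> v) ` U = U"
    by (intro endo_inj_surj U_finite) (auto intro: U_mult u)
  then obtain v where "v \<in> U" "u \<otimes> v = \<one>" using U_one by (metis imageE)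
  then show ?thesis using inv_eqI[of u v] u by simp
qed

lemma x_pow_move: "u \<in> U \<Longrightarrow> \<exists>v \<in> U. x [^] (i::nat) \<otimes> u = v \<otimes> x [^] i"
proof (induction i arbitrary: u)
  case 0
  then show ?case by (intro bexI[of _ u]) auto
next
  case (Suc i)
  define v where "v = x \<otimes> u \<otimes> inv x"
  have v: "v \<in> U" unfolding v_def by (rule U_conj[OF Suc.prems])
  have xu: "x \<otimes> u = v \<otimes> x" unfolding v_def using Suc.prems x by (simp add: m_assoc)
  obtain w where w: "w \<in> U" "x [^] i \<otimes> v = w \<otimes> x [^] i" using Suc.IH[OF v] by blast
  have "x [^] Suc i \<otimes> u = x [^] i \<otimes> (x \<otimes> u)" using x Suc.prems by (simp add: m_assoc)
  also have "\<dots> = x [^] i \<otimes> v \<otimes> x" unfolding xu using x v by (simp add: m_assoc)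
  also have "\<dots> = w \<otimes> x [^] Suc i" unfolding w(2) using x w(1) by (simp add: m_assoc)
  finally show ?case using w(1) by blast
qed

lemma twisted_pow: "c \<in> U \<Longrightarrow> \<exists>e \<in> U. (c \<otimes> x) [^] (i::nat) = e \<otimes> x [^] i"
proof (induction i)
  case 0
  then show ?case using U_one by (intro bexI[of _ \<one>]) auto
next
  case (Suc i)
  then obtain e where e: "e \<in> U" "(c \<otimes> x) [^] i = e \<otimes> x [^] i" by blast
  obtain v where v: "v \<in> U" "x [^] i \<otimes> c = v \<otimes> x [^] i" using x_pow_move[OF Suc.prems] by blast
  have "(c \<otimes> x) [^] Suc i = e \<otimes> x [^] i \<otimes> (c \<otimes> x)" using e(2) by simp
  also have "\<dots> = e \<otimes> (x [^] i \<otimes> c) \<otimes> x" using x e Suc.prems by (simp add: m_assoc)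
  also have "\<dots> = (e \<otimes> v) \<otimes> x [^] Suc i" unfolding v(2) using x e v by (simp add: m_assoc)
  finally show ?case using U_mult[OF e(1) v(1)] by blast
qed

lemma twisted_closed: "c \<in> U \<Longrightarrow> c \<otimes> x \<in> carrier R" "c \<in> U \<Longrightarrow> c \<otimes> x \<noteq> \<zero>"
  using x U_nonzero by auto

lemma twisted_pow_conj:
  fixes i N :: nat
  assumes c: "c \<in> U"
  shows "(c \<otimes> x) [^] i \<otimes> a [^] N = s i [^] N \<otimes> (c \<otimes> x) [^] i"
proof (rule conj_pow)
  obtain e where e: "e \<in> U" "(c \<otimes> x) [^] i = e \<otimes> x [^] i" using twisted_pow[OF c] by blast
  have "e \<otimes> x [^] i \<otimes> a = e \<otimes> (s i \<otimes> x [^] i)"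
    using e(1) x a s(2)[of i, symmetric] by (simp add: m_assoc)
  also have "\<dots> = s i \<otimes> e \<otimes> x [^] i"
    unfolding U_comm[OF s(1) e(1)] using e(1) x s(1) by (simp add: m_assoc)
  finally show "(c \<otimes> x) [^] i \<otimes> a = s i \<otimes> (c \<otimes> x) [^] i"
    unfolding e(2) using e(1) x s(1) by (simp add: m_assoc)
qed (use twisted_closed[OF c] a s(1) in auto)

lemma separate:
  assumes "\<And>i. z i \<in> carrier R" "z 0 \<noteq> \<zero>"
  shows "\<exists>N. (\<Oplus>i\<in>{..<r}. s i [^] (N::nat) \<otimes> z i) \<noteq> \<zero>"
proof (rule ccontr)
  assume *: "\<not> ?thesis"
  have "z 0 = \<zero>"
  proof (rule vandermonde_zero[of s z r 0])
    show "(\<Oplus>i\<in>{..<r}. s i [^] k \<otimes> z i) = \<zero>" for k :: nat using * by blast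
  qed (use s_inj r assms(1) s(1) U_comm[OF s(1) s(1)] in auto)
  then show False using assms(2) by contradiction
qed

definition \<nu> :: "'a \<Rightarrow> 'a" where
  "\<nu> c = (c \<otimes> x) [^] r"

definition U0 :: "'a set" where
  "U0 = {z \<in> U. z \<otimes> x = x \<otimes> z}"

lemma \<nu>_U0:
  assumes c: "c \<in> U"
  shows "\<nu> c \<in> U0"
proof -
  obtain e where e: "e \<in> U" "\<nu> c = e \<otimes> x [^] r"
    using twisted_pow[OF c] unfolding \<nu>_def by blast
  then have zU: "\<nu> c \<in> U" using U_mult x_pow by simp
  have zc: "\<nu> c \<in> carrier R" using zU by simp
  have "c \<otimes> (\<nu> c \<otimes> x) = \<nu> c \<otimes> c \<otimes> x"
    unfolding U_comm[OF zU c] using zc c x by (simp add: m_assoc)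
  also have "\<dots> = (c \<otimes> x) \<otimes> \<nu> c"
    using nat_pow_comm[OF twisted_closed(1)[OF c], of r "Suc 0"] twisted_closed(1)[OF c] zc c x
    by (simp add: \<nu>_def m_assoc)
  finally have "c \<otimes> (\<nu> c \<otimes> x) = c \<otimes> (x \<otimes> \<nu> c)" using zc c x by (simp add: m_assoc)
  then have "\<nu> c \<otimes> x = x \<otimes> \<nu> c"
    by (rule mult_left_cancel[OF U_carrier[OF c] U_nonzero[OF c], rotated 2]) (use zc x in auto)
  then show ?thesis using zU by (simp add: U0_def)
qed

text \<open>Hilbert 90: elements of \<^term>\<open>U\<close> with the same norm differ by a twisted coboundary.\<close>

lemma same_norm_conj:
  assumes c: "c \<in> U" "c' \<in> U" and eq: "\<nu> c = \<nu> c'"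
  shows "\<exists>b \<in> U. c' \<otimes> x \<otimes> b = b \<otimes> (c \<otimes> x)"
proof -
  define u where "u = c \<otimes> x"
  define u' where "u' = c' \<otimes> x"
  note u [simp] = twisted_closed[OF c(1), folded u_def]
  note u' [simp] = twisted_closed[OF c(2), folded u'_def]
  note up [simp] = pow_nonzero[OF u]
  define z where "z i = u' [^] i \<otimes> inv (u [^] i)" for i :: nat
  have zU: "z i \<in> U" for i
  proof -
    obtain e where e: "e \<in> U" "u [^] i = e \<otimes> x [^] i" using twisted_pow[OF c(1)] u_def by blast
    obtain e' where e': "e' \<in> U" "u' [^] i = e' \<otimes> x [^] i" using twisted_pow[OF c(2)] u'_def by blast
    have "u' [^] i = (e' \<otimes> inv e) \<otimes> u [^] i"
      unfolding e e' using e(1) e'(1) x U_nonzero[OF e(1)] by (simp add: m_assoc)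
    then have "z i = (e' \<otimes> inv e) \<otimes> (u [^] i \<otimes> inv (u [^] i))"
      unfolding z_def using e(1) e'(1) U_inv[OF e(1)] by (simp add: m_assoc)
    then show ?thesis using U_mult[OF e'(1) U_inv[OF e(1)]] by simp
  qed
  obtain N where N: "(\<Oplus>i\<in>{..<r}. s i [^] (N::nat) \<otimes> z i) \<noteq> \<zero>"
    using separate[of z] zU one_not_zero by (auto simp: z_def)
  define g where "g i = s i [^] N \<otimes> z i" for i
  have gU: "g i \<in> U" for i unfolding g_def by (intro U_mult U_pow s(1) zU)
  have gc [simp]: "g i \<in> carrier R" for i using gU by simp
  define b where "b = (\<Oplus>i\<in>{..<r}. g i)"
  have bU: "b \<in> U" using U_sum[of g r] gU N unfolding b_def g_def by auto
  have aN [simp]: "a [^] N \<in> carrier R" using a by simp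
  have g_eq: "g i = u' [^] i \<otimes> a [^] N \<otimes> inv (u [^] i)" for i
    unfolding g_def z_def u'_def twisted_pow_conj[OF c(2)]
    using s(1) twisted_closed[OF c(2)] by (simp add: m_assoc)
  have step: "u' \<otimes> g i = g (Suc i) \<otimes> u" for i
  proof -
    have "inv (u [^] Suc i) = inv (u [^] i) \<otimes> inv u"
      unfolding nat_pow_Suc2[OF u(1)]
      by (intro inv_eqI) (simp_all add: m_assoc)
    then have "inv (u [^] Suc i) \<otimes> u = inv (u [^] i)" by (simp add: m_assoc)
    then have "g (Suc i) \<otimes> u = u' [^] Suc i \<otimes> a [^] N \<otimes> inv (u [^] i)"
      unfolding g_eq[of "Suc i"] by (simp add: m_assoc del: nat_pow_Suc)
    then show ?thesis
      unfolding g_eq[of i] nat_pow_Suc2[OF u'(1)] by (simp add: m_assoc)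
  qed
  have zr: "u [^] r \<in> U" "u' [^] r = u [^] r"
    using \<nu>_U0[OF c(1)] eq by (auto simp: U0_def \<nu>_def u_def u'_def)
  have "g r = a [^] N \<otimes> (u [^] r \<otimes> inv (u [^] r))"
    unfolding g_eq zr(2) U_comm[OF zr(1) U_pow[OF a]] by (simp add: m_assoc)
  then have "g r = g 0" unfolding g_eq[of 0] by simp
  then have shift: "(\<Oplus>i\<in>{..<r}. g (Suc i)) = b"
    using finsum_shift[of g r] by (simp add: b_def)
  have "u' \<otimes> b = (\<Oplus>i\<in>{..<r}. u' \<otimes> g i)"
    unfolding b_def by (intro finsum_rdistr) auto
  also have "\<dots> = (\<Oplus>i\<in>{..<r}. g (Suc i) \<otimes> u)" unfolding step ..
  also have "\<dots> = b \<otimes> u"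
    unfolding shift[symmetric] by (intro finsum_ldistr[symmetric]) auto
  finally show ?thesis using bU unfolding u_def u'_def by blast
qed

lemma fiber_card:
  assumes c: "c \<in> U"
  shows "card {c' \<in> U. \<nu> c' = \<nu> c} * card U0 \<le> card U"
proof -
  define \<eta> where "\<eta> b = b \<otimes> (c \<otimes> x) \<otimes> inv (x \<otimes> b)" for b
  have xb: "x \<otimes> b \<in> carrier R" "x \<otimes> b \<noteq> \<zero>" if "b \<in> U" for b
    using that x U_nonzero by auto
  have sub: "{c' \<in> U. \<nu> c' = \<nu> c} \<subseteq> \<eta> ` U"
  proof
    fix c' assume "c' \<in> {c' \<in> U. \<nu> c' = \<nu> c}"
    then have c': "c' \<in> U" "\<nu> c = \<nu> c'" by auto
    obtain b where b: "b \<in> U" "c' \<otimes> x \<otimes> b = b \<otimes> (c \<otimes> x)"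
      using same_norm_conj[OF c c'] by blast
    have "\<eta> b = c' \<otimes> ((x \<otimes> b) \<otimes> inv (x \<otimes> b))"
      unfolding \<eta>_def b(2)[symmetric] using c'(1) b(1) x xb[OF b(1)] by (simp add: m_assoc)
    then have "\<eta> b = c'" using xb[OF b(1)] c'(1) by simp
    then show "c' \<in> \<eta> ` U" using b(1) by blast
  qed
  have inv: "\<eta> (b \<otimes> z) = \<eta> b" if b: "b \<in> U" and z: "z \<in> U0" for b z
  proof -
    have zU: "z \<in> U" and zx: "z \<otimes> x = x \<otimes> z" using z by (auto simp: U0_def)
    note [simp] = U_carrier[OF b] U_carrier[OF zU] U_carrier[OF c] x U_nonzero[OF zU] U_nonzero[OF b]
    have "z \<otimes> (c \<otimes> x) = c \<otimes> (z \<otimes> x)"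
      using U_comm[OF zU c] by (simp add: m_assoc[symmetric])
    also have "\<dots> = c \<otimes> x \<otimes> z" unfolding zx by (simp add: m_assoc)
    finally have 1: "b \<otimes> z \<otimes> (c \<otimes> x) = b \<otimes> (c \<otimes> x) \<otimes> z" by (simp add: m_assoc)
    have "inv (x \<otimes> (b \<otimes> z)) = inv z \<otimes> inv (x \<otimes> b)"
      by (intro inv_eqI) (simp_all add: m_assoc[symmetric], simp add: m_assoc)
    then show ?thesis
      unfolding \<eta>_def 1 by (simp add: m_assoc)
  qed
  have big: "card U0 \<le> card {b' \<in> U. \<eta> b' = \<eta> b}" if b: "b \<in> U" for b
  proof (rule card_inj_on_le)
    show "inj_on (\<lambda>z. b \<otimes> z) U0"
      by (rule inj_onI, rule mult_left_cancel[OF U_carrier[OF b] U_nonzero[OF b]])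
        (auto simp: U0_def)
    show "(\<lambda>z. b \<otimes> z) ` U0 \<subseteq> {b' \<in> U. \<eta> b' = \<eta> b}"
      using inv[OF b] U_mult[OF b] by (auto simp: U0_def)
  qed (use U_finite in simp)
  have "card U = (\<Sum>y \<in> \<eta> ` U. card {b \<in> U. \<eta> b = y})"
    using sum.image_gen[OF U_finite, of "\<lambda>_. 1::nat" \<eta>] by simp
  also have "\<dots> \<ge> (\<Sum>y \<in> \<eta> ` U. card U0)"
    by (rule sum_mono) (use big in auto)
  finally have "card (\<eta> ` U) * card U0 \<le> card U" by simp
  moreover have "card {c' \<in> U. \<nu> c' = \<nu> c} \<le> card (\<eta> ` U)"
    by (rule card_mono[OF _ sub]) (use U_finite in simp)
  ultimately show ?thesis by (meson le_trans mult_le_mono1)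
qed

lemma norm_surjective: "\<nu> ` U = U0"
proof (rule card_seteq)
  show "finite U0" using U_finite by (simp add: U0_def)
  show "\<nu> ` U \<subseteq> U0" using \<nu>_U0 by blast
  have "card U * card U0 = (\<Sum>y \<in> \<nu> ` U. card {c \<in> U. \<nu> c = y} * card U0)"
    using sum.image_gen[OF U_finite, of "\<lambda>_. 1::nat" \<nu>] by (simp add: sum_distrib_right)
  also have "\<dots> \<le> (\<Sum>y \<in> \<nu> ` U. card U)"
    by (rule sum_mono) (use fiber_card in auto)
  finally have "card U * card U0 \<le> card U * card (\<nu> ` U)" by (simp add: mult.commute)
  moreover have "card U > 0" using U_finite U_one by (auto simp: card_gt_0_iff)
  ultimately show "card U0 \<le> card (\<nu> ` U)" by simp
qed

lemma absurd: False
proof -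
  have "\<one> \<in> U0" using U_one x by (simp add: U0_def)
  then obtain c where c: "c \<in> U" "\<nu> c = \<one>" using norm_surjective by (metis imageE)
  define u where "u = c \<otimes> x"
  note u = twisted_closed[OF c(1), folded u_def]
  note conj = twisted_pow_conj[OF c(1), folded u_def]
  have "u \<noteq> \<one>"
  proof
    assume "u = \<one>"
    then have "a = s 1" using conj[of 1 1] a s(1)[of 1] by simp
    then show False using s1 by simp
  qed
  then have sum0: "(\<Oplus>i\<in>{..<r}. u [^] i) = \<zero>"
    using u(1) c(2) by (intro geometric_sum_zero) (auto simp: \<nu>_def u_def)
  have "(\<Oplus>i\<in>{..<r}. s i [^] N \<otimes> u [^] i) = \<zero>" for N :: nat
  proof -
    have "(\<Oplus>i\<in>{..<r}. s i [^] N \<otimes> u [^] i) = (\<Oplus>i\<in>{..<r}. u [^] i \<otimes> a [^] N)"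
      unfolding conj ..
    also have "\<dots> = (\<Oplus>i\<in>{..<r}. u [^] i) \<otimes> a [^] N"
      using u(1) a by (intro finsum_ldistr[symmetric]) auto
    finally show ?thesis using sum0 a by simp
  qed
  then show False using separate[of "\<lambda>i. u [^] i"] u(1) one_not_zero by auto
qed

end

context skew_field
begin

lemma finite_order_absurd:
  fixes k n p q :: nat
  assumes a: "a \<in> carrier R" "a \<noteq> \<zero>" "a [^] n = \<one>" "n \<noteq> 0"
    and x: "x \<in> carrier R" "x \<noteq> \<zero>" "x [^] q = \<one>" "q \<noteq> 0"
    and conj: "x \<otimes> a = a [^] k \<otimes> x" "a [^] k \<noteq> a"
    and p: "p \<noteq> 0" "add_pow R p \<one> = \<zero>"
  shows False
proof -
  obtain r :: nat where r: "r \<noteq> 0" "x [^] r \<otimes> a = a \<otimes> x [^] r"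
    "inj_on (\<lambda>i. a [^] (k ^ i)) {..<r}"
    by (rule commuting_power[OF a(1,3,4) x(1,2) conj(1)])
  define w where "w = x [^] r"
  have w [simp]: "w \<in> carrier R" using x(1) by (simp add: w_def)
  have wa: "w \<otimes> a = a \<otimes> w" using r(2) by (simp add: w_def)
  have xw: "x \<otimes> w = w \<otimes> x"
    unfolding w_def using nat_pow_Suc2[OF x(1), of r] by simp
  have wq: "w [^] q = \<one>"
    using nat_pow_pow[OF x(1), of r q] nat_pow_pow[OF x(1), of q r] x(3)
    by (simp add: w_def mult.commute)
  note [simp] = a(1) x(1)
  define h where "h i j = a [^] i \<otimes> w [^] j" for i j :: nat
  define H where "H = (\<lambda>(i, j). h i j) ` UNIV"
  have hH: "h i j \<in> H" for i j unfolding H_def by (rule image_eqI[of _ _ "(i, j)"]) auto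
  have HE: "\<exists>i j. y = h i j" if "y \<in> H" for y using that unfolding H_def by auto
  have hc [simp]: "h i j \<in> carrier R" for i j by (simp add: h_def)
  have Hc: "H \<subseteq> carrier R" using HE hc by fastforce
  have "H \<subseteq> (\<lambda>(y, z). y \<otimes> z) ` (((\<lambda>i. a [^] i) ` {..<n}) \<times> ((\<lambda>j. w [^] j) ` {..<q}))"
  proof
    fix y assume "y \<in> H"
    then obtain i j :: nat where "y = a [^] i \<otimes> w [^] j" using HE h_def by blast
    then show "y \<in> (\<lambda>(y, z). y \<otimes> z) ` (((\<lambda>i. a [^] i) ` {..<n}) \<times> ((\<lambda>j. w [^] j) ` {..<q}))"
      using finite_powers[OF a(1,3,4), of i] finite_powers[OF w wq x(4), of j]
      by (intro image_eqI[of _ _ "(a [^] i, w [^] j)"]) simp_all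
  qed
  then have Hfin: "finite H" by (rule finite_subset) simp
  have wai: "w [^] j \<otimes> a [^] i = a [^] i \<otimes> w [^] j" for i j :: nat
  proof (rule conj_pow)
    show "w [^] j \<otimes> a = a \<otimes> w [^] j"
      using conj_pow[of a w w j] wa by simp
  qed auto
  have hh: "h i j \<otimes> h i' j' = h (i + i') (j + j')" for i j i' j'
  proof -
    have "h i j \<otimes> h i' j' = a [^] i \<otimes> (w [^] j \<otimes> a [^] i') \<otimes> w [^] j'"
      unfolding h_def by (simp add: m_assoc)
    also have "\<dots> = (a [^] i \<otimes> a [^] i') \<otimes> (w [^] j \<otimes> w [^] j')"
      unfolding wai by (simp add: m_assoc)
    finally show ?thesis by (simp add: nat_pow_mult h_def)
  qed
  define A where "A = add_span H"
  have Ac [simp]: "y \<in> A \<Longrightarrow> y \<in> carrier R" for y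
    unfolding A_def by (rule add_span_closed[OF Hc])
  have HA: "y \<in> H \<Longrightarrow> y \<in> A" for y unfolding A_def by (rule add_span_incl[OF Hc])
  have Afin: "finite A" unfolding A_def by (rule finite_add_span[OF Hfin Hc p])
  have HAm: "y \<otimes> z \<in> A" if y: "y \<in> H" and z: "z \<in> A" for y z
    unfolding A_def
  proof (rule add_span_map[OF Hc, of "\<lambda>z. y \<otimes> z"])
    have yc: "y \<in> carrier R" using y Hc by blast
    show "y \<otimes> g \<in> add_span H" if g: "g \<in> H" for g
    proof -
      obtain i j i' j' where "y = h i j" "g = h i' j'" using HE[OF y] HE[OF g] by blast
      then have "y \<otimes> g = h (i + i') (j + j')" by (simp only: hh)
      then show ?thesis using HA[OF hH[of "i + i'" "j + j'"]] by (simp only: A_def)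
    qed
    show "y \<otimes> \<zero> = \<zero>" using yc by simp
    show "y \<otimes> (z \<oplus> z') = y \<otimes> z \<oplus> y \<otimes> z'" if "z \<in> carrier R" "z' \<in> carrier R" for z z'
      using yc that by (simp add: r_distr)
    show "z \<in> add_span H" using z by (simp only: A_def)
  qed
  have Am: "y \<otimes> z \<in> A" if y: "y \<in> A" and z: "z \<in> A" for y z
    unfolding A_def
  proof (rule add_span_map[OF Hc, of "\<lambda>y. y \<otimes> z"])
    show "g \<otimes> z \<in> add_span H" if "g \<in> H" for g using HAm[OF that z] by (simp only: A_def)
    show "y \<in> add_span H" using y by (simp only: A_def)
  qed (use z in \<open>simp_all add: l_distr\<close>)
  have span_cent: "A \<subseteq> cent B" if B: "H \<subseteq> cent B" "B \<subseteq> carrier R" for B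
  proof
    fix y assume "y \<in> A"
    then have "y \<in> add_span H" by (simp add: A_def)
    then show "y \<in> cent B"
      using B(1) div_subringD(2,6)[OF cent_div_subring[OF B(2)]]
      by (induction rule: add_span.induct) auto
  qed
  have "H \<subseteq> cent H"
  proof
    fix y assume y: "y \<in> H"
    have "y \<otimes> g = g \<otimes> y" if gH: "g \<in> H" for g
    proof -
      obtain i j i' j' where "y = h i j" "g = h i' j'" using HE[OF y] HE[OF gH] by blast
      then show ?thesis by (simp only: hh add.commute)
    qed
    then show "y \<in> cent H" using y Hc unfolding cent_def by blast
  qed
  then have AH: "A \<subseteq> cent H" by (rule span_cent) (rule Hc)
  have "H \<subseteq> cent A"
  proof
    fix y assume y: "y \<in> H"
    have "y \<otimes> z = z \<otimes> y" if "z \<in> A" for z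
      by (rule centD(2)[OF subsetD[OF AH that] y, symmetric])
    then show "y \<in> cent A" using y Hc unfolding cent_def by blast
  qed
  then have AA: "A \<subseteq> cent A" by (rule span_cent) (use Ac in blast)
  have Acomm: "y \<otimes> z = z \<otimes> y" if "y \<in> A" "z \<in> A" for y z
    by (rule centD(2)[OF subsetD[OF AA that(1)] that(2)])
  have Aconj: "x \<otimes> y \<otimes> inv x \<in> A" if y: "y \<in> A" for y
    unfolding A_def
  proof (rule add_span_map[OF Hc, of "\<lambda>y. x \<otimes> y \<otimes> inv x"])
    show "y \<in> add_span H" using y by (simp only: A_def)
    show "x \<otimes> g \<otimes> inv x \<in> add_span H" if gH: "g \<in> H" for g
    proof -
      obtain i j :: nat where g: "g = a [^] i \<otimes> w [^] j" using HE[OF gH] h_def by blast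
      have xa: "x \<otimes> a [^] i = a [^] (k * i) \<otimes> x"
        using conj_pow[OF x(1) a(1) _ conj(1), of i] by (simp add: nat_pow_pow)
      have xwj: "x \<otimes> w [^] j = w [^] j \<otimes> x" by (rule conj_pow) (use xw in auto)
      have "x \<otimes> g = x \<otimes> a [^] i \<otimes> w [^] j" unfolding g by (simp add: m_assoc)
      also have "\<dots> = a [^] (k * i) \<otimes> (x \<otimes> w [^] j)" unfolding xa by (simp add: m_assoc)
      also have "\<dots> = h (k * i) j \<otimes> x" unfolding xwj h_def by (simp add: m_assoc)
      finally have "x \<otimes> g \<otimes> inv x = h (k * i) j" using x(2) by (simp add: m_assoc)
      then show ?thesis using HA[OF hH[of "k * i" j]] by (simp only: A_def)
    qed
  qed (use x(2) in \<open>simp_all add: l_distr r_distr\<close>)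
  define U where "U = A - {\<zero>}"
  define s where "s i = a [^] (k ^ i)" for i
  have aH: "a [^] i \<in> A" for i :: nat using HA[OF hH[of i 0]] by (simp add: h_def)
  have aU: "a [^] i \<in> U" for i :: nat using aH pow_nonzero[OF a(1,2)] by (simp add: U_def)
  have "finite_cyclic_pair R U x a r s"
  proof
    show "finite U" "U \<subseteq> carrier R - {\<zero>}" using Afin Ac by (auto simp: U_def)
    show "\<one> \<in> U" using aU[of 0] by simp
    show "u \<otimes> v \<in> U" "u \<otimes> v = v \<otimes> u" if "u \<in> U" "v \<in> U" for u v
      using that Am Acomm by (auto simp: U_def)
    show "(\<Oplus>i\<in>{..<m::nat}. f i) \<in> insert \<zero> U" if "\<And>i. f i \<in> U" for f m
      using add_span_finsum[OF Hc, of "{..<m}" f] that by (auto simp: U_def A_def)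
    show "x \<otimes> u \<otimes> inv x \<in> U" if "u \<in> U" for u
      using that Aconj x(2) by (auto simp: U_def)
    show "x [^] r \<in> U"
      using HA[OF hH[of 0 1]] pow_nonzero[OF x(1,2)] by (simp add: U_def h_def w_def)
    show "a \<in> U" using aU[of 1] by simp
    show "s i \<in> U" for i unfolding s_def by (rule aU)
    show "x [^] i \<otimes> a = s i \<otimes> x [^] i" for i
      unfolding s_def by (rule pow_conj_pow[OF x(1) a(1) conj(1)])
    show "inj_on s {..<r}" using r(3) by (simp add: s_def[abs_def])
    show "s 1 \<noteq> a" using conj(2) by (simp add: s_def)
  qed (use x r in auto)
  then show False by (rule finite_cyclic_pair.absurd)
qed

lemma div_subring_skew_field:
  assumes S: "div_subring S"
  shows "skew_field (R\<lparr>carrier := S\<rparr>)"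
proof (intro skew_field.intro skew_field_axioms.intro)
  note SD = div_subringD[OF S]
  show "ring (R\<lparr>carrier := S\<rparr>)"
    using S unfolding div_subring_def by (intro subring_is_ring) auto
  show "\<one>\<^bsub>R\<lparr>carrier := S\<rparr>\<^esub> \<noteq> \<zero>\<^bsub>R\<lparr>carrier := S\<rparr>\<^esub>" using one_not_zero by simp
  show "Units (R\<lparr>carrier := S\<rparr>) = carrier (R\<lparr>carrier := S\<rparr>) - {\<zero>\<^bsub>R\<lparr>carrier := S\<rparr>\<^esub>}"
  proof
    show "Units (R\<lparr>carrier := S\<rparr>) \<subseteq> carrier (R\<lparr>carrier := S\<rparr>) - {\<zero>\<^bsub>R\<lparr>carrier := S\<rparr>\<^esub>}"
      using one_not_zero SD(1) unfolding Units_def by force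
    show "carrier (R\<lparr>carrier := S\<rparr>) - {\<zero>\<^bsub>R\<lparr>carrier := S\<rparr>\<^esub>} \<subseteq> Units (R\<lparr>carrier := S\<rparr>)"
    proof
      fix y assume "y \<in> carrier (R\<lparr>carrier := S\<rparr>) - {\<zero>\<^bsub>R\<lparr>carrier := S\<rparr>\<^esub>}"
      then have y: "y \<in> S" "y \<noteq> \<zero>" "y \<in> carrier R" using SD(1) by auto
      then show "y \<in> Units (R\<lparr>carrier := S\<rparr>)"
        using SD(8)[OF y(1,2)] unfolding Units_def by (auto intro!: bexI[of _ "inv y"])
    qed
  qed
qed

lemma div_subring_inv:
  assumes "div_subring S" "y \<in> S" "y \<noteq> \<zero>"
  shows "inv\<^bsub>R\<lparr>carrier := S\<rparr>\<^esub> y = inv y"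
proof -
  interpret S: skew_field "R\<lparr>carrier := S\<rparr>" by (rule div_subring_skew_field[OF assms(1)])
  have "y \<in> carrier R" using assms div_subringD(1) by blast
  then show ?thesis
    using assms div_subringD(8)[OF assms] by (intro S.inv_eqI) auto
qed

lemma infinite_order_absurd:
  fixes Ms :: "nat set"
  assumes a: "a \<in> carrier R" "a \<noteq> \<zero>" and x: "x \<in> carrier R" "a \<otimes> x \<noteq> x \<otimes> a"
    and w: "w \<in> carrier R" "w \<noteq> \<zero>" "a \<otimes> w = w \<otimes> a" "x \<otimes> w = w \<otimes> x"
      "\<And>q::nat. q \<noteq> 0 \<Longrightarrow> w [^] q \<noteq> \<one>"
    and Ms: "finite Ms" "\<And>M. M \<in> Ms \<Longrightarrow> add_pow R M \<one> \<noteq> \<zero>"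
    and per: "\<And>g. g \<in> carrier R \<Longrightarrow> g \<noteq> \<zero> \<Longrightarrow> \<exists>M \<in> Ms. (g \<otimes> a \<otimes> inv g \<otimes> inv a) [^] M = \<one>"
  shows False
proof -
  define S where "S = cent {w}"
  let ?S = "R\<lparr>carrier := S\<rparr>"
  have S: "div_subring S" unfolding S_def by (rule cent_div_subring) (use w in auto)
  note SD = div_subringD[OF S]
  interpret S: skew_field ?S by (rule div_subring_skew_field[OF S])
  have aS: "a \<in> S" and xS: "x \<in> S" and wS: "w \<in> S"
    using a x w by (auto simp: S_def cent_def)
  have x0: "x \<noteq> \<zero>" using x a by auto
  define T0 where "T0 = insert \<zero> (range (\<lambda>n::nat. w [^] n))"
  define T where "T = {t \<in> T0. \<one> \<oplus> t \<otimes> x \<noteq> \<zero>}"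
  have pw: "w [^] n \<in> S" for n :: nat using SD(3,5) wS by (induction n) auto
  have T0S: "t \<in> S" if "t \<in> T0" for t using that pw SD(2) by (auto simp: T0_def)
  have T0c: "t \<in> carrier R" if "t \<in> T0" for t using T0S[OF that] SD(1) by blast
  have T0comm: "t \<otimes> y = y \<otimes> t" if "t \<in> T0" "y \<in> S" for t y
  proof -
    have y: "y \<in> carrier R" "y \<otimes> w = w \<otimes> y" using \<open>y \<in> S\<close> by (auto simp: S_def cent_def)
    have "y \<otimes> w [^] n = w [^] n \<otimes> y" for n :: nat by (rule conj_pow) (use y w in auto)
    then show ?thesis using that(1) y by (auto simp: T0_def)
  qed
  have "inj (\<lambda>n::nat. w [^] n)"
  proof (rule linorder_injI)
    fix i j :: nat assume ij: "i < j"
    show "w [^] i \<noteq> w [^] j"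
    proof
      assume eq: "w [^] i = w [^] j"
      have "w [^] i \<otimes> w [^] (j - i) = w [^] i \<otimes> \<one>"
        using nat_pow_mult[OF w(1), of i "j - i"] ij eq w(1) by simp
      then have "w [^] (j - i) = \<one>"
        by (rule mult_left_cancel[OF _ pow_nonzero[OF w(1,2)], rotated 3]) (use w(1) in auto)
      then show False using w(5)[of "j - i"] ij by simp
    qed
  qed
  then have "infinite (range (\<lambda>n::nat. w [^] n))" using finite_imageD infinite_UNIV_nat by blast
  then have T0inf: "infinite T0" by (simp add: T0_def)
  have "t = t'" if "t \<in> T0 - T" "t' \<in> T0 - T" for t t'
  proof -
    have t: "t \<in> carrier R" "t' \<in> carrier R" "\<one> \<oplus> t \<otimes> x = \<zero>" "\<one> \<oplus> t' \<otimes> x = \<zero>"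
      using that T0c by (auto simp: T_def)
    then have "t \<otimes> x = t' \<otimes> x"
      using add.l_cancel[of \<one> "t \<otimes> x" "t' \<otimes> x"] x by simp
    then show ?thesis using mult_right_cancel[of x t t'] t x x0 by simp
  qed
  then have "finite (T0 - T)"
    by (metis finite.simps insertCI is_singletonI' is_singleton_def)
  moreover have "T \<subseteq> T0" by (auto simp: T_def)
  ultimately have Tinf: "infinite T" using T0inf Diff_infinite_finite by fastforce
  interpret T: central_evaluation ?S T
  proof
    show "T \<subseteq> ring_center ?S"
      using T0S T0comm unfolding ring_center_def T_def by auto
    show "\<zero>\<^bsub>?S\<^esub> \<in> T" using x one_not_zero by (simp add: T_def T0_def)
  qed (rule Tinf)
  have g: "\<one> \<oplus> t \<otimes> x \<in> S" "\<one> \<oplus> t \<otimes> x \<noteq> \<zero>" if "t \<in> T" for t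
    using that T0S xS SD(3,5,6) by (auto simp: T_def)
  show False
  proof (rule T.periodic_commutators_absurd[of a x Ms])
    fix t assume t: "t \<in> T"
    then show "\<one>\<^bsub>?S\<^esub> \<oplus>\<^bsub>?S\<^esub> t \<otimes>\<^bsub>?S\<^esub> x \<noteq> \<zero>\<^bsub>?S\<^esub>" using g by simp
    define y where "y = \<one> \<oplus> t \<otimes> x"
    have y: "y \<in> S" "y \<noteq> \<zero>" "y \<in> carrier R" using g[OF t] SD(1) by (auto simp: y_def)
    obtain M where "M \<in> Ms" "(y \<otimes> a \<otimes> inv y \<otimes> inv a) [^] M = \<one>" using per y by blast
    then show "\<exists>M \<in> Ms. ((\<one>\<^bsub>?S\<^esub> \<oplus>\<^bsub>?S\<^esub> t \<otimes>\<^bsub>?S\<^esub> x) \<otimes>\<^bsub>?S\<^esub> a \<otimes>\<^bsub>?S\<^esub> inv\<^bsub>?S\<^esub> (\<one>\<^bsub>?S\<^esub> \<oplus>\<^bsub>?S\<^esub> t \<otimes>\<^bsub>?S\<^esub> x)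
        \<otimes>\<^bsub>?S\<^esub> inv\<^bsub>?S\<^esub> a) [^]\<^bsub>?S\<^esub> M = \<one>\<^bsub>?S\<^esub>"
      using div_subring_inv[OF S y(1,2)] div_subring_inv[OF S aS a(2)]
      by (intro bexI[of _ M]) (simp_all add: y_def nat_pow_consistent[symmetric])
  next
    fix M assume "M \<in> Ms"
    then show "add_pow ?S M \<one>\<^bsub>?S\<^esub> \<noteq> \<zero>\<^bsub>?S\<^esub>"
      using Ms(2) by (simp add: add_pow_def nat_pow_def)
  qed (use a x aS xS Ms(1) in simp_all)
qed

lemma finite_center_absurd:
  assumes fin: "finite (ring_center R)"
    and N: "N \<subseteq> carrier R - {\<zero>}" "\<And>x y. x \<in> N \<Longrightarrow> y \<in> N \<Longrightarrow> x \<otimes> y \<in> N"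
      "\<And>x. x \<in> N \<Longrightarrow> inv x \<in> N"
      "\<And>g x. g \<in> carrier R \<Longrightarrow> g \<noteq> \<zero> \<Longrightarrow> x \<in> N \<Longrightarrow> g \<otimes> x \<otimes> inv g \<in> N"
    and nc: "\<not> N \<subseteq> ring_center R"
    and alg: "algebraic_of_bounded_degree (ring_center R) d N"
  shows False
proof -
  let ?F = "ring_center R"
  note F = center_subfield
  have Fsub: "\<zero> \<in> ?F" "\<one> \<in> ?F" "?F \<subseteq> carrier R"
    using subringE(1,2,3)[OF subfieldE(1)[OF F]] by auto
  define Q where "Q = card ?F"
  have Q: "Q \<noteq> 0" using fin Fsub by (auto simp: Q_def)
  define Ms where "Ms = {M. M \<noteq> 0 \<and> M \<le> Q ^ d \<and> add_pow R M \<one> \<noteq> \<zero>}"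
  have Ms: "finite Ms" by (rule finite_subset[of _ "{..Q ^ d}"]) (auto simp: Ms_def)
  have per: "\<exists>M \<in> Ms. y [^] M = \<one>" if y: "y \<in> N" for y
  proof -
    let ?G = "generate_field R (insert y ?F)"
    have yc: "y \<in> carrier R" "y \<noteq> \<zero>" using y N(1) by auto
    have G: "subfield ?G R" by (rule generate_field_center_subfield[OF yc(1)])
    define m where "m = (dim over ?F) ?G"
    have m: "dimension m ?F ?G" "m \<le> d"
      using alg y finite_dimensionE[OF F] unfolding algebraic_of_bounded_degree_def m_def by auto
    obtain Vs where Vs: "set Vs \<subseteq> carrier R" "length Vs = m" "Span ?F Vs = ?G"
      using exists_base[OF F m(1)] by blast
    have Geq: "?G = (\<lambda>Ks. combine Ks Vs) ` {Ks. set Ks \<subseteq> ?F \<and> length Ks = m}"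
      using Span_eq_combine_set_length_version[OF F Vs(1)] Vs(2,3) by auto
    have finL: "finite {Ks. set Ks \<subseteq> ?F \<and> length Ks = m}"
      by (rule finite_lists_length_eq[OF fin])
    have Gfin: "finite ?G" unfolding Geq using finL by simp
    have "card ?G \<le> card {Ks. set Ks \<subseteq> ?F \<and> length Ks = m}"
      unfolding Geq by (rule card_image_le[OF finL])
    also have "\<dots> = Q ^ m" unfolding Q_def by (rule card_lists_length_eq[OF fin])
    also have "\<dots> \<le> Q ^ d" using m(2) Q by (intro power_increasing) auto
    finally have cG: "card ?G \<le> Q ^ d" .
    define M where "M = card ?G - 1"
    have G01: "\<zero> \<in> ?G" "\<one> \<in> ?G" "y \<in> ?G"
      using subringE(2,3)[OF subfieldE(1)[OF G]] by (auto intro: generate_field.incl)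
    have "card {\<zero>, \<one>} \<le> card ?G" by (rule card_mono[OF Gfin]) (use G01 in auto)
    then have c2: "2 \<le> card ?G" using one_not_zero by simp
    have "add_pow R (Suc M) \<one> = \<zero>"
      using finite_subfield_order(1)[OF G Gfin] c2 by (simp add: M_def)
    then have "add_pow R M \<one> \<oplus> \<one> = \<zero>" by simp
    then have "add_pow R M \<one> \<noteq> \<zero>" using one_not_zero by auto
    then have "M \<in> Ms" using c2 cG by (auto simp: Ms_def M_def)
    moreover have "y [^] M = \<one>"
      unfolding M_def by (rule finite_subfield_order(2)[OF G Gfin G01(3) yc(2)])
    ultimately show ?thesis by blast
  qed
  obtain a where a: "a \<in> N" "a \<notin> ?F" using nc by blast
  then have ac: "a \<in> carrier R" "a \<noteq> \<zero>" using N(1) by auto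
  obtain y where y: "y \<in> carrier R" "a \<otimes> y \<noteq> y \<otimes> a"
    using a(2) ac(1) unfolding ring_center_def by blast
  obtain n :: nat where n: "n \<noteq> 0" "a [^] n = \<one>" using per[OF a(1)] by (auto simp: Ms_def)
  obtain x and k :: nat where x: "x \<in> carrier R" "x \<noteq> \<zero>" "x \<otimes> a = a [^] k \<otimes> x" "a [^] k \<noteq> a"
    by (rule conjugate_to_other_power[OF ac n(2,1) y])
  obtain r :: nat where r: "r \<noteq> 0" "x [^] r \<otimes> a = a \<otimes> x [^] r"
    by (rule commuting_power[OF ac(1) n(2,1) x(1-3)])
  show False
  proof (cases "\<exists>q::nat. q \<noteq> 0 \<and> x [^] q = \<one>")
    case True
    then obtain q :: nat where "q \<noteq> 0" "x [^] q = \<one>" by blast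
    then show False
      using finite_order_absurd[OF ac n(2,1) x(1,2) _ _ x(3,4) Q]
        finite_subfield_order(1)[OF F fin] by (simp add: Q_def)
  next
    case False
    define w where "w = x [^] r"
    have wq: "w [^] q \<noteq> \<one>" if "q \<noteq> 0" for q :: nat
    proof
      assume "w [^] q = \<one>"
      then have "x [^] (r * q) = \<one>" using nat_pow_pow[OF x(1), of r q] by (simp add: w_def)
      moreover have "r * q \<noteq> 0" using r(1) that by simp
      ultimately show False using False by blast
    qed
    show False
    proof (rule infinite_order_absurd[of a x w Ms])
      show "a \<otimes> x \<noteq> x \<otimes> a"
      proof
        assume "a \<otimes> x = x \<otimes> a"
        then have "a \<otimes> x = a [^] k \<otimes> x" using x(3) by simp
        then have "a = a [^] k"
          by (rule mult_right_cancel[OF x(1,2), rotated 2]) (use ac in auto)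
        then show False using x(4) by simp
      qed
      show "w \<in> carrier R" "w \<noteq> \<zero>" "a \<otimes> w = w \<otimes> a"
        using x(1) pow_nonzero[OF x(1,2)] r(2) by (simp_all add: w_def)
      show "x \<otimes> w = w \<otimes> x" using nat_pow_Suc2[OF x(1), of r] by (simp add: w_def)
      show "\<exists>M \<in> Ms. (g \<otimes> a \<otimes> inv g \<otimes> inv a) [^] M = \<one>" if "g \<in> carrier R" "g \<noteq> \<zero>" for g
        by (rule per) (intro N(2,3,4) that a(1))
      show "add_pow R M \<one> \<noteq> \<zero>" if "M \<in> Ms" for M using that by (simp add: Ms_def)
    qed (use ac x Ms wq in auto)
  qed
qed

end

theorem theorem4p1:
  fixes D :: "('a, 'b) ring_scheme" (structure)
    and F N :: "'a set" and d :: nat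
  assumes "skew_field D"
    and "F = ring_center D"
    and "d > 0"
    and "N \<lhd> units_of D"
    and "\<not> N \<subseteq> F"
    and "ring.algebraic_of_bounded_degree D F d N"
  shows "ring.finite_dimension D F (carrier D) \<and> (ring.dim D over F) (carrier D) \<le> d\<^sup>2"
proof -
  interpret D: skew_field D by (rule assms(1))
  interpret N: normal N "units_of D" by (rule assms(4))
  note sub = normal_imp_subgroup[OF assms(4)]
  have units: "carrier (units_of D) = carrier D - {\<zero>}"
    by (simp add: units_of_carrier D.skew_field_Units)
  have N1: "N \<subseteq> carrier D - {\<zero>}" using subgroup.subset[OF sub] units by simp
  have N2: "x \<otimes> y \<in> N" if "x \<in> N" "y \<in> N" for x y
    using subgroup.m_closed[OF sub that] by (simp add: units_of_mult)
  have inv: "inv\<^bsub>units_of D\<^esub> x = inv x" if "x \<in> carrier D" "x \<noteq> \<zero>" for x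
    using that D.units_of_inv by (simp add: D.Units_iff)
  have N3: "inv x \<in> N" if "x \<in> N" for x
  proof -
    have "inv\<^bsub>units_of D\<^esub> x = inv x" by (rule inv) (use N1 that in auto)
    then show ?thesis using subgroup.m_inv_closed[OF sub that] by metis
  qed
  have N4: "g \<otimes> x \<otimes> inv g \<in> N" if "g \<in> carrier D" "g \<noteq> \<zero>" "x \<in> N" for g x
    using N.inv_op_closed2[of g x] inv[of g] units that by (simp add: units_of_mult)
  show ?thesis
  proof (cases "finite F")
    case True
    then show ?thesis
      using D.finite_center_absurd[of N d] N1 N2 N3 N4 assms(2,5,6) by blast
  next
    case False
    then show ?thesis
      using D.dimension_bound_infinite_center[of N d] N1 N2 N3 N4 assms(2,5,6) by simp
  qed
qed

end
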